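(* Let $\Omega\subset\mathbb{R}^n$ be bounded, open and of class $C^\infty$, and let $\Omega'\subset\subset\Omega$ be open. Let $$\mathcal{F}'(\Omega)=\mathcal{E}'(\Omega')+\Big(\bigcup_{0\le k\le\infty,\,1\le p\le\infty}W^{k,p}(\Omega)\Big)\subset\mathcal{D}'(\Omega).$$ Let $E$ be a linear extension operator as described in the context, and let $\phi_\epsilon$ be as described in the context. Then the map $$i:\mathcal{F}'(\Omega)\to\mathcal{G}(\overline{\Omega}),\qquad i(u)=\big((E(u)\ast\phi_\epsilon)|_{\overline{\Omega}}\big)_{\epsilon\in(0,1]}+\mathcal{N}(\overline{\Omega}),$$ is a well-defined, linear, injective map (a linear embedding of $\mathcal{F}'(\Omega)$ into $\mathcal{G}(\overline{\Omega})$).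
   Context: $\mathcal{E}'(\Omega')$ denotes compactly supported distributions on $\Omega'$, viewed inside $\mathcal{D}'(\Omega)$. The extension operator $E$ is linear; for every $0\le k\le\infty$, $1\le p\le\infty$ it maps $W^{k,p}(\Omega)$ boundedly into $W^{k,p}(\mathbb{R}^n)$ with $E(u)|_\Omega=u$; and it is extended to $\mathcal{E}'(\Omega')$ so that for $u\in\mathcal{E}'(\Omega')$, $E(u)\in\mathcal{D}'(\mathbb{R}^n)$ with $E(u)|_\Omega=u$ and $E(u)|_{\mathbb{R}^n\setminus\Omega}=0$ (the two definitions being consistent on the intersection). Let $\psi\in\mathcal{S}(\mathbb{R}^n)$ with $\psi\equiv1$ on a neighbourhood of $0$, $\phi=\mathcal{F}^{-1}[\psi]\in\mathcal{S}(\mathbb{R}^n)$ (so $\int\phi=1$ and $\int x^\beta\phi\,dx=0$ for $|\beta|\ge1$), and $\phi_\epsilon(x)=\epsilon^{-n}\phi(x/\epsilon)$. Colombeau algebra: $\mathcal{E}_M(\overline{\Omega})$ is the set of nets $(u_\epsilon)_{\epsilon\in(0,1]}$ in $C^\infty(\overline{\Omega})$ such that for every $k\in\mathbb{N}$ there is $a\in\mathbb{R}$ with $\sup\{|D^\beta u_\epsilon(x)|:|\beta|\le k,\ x\in\overline{\Omega}\}=O(\epsilon^a)$ as $\epsilon\to0$; $\mathcal{N}(\overline{\Omega})$ is the set of nets in $\mathcal{E}_M(\overline{\Omega})$ for which this holds for every $a\in\mathbb{R}$; $\mathcal{G}(\overline{\Omega})=\mathcal{E}_M(\overline{\Omega})/\mathcal{N}(\overline{\Omega})$,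 with componentwise operations. *)

theory Defs
  imports "HOL-Analysis.Analysis"
begin

definition pdiff :: "'n::finite \<Rightarrow> (real^'n \<Rightarrow> 'b::real_normed_vector) \<Rightarrow> real^'n \<Rightarrow> 'b" where
  "pdiff i f x = vector_derivative (\<lambda>t. f (x + t *\<^sub>R axis i 1)) (at 0)"

text \<open>Iterated partial derivative D^beta; a multi-index beta of order |beta| is
  represented by the list of the coordinate directions (order |beta| = length).\<close>
fun Dl :: "'n::finite list \<Rightarrow> (real^'n \<Rightarrow> 'b::real_normed_vector) \<Rightarrow> real^'n \<Rightarrow> 'b" where
  "Dl [] f = f"
| "Dl (i # is) f = pdiff i (Dl is f)"

definition smooth_on :: "(real^'n::finite) set \<Rightarrow> (real^'n \<Rightarrow> 'b::real_normed_vector) \<Rightarrow> bool" where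
  "smooth_on S f \<longleftrightarrow> (\<forall>\<beta>. continuous_on S (Dl \<beta> f) \<and>
      (\<forall>i. \<forall>x\<in>S. (\<lambda>t. Dl \<beta> f (x + t *\<^sub>R axis i 1)) differentiable (at 0)))"

definition smooth_domain :: "(real^'n::finite) set \<Rightarrow> bool" where
  "smooth_domain \<Omega> \<longleftrightarrow> open \<Omega> \<and> bounded \<Omega> \<and>
     (\<forall>x0\<in>frontier \<Omega>. \<exists>r>0. \<exists>\<rho>::real^'n \<Rightarrow> real.
        smooth_on (ball x0 r) \<rho> \<and>
        \<Omega> \<inter> ball x0 r = {x\<in>ball x0 r. \<rho> x < 0} \<and>
        (\<forall>x\<in>ball x0 r. \<rho> x = 0 \<longrightarrow> (\<exists>i. Dl [i] \<rho> x \<noteq> 0)))"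

definition tsupp :: "(real^'n::finite \<Rightarrow> complex) \<Rightarrow> (real^'n) set" where
  "tsupp \<phi> = closure {x. \<phi> x \<noteq> 0}"

definition test_fun :: "(real^'n::finite) set \<Rightarrow> (real^'n \<Rightarrow> complex) \<Rightarrow> bool" where
  "test_fun U \<phi> \<longleftrightarrow> smooth_on UNIV \<phi> \<and> compact (tsupp \<phi>) \<and> tsupp \<phi> \<subseteq> U"

type_synonym 'n distr = "(real^'n \<Rightarrow> complex) \<Rightarrow> complex"

text \<open>D'(U): linear functionals on C_c^infinity(U) with the usual continuity estimate.
  Two functionals represent the same distribution iff they agree on all test functions.\<close>
definition distribution :: "(real^'n::finite) set \<Rightarrow> 'n distr \<Rightarrow> bool" where
  "distribution U T \<longleftrightarrow>
     (\<forall>\<phi> \<psi> a b. test_fun U \<phi> \<longrightarrow> test_fun U \<psi> \<longrightarrow>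
        T (\<lambda>x. a * \<phi> x + b * \<psi> x) = a * T \<phi> + b * T \<psi>) \<and>
     (\<forall>K. compact K \<and> K \<subseteq> U \<longrightarrow> (\<exists>C N. \<forall>\<phi> M. test_fun U \<phi> \<and> tsupp \<phi> \<subseteq> K \<and>
        (\<forall>\<beta> x. length \<beta> \<le> N \<longrightarrow> norm (Dl \<beta> \<phi> x) \<le> M) \<longrightarrow> norm (T \<phi>) \<le> C * M))"

definition dist_eq :: "(real^'n::finite) set \<Rightarrow> 'n distr \<Rightarrow> 'n distr \<Rightarrow> bool" where
  "dist_eq U T S \<longleftrightarrow> (\<forall>\<phi>. test_fun U \<phi> \<longrightarrow> T \<phi> = S \<phi>)"

definition fdist :: "(real^'n::finite) set \<Rightarrow> (real^'n \<Rightarrow> complex) \<Rightarrow> 'n distr" where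
  "fdist U w = (\<lambda>\<phi>. set_lebesgue_integral lebesgue U (\<lambda>x. w x * \<phi> x))"

text \<open>E'(Omega'), viewed inside D'(Omega): distributions on Omega whose support is a compact
  subset of Omega' (i.e. they vanish on Omega minus some compact K in Omega').\<close>
definition compact_distr :: "(real^'n::finite) set \<Rightarrow> (real^'n) set \<Rightarrow> 'n distr \<Rightarrow> bool" where
  "compact_distr \<Omega> \<Omega>' T \<longleftrightarrow> distribution \<Omega> T \<and>
     (\<exists>K. compact K \<and> K \<subseteq> \<Omega>' \<and>
        (\<forall>\<phi>. test_fun \<Omega> \<phi> \<and> tsupp \<phi> \<inter> K = {} \<longrightarrow> T \<phi> = 0))"

definition Lp :: "(real^'n::finite) set \<Rightarrow> ennreal \<Rightarrow> (real^'n \<Rightarrow> complex) \<Rightarrow> bool" where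
  "Lp U p g \<longleftrightarrow> g \<in> borel_measurable lebesgue \<and>
     (if p = \<infinity> then (\<exists>C. AE x in lebesgue. x \<in> U \<longrightarrow> norm (g x) \<le> C)
      else set_nn_integral lebesgue U (\<lambda>x. ennreal (norm (g x) powr enn2real p)) < \<infinity>)"

definition Lp_norm :: "(real^'n::finite) set \<Rightarrow> ennreal \<Rightarrow> (real^'n \<Rightarrow> complex) \<Rightarrow> real" where
  "Lp_norm U p g = (if p = \<infinity> then Inf {C. C \<ge> 0 \<and> (AE x in lebesgue. x \<in> U \<longrightarrow> norm (g x) \<le> C)}
      else (enn2real (set_nn_integral lebesgue U (\<lambda>x. ennreal (norm (g x) powr enn2real p))))
             powr (1 / enn2real p))"

definition weak_deriv :: "(real^'n::finite) set \<Rightarrow> 'n list \<Rightarrow> (real^'n \<Rightarrow> complex) \<Rightarrow> (real^'n \<Rightarrow> complex) \<Rightarrow> bool" where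
  "weak_deriv U \<beta> u g \<longleftrightarrow> (\<forall>\<phi>. test_fun U \<phi> \<longrightarrow>
     set_lebesgue_integral lebesgue U (\<lambda>x. u x * Dl \<beta> \<phi> x)
       = (-1) ^ length \<beta> * set_lebesgue_integral lebesgue U (\<lambda>x. g x * \<phi> x))"

definition sobolev :: "(real^'n::finite) set \<Rightarrow> enat \<Rightarrow> ennreal \<Rightarrow> (real^'n \<Rightarrow> complex) \<Rightarrow> bool" where
  "sobolev U k p u \<longleftrightarrow> 1 \<le> p \<and> Lp U p u \<and>
     (\<forall>\<beta>. enat (length \<beta>) \<le> k \<longrightarrow> (\<exists>g. Lp U p g \<and> weak_deriv U \<beta> u g))"

definition wderiv :: "(real^'n::finite) set \<Rightarrow> ennreal \<Rightarrow> 'n list \<Rightarrow> (real^'n \<Rightarrow> complex) \<Rightarrow> (real^'n \<Rightarrow> complex)" where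
  "wderiv U p \<beta> u = (SOME g. Lp U p g \<and> weak_deriv U \<beta> u g)"

definition sobolev_norm :: "(real^'n::finite) set \<Rightarrow> nat \<Rightarrow> ennreal \<Rightarrow> (real^'n \<Rightarrow> complex) \<Rightarrow> real" where
  "sobolev_norm U k p u = (\<Sum>\<beta>\<in>{\<beta>::'n list. length \<beta> \<le> k}. Lp_norm U p (wderiv U p \<beta> u))"

definition Fprime :: "(real^'n::finite) set \<Rightarrow> (real^'n) set \<Rightarrow> 'n distr \<Rightarrow> bool" where
  "Fprime \<Omega> \<Omega>' T \<longleftrightarrow> (\<exists>v w k p. compact_distr \<Omega> \<Omega>' v \<and> sobolev \<Omega> k p w \<and>
      dist_eq \<Omega> T (\<lambda>\<phi>. v \<phi> + fdist \<Omega> w \<phi>))"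

definition schwartz :: "(real^'n::finite \<Rightarrow> complex) \<Rightarrow> bool" where
  "schwartz f \<longleftrightarrow> smooth_on UNIV f \<and> (\<forall>\<beta> m. \<exists>C. \<forall>x. norm x ^ m * norm (Dl \<beta> f x) \<le> C)"

definition inv_fourier :: "(real^'n::finite \<Rightarrow> complex) \<Rightarrow> real^'n \<Rightarrow> complex" where
  "inv_fourier \<psi> x = integral\<^sup>L lborel (\<lambda>\<xi>. cis (2 * pi * (x \<bullet> \<xi>)) * \<psi> \<xi>)"

definition mollifier :: "(real^'n::finite \<Rightarrow> complex) \<Rightarrow> real \<Rightarrow> real^'n \<Rightarrow> complex" where
  "mollifier \<psi> \<epsilon> x = complex_of_real (1 / \<epsilon> ^ CARD('n)) * inv_fourier \<psi> ((1 / \<epsilon>) *\<^sub>R x)"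

definition cutoff :: "real^'n::finite \<Rightarrow> complex" where
  "cutoff = (SOME c. test_fun UNIV c \<and> (\<forall>x\<in>cball 0 1. c x = 1))"

text \<open>Convolution (T * f)(x) = T(f(x - .)) of a tempered distribution T on R^n with a
  Schwartz function f, T being applied through its (unique) continuous extension to S,
  computed as the limit of T on the truncations chi(./j) f(x - .).\<close>
definition tconv :: "'n::finite distr \<Rightarrow> (real^'n \<Rightarrow> complex) \<Rightarrow> real^'n \<Rightarrow> complex" where
  "tconv T f x = lim (\<lambda>j::nat. T (\<lambda>y. cutoff ((1 / real (Suc j)) *\<^sub>R y) * f (x - y)))"

text \<open>A net in C^infinity(closure Omega): smooth in Omega, all derivatives extend continuously
  to the closure.  The sup over closure Omega of such a derivative equals its sup over Omega,
  so the estimates below are taken over Omega.\<close>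
definition smooth_closure :: "(real^'n::finite) set \<Rightarrow> (real^'n \<Rightarrow> complex) \<Rightarrow> bool" where
  "smooth_closure \<Omega> f \<longleftrightarrow> smooth_on \<Omega> f \<and>
     (\<forall>\<beta>. \<exists>g. continuous_on (closure \<Omega>) g \<and> (\<forall>x\<in>\<Omega>. g x = Dl \<beta> f x))"

definition moderate :: "(real^'n::finite) set \<Rightarrow> (real \<Rightarrow> real^'n \<Rightarrow> complex) \<Rightarrow> bool" where
  "moderate \<Omega> u \<longleftrightarrow> (\<forall>\<epsilon>\<in>{0<..1}. smooth_closure \<Omega> (u \<epsilon>)) \<and>
     (\<forall>k::nat. \<exists>a C. \<exists>\<epsilon>0>0. \<forall>\<epsilon>. 0 < \<epsilon> \<and> \<epsilon> < \<epsilon>0 \<longrightarrow>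
        (\<forall>\<beta> x. length \<beta> \<le> k \<and> x \<in> \<Omega> \<longrightarrow> norm (Dl \<beta> (u \<epsilon>) x) \<le> C * \<epsilon> powr a))"

definition negligible :: "(real^'n::finite) set \<Rightarrow> (real \<Rightarrow> real^'n \<Rightarrow> complex) \<Rightarrow> bool" where
  "negligible \<Omega> u \<longleftrightarrow> moderate \<Omega> u \<and>
     (\<forall>k::nat. \<forall>a. \<exists>C. \<exists>\<epsilon>0>0. \<forall>\<epsilon>. 0 < \<epsilon> \<and> \<epsilon> < \<epsilon>0 \<longrightarrow>
        (\<forall>\<beta> x. length \<beta> \<le> k \<and> x \<in> \<Omega> \<longrightarrow> norm (Dl \<beta> (u \<epsilon>) x) \<le> C * \<epsilon> powr a))"

definition colombeau_net :: "('n::finite distr \<Rightarrow> 'n distr) \<Rightarrow> (real^'n \<Rightarrow> complex) \<Rightarrow> 'n distr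
    \<Rightarrow> real \<Rightarrow> real^'n \<Rightarrow> complex" where
  "colombeau_net E \<psi> u = (\<lambda>\<epsilon> x. tconv (E u) (mollifier \<psi> \<epsilon>) x)"

end

theory Submission
  imports Defs "HOL-Probability.Probability" "HOL-Computational_Algebra.Polynomial"
begin

text \<open>For \<open>u\<close> in the domain, \<open>T = E u\<close> is tempered: \<open>\<bar>T f\<bar>\<close> is bounded by a seminorm
  \<open>sup (1 + \<bar>x\<bar>\<^sup>2)\<^sup>m \<bar>D\<^sup>\<alpha> f\<bar>\<close>, \<open>\<bar>\<alpha>\<bar> \<le> N\<close>. A compactly supported part gives \<open>m = 0\<close>; an
  \<open>L\<^sup>p\<close> part is bounded by a constant plus an integrable function, which gives
  \<open>N = 0\<close>, \<open>m = n\<close>. Derivatives of \<open>T * \<phi>\<^sub>\<epsilon>\<close> fall on \<open>\<phi>\<^sub>\<epsilon>\<close>, whose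
  seminorms grow like a power of \<open>1/\<epsilon>\<close>; hence moderateness. For injectivity, \<open>\<integral> \<phi> = \<psi>(0) = 1\<close>
  makes \<open>T (\<theta> * \<phi>\<^sub>\<epsilon> reflected)\<close> converge to \<open>T \<theta>\<close> for test functions \<open>\<theta>\<close>, while this pairing is an average of
  values of \<open>T * \<phi>\<^sub>\<epsilon>\<close> on the support of \<open>\<theta>\<close> and so vanishes in the limit for a negligible net.\<close>

section \<open>Calculus with partial derivatives along the axes\<close>

text \<open>Derivatives are taken along the axes and multi-indices are lists, so symmetry of mixed
  derivatives is not built in. It is read off on the Fourier side, where the derivatives of
  \<open>inv_fourier \<psi>\<close> become commuting multipliers, and dilations inherit it.
  Increments in a general direction are estimated by changing one coordinate at a time, and
  derivatives pass inside an integral or a functional by a remainder of size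
  \<open>t\<^sup>2\<close> in the relevant norm. Since \<open>tconv\<close> is a limit over
  truncations, convergence has to be established first: the truncation error decays like
  \<open>1 / Suc j\<close> in every weighted seminorm. That the integral of the mollifier profile
  equals \<open>\<psi> 0\<close> is Fourier inversion at one point, obtained by Gaussian summation.
  All errors in the injectivity argument are linear in \<open>\<epsilon>\<close>, so negligibility
  is read off at order 0 with exponent 1. The union in \<open>Fprime\<close> mixes exponents
  \<open>p\<close>. Boundedness of \<open>\<Omega>\<close> places every member in L^1, which makes
  \<open>Fprime\<close> a vector space and reduces injectivity to the single distribution
  \<open>u - v\<close>.\<close>

abbreviation smooth :: "(real^'n::finite \<Rightarrow> 'b::real_normed_vector) \<Rightarrow> bool" where
  "smooth \<equiv> smooth_on UNIV"

abbreviation has_pd :: "(real^'n::finite \<Rightarrow> 'b::real_normed_vector) \<Rightarrow> 'b \<Rightarrow> 'n \<Rightarrow> real^'n \<Rightarrow> bool" where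
  "has_pd f D i x \<equiv> ((\<lambda>t. f (x + t *\<^sub>R axis i 1)) has_vector_derivative D) (at 0)"

lemma pdiff_eqI: "has_pd f D i x \<Longrightarrow> pdiff i f x = D"
  by (simp add: pdiff_def vector_derivative_at)

text \<open>\<open>has_pd\<close> looks at parameter 0 only, whereas the mean value inequality on a
  segment needs the derivative at every parameter \<open>s\<close>; translating the parameter
  bridges the two.\<close>

lemma has_pd_line:
  assumes "has_pd f D i (x + s *\<^sub>R axis i 1)"
  shows "((\<lambda>t. f (x + t *\<^sub>R axis i 1)) has_vector_derivative D) (at s)"
proof -
  have "((\<lambda>t::real. t - s) has_vector_derivative 1) (at s)"
    by (auto intro!: derivative_eq_intros)
  moreover have "((\<lambda>t. f ((x + s *\<^sub>R axis i 1) + t *\<^sub>R axis i 1)) has_vector_derivative D) (at (s - s))"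
    using assms by simp
  ultimately have "((\<lambda>t. f ((x + s *\<^sub>R axis i 1) + t *\<^sub>R axis i 1)) \<circ> (\<lambda>t. t - s) has_vector_derivative 1 *\<^sub>R D) (at s)"
    by (rule vector_diff_chain_at)
  then show ?thesis
    by (simp add: o_def algebra_simps)
qed

lemma Dl_append: "Dl (\<alpha> @ \<beta>) f = Dl \<alpha> (Dl \<beta> f)"
  by (induction \<alpha>) auto

lemma smooth_cont: "smooth f \<Longrightarrow> continuous_on S (Dl \<beta> f)"
  unfolding smooth_on_def by (meson continuous_on_subset subset_UNIV)

lemma smooth_cont0: "smooth f \<Longrightarrow> continuous_on S f"
  using smooth_cont[of f S "[]"] by simp

lemma smooth_pd: "smooth f \<Longrightarrow> has_pd (Dl \<beta> f) (Dl (i # \<beta>) f x) i x"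
  unfolding smooth_on_def by (simp add: pdiff_def vector_derivative_works)

lemma smooth_pd0: "smooth f \<Longrightarrow> has_pd f (pdiff i f x) i x"
  using smooth_pd[of f "[]"] by simp

lemma smooth_Dl: "smooth f \<Longrightarrow> smooth (Dl \<beta> f)"
  unfolding smooth_on_def Dl_append[symmetric] by blast

lemma smooth_pdiff: "smooth f \<Longrightarrow> smooth (pdiff i f)"
  using smooth_Dl[of f "[i]"] by simp

text \<open>Smoothness stratified by order, so that closure properties follow by induction on the order.\<close>

primrec smooth_ord :: "nat \<Rightarrow> (real^'n::finite \<Rightarrow> 'b::real_normed_vector) \<Rightarrow> bool" where
  "smooth_ord 0 f \<longleftrightarrow> continuous_on UNIV f"
| "smooth_ord (Suc n) f \<longleftrightarrow> continuous_on UNIV f \<and>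
     (\<forall>i. (\<forall>x. has_pd f (pdiff i f x) i x) \<and> smooth_ord n (pdiff i f))"

lemma smooth_ordI:
  assumes "continuous_on UNIV f" "\<And>i x. has_pd f (g i x) i x" "\<And>i. smooth_ord n (g i)"
  shows "smooth_ord (Suc n) f"
proof -
  have "pdiff i f = g i" for i
    using assms(2) by (intro ext pdiff_eqI)
  then show ?thesis using assms by simp
qed

lemma smooth_ord_Suc: "smooth_ord (Suc n) f \<Longrightarrow> smooth_ord n f"
proof (induction n arbitrary: f)
  case (Suc n)
  then show ?case by (metis smooth_ord.simps(2))
qed simp

lemma smooth_imp_ord: "smooth f \<Longrightarrow> smooth_ord n f"
  by (induction n arbitrary: f) (auto intro: smooth_cont0 smooth_pd0 smooth_pdiff)

lemma smooth_ord_imp: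
  "smooth_ord (Suc (length \<beta>)) f \<Longrightarrow>
     continuous_on UNIV (Dl \<beta> f) \<and> has_pd (Dl \<beta> f) (pdiff i (Dl \<beta> f) x) i x"
\<comment> \<open>The last entry of the list acts first, so induction from the right peels off the
  derivative that \<open>smooth_ord\<close> exposes.\<close>
proof (induction \<beta> arbitrary: f rule: rev_induct)
  case (snoc j \<beta>)
  from snoc.prems have "smooth_ord (Suc (length \<beta>)) (pdiff j f)" by simp
  from snoc.IH[OF this] show ?case by (simp add: Dl_append)
qed auto

lemma smooth_iff_ord: "smooth f \<longleftrightarrow> (\<forall>n. smooth_ord n f)"
proof
  assume *: "\<forall>n. smooth_ord n f"
  show "smooth f"
    unfolding smooth_on_def
    using smooth_ord_imp[OF *[rule_format]] by (auto intro: differentiableI_vector)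
qed (auto intro: smooth_imp_ord)

text \<open>A coinduction principle: a family closed under differentiation needs only one check of
  continuity and of first derivatives. It is used with the multiples of a character, with all
  inverse Fourier transforms and with all convolutions.\<close>

lemma smoothI_family:
  assumes "f \<in> \<F>"
    and "\<And>g. g \<in> \<F> \<Longrightarrow> continuous_on UNIV g"
    and "\<And>g i x. g \<in> \<F> \<Longrightarrow> has_pd g (D g i x) i x"
    and "\<And>g i. g \<in> \<F> \<Longrightarrow> D g i \<in> \<F>"
  shows "smooth f"
proof -
  have "\<forall>f\<in>\<F>. smooth_ord n f" for n
  proof (induction n)
    case (Suc n)
    show ?case
    proof
      fix g assume g: "g \<in> \<F>"
      show "smooth_ord (Suc n) g"
        by (rule smooth_ordI[where g = "D g"]) (use Suc g assms(2-4) in blast)+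
    qed
  qed (use assms(2) in auto)
  then show ?thesis using assms(1) by (auto simp: smooth_iff_ord)
qed

lemma smooth_const [simp]: "smooth (\<lambda>x. c)"
proof (rule smoothI_family[where \<F> = "range (\<lambda>c x. c)" and D = "\<lambda>g i x. 0"])
  fix g :: "real^'a \<Rightarrow> 'b" and i x
  assume "g \<in> range (\<lambda>c x. c)"
  then show "has_pd g 0 i x" by auto
qed auto

lemma pdiff_const [simp]: "pdiff i (\<lambda>x. c) = (\<lambda>x. 0)"
  by (intro ext pdiff_eqI) auto

lemma Dl_zero [simp]: "Dl \<beta> (\<lambda>x. 0) = (\<lambda>x. 0)"
  by (induction \<beta>) auto

lemma Dl_const: "Dl \<beta> (\<lambda>x. c) = (\<lambda>x. if \<beta> = [] then c else 0)"
  by (induction \<beta>) auto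

lemma smooth_ord_add: "smooth_ord n f \<Longrightarrow> smooth_ord n g \<Longrightarrow> smooth_ord n (\<lambda>x. f x + g x)"
proof (induction n arbitrary: f g)
  case (Suc n)
  show ?case
  proof (rule smooth_ordI[where g = "\<lambda>i x. pdiff i f x + pdiff i g x"])
    show "continuous_on UNIV (\<lambda>x. f x + g x)"
      using Suc.prems by (auto intro: continuous_intros)
    show "has_pd (\<lambda>x. f x + g x) (pdiff i f x + pdiff i g x) i x" for i x
      using Suc.prems by (intro has_vector_derivative_add) auto
  qed (use Suc in auto)
qed (auto intro: continuous_intros)

lemma smooth_add: "smooth f \<Longrightarrow> smooth g \<Longrightarrow> smooth (\<lambda>x. f x + g x)"
  by (simp add: smooth_iff_ord smooth_ord_add)

lemma smooth_ord_mult: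
  fixes f g :: "real^'n::finite \<Rightarrow> complex"
  shows "smooth_ord n f \<Longrightarrow> smooth_ord n g \<Longrightarrow> smooth_ord n (\<lambda>x. f x * g x)"
proof (induction n arbitrary: f g)
  case (Suc n)
  show ?case
  proof (rule smooth_ordI[where g = "\<lambda>i x. f x * pdiff i g x + pdiff i f x * g x"])
    show "continuous_on UNIV (\<lambda>x. f x * g x)"
      using Suc.prems by (auto intro: continuous_intros)
    show "has_pd (\<lambda>x. f x * g x) (f x * pdiff i g x + pdiff i f x * g x) i x" for i x
      using has_vector_derivative_mult[of "\<lambda>t. f (x + t *\<^sub>R axis i 1)" _ 0 UNIV "\<lambda>t. g (x + t *\<^sub>R axis i 1)"]
        Suc.prems by simp
    show "smooth_ord n (\<lambda>x. f x * pdiff i g x + pdiff i f x * g x)" for i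
      using Suc.prems by (auto intro!: smooth_ord_add Suc.IH simp del: smooth_ord.simps dest: smooth_ord_Suc)
        (simp_all)
  qed
qed (auto intro: continuous_intros)

lemma smooth_mult:
  fixes f g :: "real^'n::finite \<Rightarrow> complex"
  shows "smooth f \<Longrightarrow> smooth g \<Longrightarrow> smooth (\<lambda>x. f x * g x)"
  by (simp add: smooth_iff_ord smooth_ord_mult)

text \<open>The derivative of \<open>1 / f\<close> contains \<open>1 / f\<close> again, but is
  needed to one order less, so the product rule for \<open>smooth_ord\<close> closes the
  induction.\<close>

lemma smooth_inverse:
  fixes f :: "real^'n::finite \<Rightarrow> complex"
  assumes f: "smooth f" and nz: "\<And>x. f x \<noteq> 0"
  shows "smooth (\<lambda>x. inverse (f x))"
proof -
  have "smooth_ord n (\<lambda>x. inverse (f x))" for n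
  proof (induction n)
    case 0
    show ?case using continuous_on_inverse[OF smooth_cont0[OF f]] nz by simp
  next
    case (Suc n)
    show ?case
    proof (rule smooth_ordI[where g = "\<lambda>i x. (- 1) * (inverse (f x) * pdiff i f x * inverse (f x))"])
      show "continuous_on UNIV (\<lambda>x. inverse (f x))"
        using continuous_on_inverse[OF smooth_cont0[OF f]] nz by simp
      show "has_pd (\<lambda>x. inverse (f x)) ((- 1) * (inverse (f x) * pdiff i f x * inverse (f x))) i x" for i x
      proof -
        have "((\<lambda>t. f (x + t *\<^sub>R axis i 1)) has_derivative (\<lambda>t. t *\<^sub>R pdiff i f x)) (at 0)"
          using smooth_pd0[OF f] by (simp add: has_vector_derivative_def)
        from Deriv.has_derivative_inverse[OF _ this] nz show ?thesis
          by (simp add: has_vector_derivative_def)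
      qed
      show "smooth_ord n (\<lambda>x. (- 1) * (inverse (f x) * pdiff i f x * inverse (f x)))" for i
        by (intro smooth_ord_mult Suc smooth_imp_ord smooth_pdiff f smooth_const)
    qed
  qed
  then show ?thesis using smooth_iff_ord by blast
qed

lemma smooth_cmult: "smooth f \<Longrightarrow> smooth (\<lambda>x. (c::complex) * f x)"
  by (intro smooth_mult smooth_const)

lemma smooth_diff:
  fixes f g :: "real^'n::finite \<Rightarrow> complex"
  assumes "smooth f" "smooth g" shows "smooth (\<lambda>x. f x - g x)"
  using smooth_add[OF assms(1) smooth_cmult[OF assms(2), of "-1"]] by simp

lemma smooth_prod:
  fixes f :: "'a \<Rightarrow> real^'n::finite \<Rightarrow> complex"
  shows "(\<And>i. i \<in> A \<Longrightarrow> smooth (f i)) \<Longrightarrow> smooth (\<lambda>x. \<Prod>i\<in>A. f i x)"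
  by (induction A rule: infinite_finite_induct) (auto intro: smooth_mult)

lemma smooth_sum:
  fixes f :: "'a \<Rightarrow> real^'n::finite \<Rightarrow> complex"
  shows "(\<And>i. i \<in> A \<Longrightarrow> smooth (f i)) \<Longrightarrow> smooth (\<lambda>x. \<Sum>i\<in>A. f i x)"
  by (induction A rule: infinite_finite_induct) (auto intro: smooth_add)

lemma pdiff_mult:
  fixes f g :: "real^'n::finite \<Rightarrow> complex"
  assumes "smooth f" "smooth g"
  shows "pdiff i (\<lambda>x. f x * g x) = (\<lambda>x. f x * pdiff i g x + pdiff i f x * g x)"
proof (intro ext pdiff_eqI)
  fix x
  show "has_pd (\<lambda>x. f x * g x) (f x * pdiff i g x + pdiff i f x * g x) i x"
    using has_vector_derivative_mult[OF smooth_pd0[OF assms(1), where i=i and x=x] smooth_pd0[OF assms(2)]] by simp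
qed

lemma pdiff_add:
  assumes "smooth f" "smooth g"
  shows "pdiff i (\<lambda>x. f x + g x) = (\<lambda>x. pdiff i f x + pdiff i g x)"
  by (intro ext pdiff_eqI has_vector_derivative_add smooth_pd0 assms)

lemma Dl_add:
  assumes "smooth f" "smooth g"
  shows "Dl \<beta> (\<lambda>x. f x + g x) = (\<lambda>x. Dl \<beta> f x + Dl \<beta> g x)"
  by (induction \<beta>) (use assms in \<open>auto simp: pdiff_add smooth_Dl\<close>)

lemma Dl_cmult:
  assumes "smooth f"
  shows "Dl \<beta> (\<lambda>x. (c::complex) * f x) = (\<lambda>x. c * Dl \<beta> f x)"
  by (induction \<beta>) (use assms in \<open>auto simp: pdiff_mult smooth_Dl\<close>)

lemma Dl_lin:
  fixes f g :: "real^'n::finite \<Rightarrow> complex"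
  assumes "smooth f" "smooth g"
  shows "Dl \<beta> (\<lambda>x. a * f x + b * g x) = (\<lambda>x. a * Dl \<beta> f x + b * Dl \<beta> g x)"
  using assms by (simp add: Dl_add Dl_cmult smooth_cmult)

lemma Dl_diff:
  fixes f g :: "real^'n::finite \<Rightarrow> complex"
  assumes "smooth f" "smooth g"
  shows "Dl \<beta> (\<lambda>x. f x - g x) = (\<lambda>x. Dl \<beta> f x - Dl \<beta> g x)"
  using Dl_lin[OF assms, where a=1 and b="-1"] by simp

lemma Dl_sum:
  fixes f :: "'a \<Rightarrow> real^'n::finite \<Rightarrow> complex"
  shows "(\<And>i. i \<in> A \<Longrightarrow> smooth (f i)) \<Longrightarrow>
     Dl \<beta> (\<lambda>x. \<Sum>i\<in>A. f i x) = (\<lambda>x. \<Sum>i\<in>A. Dl \<beta> (f i) x)"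
  by (induction A rule: infinite_finite_induct) (auto simp: Dl_add smooth_sum)

lemma Dl_local:
  assumes "open S" "\<And>x. x \<in> S \<Longrightarrow> f x = g x"
  shows "x \<in> S \<Longrightarrow> Dl \<beta> f x = Dl \<beta> g x"
proof (induction \<beta> arbitrary: x)
  case (Cons i \<beta>)
  have "((\<lambda>t. x + t *\<^sub>R axis i 1) \<longlongrightarrow> x + 0 *\<^sub>R axis i (1::real)) (at 0)"
    by (intro tendsto_intros)
  then have "((\<lambda>t. x + t *\<^sub>R axis i 1) \<longlongrightarrow> x) (at (0::real))" by simp
  then have "eventually (\<lambda>t. x + t *\<^sub>R axis i 1 \<in> S) (at (0::real))"
    using assms(1) Cons.prems topological_tendstoD by blast
  then have ev: "eventually (\<lambda>t. Dl \<beta> f (x + t *\<^sub>R axis i 1) = Dl \<beta> g (x + t *\<^sub>R axis i 1)) (at (0::real))"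
    by (rule eventually_mono) (rule Cons.IH, assumption)
  have eq0: "Dl \<beta> f x = Dl \<beta> g x" by (rule Cons.IH) (rule Cons.prems)
  \<comment> \<open>Differentiability is not assumed: \<open>vector_derivative\<close> is a choice
    from a predicate, so it is enough that the predicates for \<open>f\<close> and \<open>g\<close>
    coincide.\<close>
  have "has_pd (Dl \<beta> f) D i x \<longleftrightarrow> has_pd (Dl \<beta> g) D i x" for D
    unfolding has_vector_derivative_def
  proof
    assume "((\<lambda>t. Dl \<beta> f (x + t *\<^sub>R axis i 1)) has_derivative (\<lambda>t. t *\<^sub>R D)) (at 0)"
    from has_derivative_transform_eventually[OF this ev] eq0
    show "((\<lambda>t. Dl \<beta> g (x + t *\<^sub>R axis i 1)) has_derivative (\<lambda>t. t *\<^sub>R D)) (at 0)" by simp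
  next
    assume "((\<lambda>t. Dl \<beta> g (x + t *\<^sub>R axis i 1)) has_derivative (\<lambda>t. t *\<^sub>R D)) (at 0)"
    from has_derivative_transform_eventually[OF this eventually_mono[OF ev sym]] eq0
    show "((\<lambda>t. Dl \<beta> f (x + t *\<^sub>R axis i 1)) has_derivative (\<lambda>t. t *\<^sub>R D)) (at 0)" by simp
  qed
  then show ?case by (simp add: pdiff_def vector_derivative_def)
qed (use assms in auto)

text \<open>A crude Leibniz rule: each derivative doubles the number of terms, and every resulting
  product is at most \<open>A * B\<close>.\<close>

lemma norm_Dl_mult_le:
  fixes f g :: "real^'n::finite \<Rightarrow> complex"
  assumes "smooth f" "smooth g"
    and "\<And>\<beta>. length \<beta> \<le> length \<alpha> \<Longrightarrow> norm (Dl \<beta> f x) \<le> A"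
    and "\<And>\<beta>. length \<beta> \<le> length \<alpha> \<Longrightarrow> norm (Dl \<beta> g x) \<le> B"
  shows "norm (Dl \<alpha> (\<lambda>x. f x * g x) x) \<le> 2 ^ length \<alpha> * A * B"
  using assms
proof (induction \<alpha> arbitrary: f g rule: rev_induct)
  case Nil
  have "0 \<le> A" using order_trans[OF norm_ge_zero Nil.prems(3)[of "[]"]] by simp
  with Nil.prems(3)[of "[]"] Nil.prems(4)[of "[]"] show ?case
    by (auto simp: norm_mult intro!: mult_mono)
next
  case (snoc i \<alpha>)
  have 1: "norm (Dl \<alpha> (\<lambda>x. f x * pdiff i g x) x) \<le> 2 ^ length \<alpha> * A * B"
  proof (rule snoc.IH)
    fix \<beta> :: "'n list" assume "length \<beta> \<le> length \<alpha>"
    then show "norm (Dl \<beta> (pdiff i g) x) \<le> B" using snoc.prems(4)[of "\<beta> @ [i]"] by (simp add: Dl_append)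
  qed (use snoc.prems in \<open>auto intro: smooth_pdiff\<close>)
  have 2: "norm (Dl \<alpha> (\<lambda>x. pdiff i f x * g x) x) \<le> 2 ^ length \<alpha> * A * B"
  proof (rule snoc.IH)
    fix \<beta> :: "'n list" assume "length \<beta> \<le> length \<alpha>"
    then show "norm (Dl \<beta> (pdiff i f) x) \<le> A" using snoc.prems(3)[of "\<beta> @ [i]"] by (simp add: Dl_append)
  qed (use snoc.prems in \<open>auto intro: smooth_pdiff\<close>)
  have "Dl (\<alpha> @ [i]) (\<lambda>x. f x * g x) x
      = Dl \<alpha> (\<lambda>x. f x * pdiff i g x) x + Dl \<alpha> (\<lambda>x. pdiff i f x * g x) x"
    using snoc.prems by (simp add: Dl_append pdiff_mult Dl_add smooth_mult smooth_pdiff)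
  moreover have "norm (Dl \<alpha> (\<lambda>x. f x * pdiff i g x) x + Dl \<alpha> (\<lambda>x. pdiff i f x * g x) x)
      \<le> 2 ^ length \<alpha> * A * B + 2 ^ length \<alpha> * A * B"
    using 1 2 by (rule norm_triangle_mono)
  ultimately show ?case by (simp add: mult_ac)
qed

lemma has_pd_affine:
  assumes "has_pd f D i (a + c *\<^sub>R y)"
  shows "has_pd (\<lambda>y. k *\<^sub>R f (a + c *\<^sub>R y)) (k *\<^sub>R (c *\<^sub>R D)) i y"
proof -
  have "((\<lambda>t::real. c * t) has_vector_derivative c) (at 0)"
    by (auto intro!: derivative_eq_intros)
  moreover have "((\<lambda>t. f ((a + c *\<^sub>R y) + t *\<^sub>R axis i 1)) has_vector_derivative D) (at (c * 0))"
    using assms by simp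
  ultimately have "((\<lambda>t. f ((a + c *\<^sub>R y) + t *\<^sub>R axis i 1)) \<circ> (\<lambda>t. c * t) has_vector_derivative c *\<^sub>R D) (at 0)"
    by (rule vector_diff_chain_at)
  then have "has_pd (\<lambda>y. f (a + c *\<^sub>R y)) (c *\<^sub>R D) i y"
    by (simp add: o_def algebra_simps)
  then show ?thesis
    by (intro bounded_linear.has_vector_derivative[OF bounded_linear_scaleR_right])
qed

lemma Dl_affine:
  assumes "smooth f"
  shows "Dl \<beta> (\<lambda>y. f (a + c *\<^sub>R y)) = (\<lambda>y. c ^ length \<beta> *\<^sub>R Dl \<beta> f (a + c *\<^sub>R y))"
proof (induction \<beta>)
  case (Cons i \<beta>)
  have "pdiff i (\<lambda>y. c ^ length \<beta> *\<^sub>R Dl \<beta> f (a + c *\<^sub>R y))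
      = (\<lambda>y. c ^ length \<beta> *\<^sub>R (c *\<^sub>R Dl (i # \<beta>) f (a + c *\<^sub>R y)))"
    by (intro ext pdiff_eqI has_pd_affine smooth_pd assms)
  then show ?case using Cons.IH by (simp add: mult.commute)
qed simp

lemma smooth_affine:
  assumes "smooth f"
  shows "smooth (\<lambda>y. f (a + c *\<^sub>R y))"
proof (rule smoothI_family[where \<F> = "{\<lambda>y. k *\<^sub>R Dl \<beta> f (a + c *\<^sub>R y) | k \<beta>. True}" and D = "\<lambda>g i x. pdiff i g x"])
  show "(\<lambda>y. f (a + c *\<^sub>R y)) \<in> {\<lambda>y. k *\<^sub>R Dl \<beta> f (a + c *\<^sub>R y) | k \<beta>. True}"
    by (rule CollectI, rule exI[of _ 1], rule exI[of _ "[]"]) simp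
next
  fix g assume "g \<in> {\<lambda>y. k *\<^sub>R Dl \<beta> f (a + c *\<^sub>R y) | k \<beta>. True}"
  then obtain k \<beta> where g: "g = (\<lambda>y. k *\<^sub>R Dl \<beta> f (a + c *\<^sub>R y))" by auto
  have "continuous_on UNIV (Dl \<beta> f \<circ> (\<lambda>y. a + c *\<^sub>R y))"
    by (intro continuous_on_compose continuous_intros) (auto intro: smooth_cont assms)
  then show "continuous_on UNIV g"
    unfolding g by (auto simp: o_def intro: continuous_intros)
  have pd: "has_pd g (k *\<^sub>R (c *\<^sub>R Dl (i # \<beta>) f (a + c *\<^sub>R y))) i y" for i y
    unfolding g by (intro has_pd_affine smooth_pd assms)
  fix i
  have "pdiff i g = (\<lambda>y. (k * c) *\<^sub>R Dl (i # \<beta>) f (a + c *\<^sub>R y))"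
    using pdiff_eqI[OF pd] by (intro ext) simp
  then show "pdiff i g \<in> {\<lambda>y. k *\<^sub>R Dl \<beta> f (a + c *\<^sub>R y) | k \<beta>. True}"
    by blast
  show "has_pd g (pdiff i g y) i y" for y
    using pd pdiff_eqI[OF pd] by simp
qed

section \<open>Weighted estimates and Schwartz functions\<close>

lemma vector_derivative_bound:
  fixes f :: "real \<Rightarrow> 'b::real_normed_vector"
  assumes "convex S" "\<And>t. t \<in> S \<Longrightarrow> (f has_vector_derivative f' t) (at t)"
    "\<And>t. t \<in> S \<Longrightarrow> norm (f' t) \<le> B" "a \<in> S" "b \<in> S"
  shows "norm (f b - f a) \<le> B * \<bar>b - a\<bar>"
proof -
  have "norm (f b - f a) \<le> B * norm (b - a)"
  proof (rule differentiable_bound[OF assms(1)])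
    fix t assume t: "t \<in> S"
    show "(f has_derivative (\<lambda>h. h *\<^sub>R f' t)) (at t within S)"
      using assms(2)[OF t] by (simp add: has_vector_derivative_def has_derivative_at_withinI)
    show "onorm (\<lambda>h. h *\<^sub>R f' t) \<le> B"
      using assms(3)[OF t] by (intro onorm_le) (simp add: mult.commute[of B] mult_left_mono)
  qed (use assms in auto)
  then show ?thesis by simp
qed

text \<open>The mean value inequality is applied twice, first to \<open>h'\<close> and then to
  \<open>h s - s *\<^sub>R h' 0\<close>. This loses the factor 1/2 of Taylor's formula, which is
  harmless.\<close>

lemma taylor_bound:
  fixes h :: "real \<Rightarrow> 'b::real_normed_vector"
  assumes "\<And>s. (h has_vector_derivative h' s) (at s)" "\<And>s. (h' has_vector_derivative h'' s) (at s)"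
    and "\<And>s. \<bar>s\<bar> \<le> \<bar>t\<bar> \<Longrightarrow> norm (h'' s) \<le> B"
  shows "norm (h t - h 0 - t *\<^sub>R h' 0) \<le> B * t\<^sup>2"
proof -
  let ?S = "{-\<bar>t\<bar>..\<bar>t\<bar>}"
  have B: "0 \<le> B" using order_trans[OF norm_ge_zero assms(3)[of 0]] by simp
  have 1: "norm (h' s - h' 0) \<le> B * \<bar>t\<bar>" if "s \<in> ?S" for s
  proof -
    have "norm (h' s - h' 0) \<le> B * \<bar>s - 0\<bar>"
      by (rule vector_derivative_bound[of ?S _ h'']) (use assms that in auto)
    also have "\<dots> \<le> B * \<bar>t\<bar>" using that B by (intro mult_left_mono) auto
    finally show ?thesis .
  qed
  have "norm ((h t - t *\<^sub>R h' 0) - (h 0 - 0 *\<^sub>R h' 0)) \<le> (B * \<bar>t\<bar>) * \<bar>t - 0\<bar>"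
  proof (rule vector_derivative_bound[of ?S _ "\<lambda>s. h' s - h' 0"])
    fix s show "((\<lambda>s. h s - s *\<^sub>R h' 0) has_vector_derivative h' s - h' 0) (at s)"
      using assms(1) by (auto intro!: derivative_eq_intros)
  qed (use 1 in auto)
  moreover have "(B * \<bar>t\<bar>) * \<bar>t - 0\<bar> = B * t\<^sup>2"
    by (simp add: power2_eq_square)
  moreover have "(h t - t *\<^sub>R h' 0) - (h 0 - 0 *\<^sub>R h' 0) = h t - h 0 - t *\<^sub>R h' 0"
    by simp
  ultimately show ?thesis by metis
qed

text \<open>Serves to differentiate \<open>inv_fourier f\<close> and convolutions: a second-order
  remainder, estimated uniformly under the integral or the functional, already gives the
  derivative.\<close>

lemma has_vector_derivative_quadratic:
  fixes h :: "real \<Rightarrow> 'b::real_normed_vector"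
  assumes "\<And>t. \<bar>t\<bar> \<le> 1 \<Longrightarrow> norm (h t - h 0 - t *\<^sub>R d) \<le> K * t\<^sup>2"
  shows "(h has_vector_derivative d) (at 0)"
  unfolding has_vector_derivative_def has_derivative_at
proof (intro conjI bounded_linear_scaleR_left)
  have K: "0 \<le> K" using order_trans[OF norm_ge_zero assms[of 1]] by simp
  have "((\<lambda>t. K * \<bar>t\<bar>) \<longlongrightarrow> 0) (at (0::real))"
    by (auto intro!: tendsto_eq_intros)
  moreover have "\<forall>\<^sub>F t in at (0::real). norm (norm (h (0 + t) - h 0 - t *\<^sub>R d) / norm t) \<le> K * \<bar>t\<bar>"
    unfolding eventually_at
  proof (intro exI[of _ 1] conjI ballI impI)
    fix t :: real assume "t \<noteq> 0 \<and> dist t 0 < 1"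
    then show "norm (norm (h (0 + t) - h 0 - t *\<^sub>R d) / norm t) \<le> K * \<bar>t\<bar>"
      using assms[of t] by (simp add: field_simps power2_eq_square)
  qed auto
  ultimately show "(\<lambda>t. norm (h (0 + t) - h 0 - t *\<^sub>R d) / norm t) \<midarrow>0\<rightarrow> 0"
    by (rule Lim_null_comparison[rotated])
qed

text \<open>Takes the place of the mean value theorem in several variables. The path from
  \<open>x\<close> to \<open>y\<close> changes one coordinate at a time, so axis derivatives
  suffice, and it stays in the box spanned by the two points, where alone \<open>D\<close> has to be
  controlled.\<close>

lemma coordinate_telescope:
  fixes F :: "real^'n::finite \<Rightarrow> 'b::real_normed_vector"
  assumes pd: "\<And>i z. (\<And>j. \<bar>z$j - x$j\<bar> \<le> \<bar>y$j - x$j\<bar>) \<Longrightarrow> has_pd F (D i z) i z \<and> norm (D i z) \<le> B"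
  shows "norm (F y - F x) \<le> B * (\<Sum>i\<in>UNIV. \<bar>y$i - x$i\<bar>)"
proof -
  define Q where "Q S = (\<chi> i. if i \<in> S then y$i else x$i)" for S
  have "norm (F (Q S) - F x) \<le> B * (\<Sum>i\<in>S. \<bar>y$i - x$i\<bar>)" for S
  proof (induction S rule: finite_induct[OF finite])
    case 1
    have "Q {} = x" by (simp add: Q_def vec_eq_iff)
    then show ?case by simp
  next
    case (2 i S)
    define d where "d = y$i - x$i"
    have Qi: "Q (insert i S) = Q S + d *\<^sub>R axis i 1"
      using 2 by (auto simp: Q_def vec_eq_iff axis_def d_def)
    have seg: "\<bar>(Q S + t *\<^sub>R axis i 1)$j - x$j\<bar> \<le> \<bar>y$j - x$j\<bar>" if "t \<in> closed_segment 0 d" for t j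
      using 2 that by (auto simp: Q_def axis_def d_def closed_segment_eq_real_ivl split: if_splits)
    have "norm (F (Q S + d *\<^sub>R axis i 1) - F (Q S + 0 *\<^sub>R axis i 1)) \<le> B * \<bar>d - 0\<bar>"
    proof (rule vector_derivative_bound[of "closed_segment 0 d"])
      fix t assume t: "t \<in> closed_segment 0 d"
      show "((\<lambda>t. F (Q S + t *\<^sub>R axis i 1)) has_vector_derivative D i (Q S + t *\<^sub>R axis i 1)) (at t)"
        by (rule has_pd_line) (use pd[OF seg[OF t]] in blast)
      show "norm (D i (Q S + t *\<^sub>R axis i 1)) \<le> B"
        using pd[OF seg[OF t]] by blast
    qed auto
    then have "norm (F (Q (insert i S)) - F (Q S)) \<le> B * \<bar>d\<bar>" by (simp add: Qi)
    moreover have "norm (F (Q (insert i S)) - F x) \<le> norm (F (Q (insert i S)) - F (Q S)) + norm (F (Q S) - F x)"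
      using norm_triangle_ineq[of "F (Q (insert i S)) - F (Q S)" "F (Q S) - F x"] by simp
    ultimately show ?case using 2 by (simp add: d_def algebra_simps)
  qed
  from this[of UNIV] show ?thesis by (simp add: Q_def)
qed

section \<open>Polynomial weights\<close>

definition wt :: "real^'n::finite \<Rightarrow> real" where "wt x = 1 + (norm x)\<^sup>2"

lemma wt_ge1: "1 \<le> wt x" by (simp add: wt_def)
lemma wt_pos: "0 < wt x" using wt_ge1[of x] by simp
lemma wt_nonneg: "0 \<le> wt x" using wt_ge1[of x] by simp
lemma wt_power_ge1: "1 \<le> wt x ^ m" by (simp add: one_le_power wt_ge1)
lemma wt_power_nonneg: "0 \<le> wt x ^ m" by (simp add: wt_nonneg)
lemma wt_power_pos: "0 < wt x ^ m" by (simp add: wt_pos)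
lemma wt_minus [simp]: "wt (- x) = wt x" by (simp add: wt_def)
lemma wt_power_mono: "m \<le> k \<Longrightarrow> wt x ^ m \<le> wt x ^ k" by (simp add: power_increasing wt_ge1)
lemma wt_mono: "norm x \<le> norm y \<Longrightarrow> wt x \<le> wt y" by (simp add: wt_def power_mono)

text \<open>Peetre's inequality. It lets a weight at \<open>y\<close> be exchanged for weights at
  \<open>x\<close> and \<open>x - y\<close> in every convolution estimate below.\<close>

lemma wt_add: "wt (a + b) \<le> 2 * wt a * wt b"
proof -
  have "(norm (a + b))\<^sup>2 \<le> (norm a + norm b)\<^sup>2"
    by (intro power_mono norm_triangle_ineq norm_ge_zero)
  also have "\<dots> \<le> 2 * (norm a)\<^sup>2 + 2 * (norm b)\<^sup>2"
    using sum_squares_bound[of "norm a" "norm b"] by (simp add: power2_sum)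
  finally have "(norm (a + b))\<^sup>2 \<le> 2 * (norm a)\<^sup>2 + 2 * (norm b)\<^sup>2" .
  moreover have "2 * wt a * wt b = 2 + 2 * (norm a)\<^sup>2 + 2 * (norm b)\<^sup>2 + 2 * ((norm a)\<^sup>2 * (norm b)\<^sup>2)"
    by (simp add: wt_def algebra_simps)
  moreover have "0 \<le> (norm a)\<^sup>2 * (norm b)\<^sup>2" by simp
  ultimately show ?thesis unfolding wt_def[of "a + b"] by linarith
qed

lemma wt_diff: "wt (a - b) \<le> 2 * wt a * wt b"
  using wt_add[of a "- b"] by simp

lemma wt_power_diff: "wt (a - b) ^ m \<le> 2 ^ m * wt a ^ m * wt b ^ m"
  using power_mono[OF wt_diff wt_nonneg, of a b m] by (simp add: power_mult_distrib)

lemma norm_power_le_wt: "norm x ^ m \<le> wt x ^ m"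
proof (rule power_mono)
  show "norm x \<le> wt x"
    using sum_squares_bound[of 1 "norm x"] norm_ge_zero[of x] unfolding wt_def power_one by linarith
qed simp

lemma wt_power_le_norm: "wt x ^ m \<le> 2 ^ m * (1 + norm x ^ (2 * m))"
proof (cases "norm x \<le> 1")
  case True
  then have "wt x \<le> 2" by (simp add: wt_def power_le_one)
  then have "wt x ^ m \<le> 2 ^ m" by (intro power_mono wt_nonneg)
  also have "\<dots> \<le> 2 ^ m * (1 + norm x ^ (2 * m))" by simp
  finally show ?thesis .
next
  case False
  then have "1 \<le> (norm x)\<^sup>2" by simp
  then have "wt x \<le> 2 * (norm x)\<^sup>2" by (simp add: wt_def)
  then have "wt x ^ m \<le> (2 * (norm x)\<^sup>2) ^ m" by (intro power_mono wt_nonneg)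
  also have "\<dots> = 2 ^ m * norm x ^ (2 * m)" by (simp add: power_mult_distrib power_mult)
  also have "\<dots> \<le> 2 ^ m * (1 + norm x ^ (2 * m))" by (intro mult_left_mono) auto
  finally show ?thesis .
qed

lemma schwartzI_wt:
  assumes "smooth f" "\<And>\<beta> m. \<exists>C. \<forall>x. wt x ^ m * norm (Dl \<beta> f x) \<le> C"
  shows "schwartz f"
  unfolding schwartz_def
proof (intro conjI allI assms(1))
  fix \<beta> m
  obtain C where "\<And>x. wt x ^ m * norm (Dl \<beta> f x) \<le> C" using assms(2) by blast
  then have "norm x ^ m * norm (Dl \<beta> f x) \<le> C" for x
    by (meson norm_power_le_wt mult_right_mono norm_ge_zero order_trans)
  then show "\<exists>C. \<forall>x. norm x ^ m * norm (Dl \<beta> f x) \<le> C" by blast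
qed

lemma schwartz_smooth: "schwartz f \<Longrightarrow> smooth f"
  by (simp add: schwartz_def)

lemma schwartz_wt:
  assumes "schwartz f"
  shows "\<exists>C. \<forall>x. wt x ^ m * norm (Dl \<beta> f x) \<le> C"
proof -
  obtain A where A: "\<And>x. norm x ^ 0 * norm (Dl \<beta> f x) \<le> A"
    using assms unfolding schwartz_def by blast
  obtain B where B: "\<And>x. norm x ^ (2*m) * norm (Dl \<beta> f x) \<le> B"
    using assms unfolding schwartz_def by blast
  have "wt x ^ m * norm (Dl \<beta> f x) \<le> 2 ^ m * (A + B)" for x
  proof -
    have "wt x ^ m * norm (Dl \<beta> f x) \<le> 2 ^ m * (1 + norm x ^ (2*m)) * norm (Dl \<beta> f x)"
      by (intro mult_right_mono wt_power_le_norm) auto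
    also have "\<dots> = 2 ^ m * (norm x ^ 0 * norm (Dl \<beta> f x) + norm x ^ (2*m) * norm (Dl \<beta> f x))"
      by (simp add: algebra_simps)
    also have "\<dots> \<le> 2 ^ m * (A + B)" by (intro mult_left_mono add_mono A B) auto
    finally show ?thesis .
  qed
  then show ?thesis by blast
qed

lemma finite_uniform_bound:
  fixes F :: "'a \<Rightarrow> 'b \<Rightarrow> real"
  assumes "finite S" "\<And>s. s \<in> S \<Longrightarrow> \<exists>C. \<forall>x. F s x \<le> C"
  shows "\<exists>C\<ge>0. \<forall>s\<in>S. \<forall>x. F s x \<le> C"
  using assms
proof (induction S)
  case (insert s S)
  then obtain C D where "C \<ge> 0" "\<forall>s\<in>S. \<forall>x. F s x \<le> C" "\<forall>x. F s x \<le> D" by (meson insertCI)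
  then show ?case by (intro exI[of _ "max C D"]) (auto simp: le_max_iff_disj)
qed auto

lemma finite_lists_le: "finite {\<beta> :: 'n::finite list. length \<beta> \<le> N}"
  using finite_lists_length_le[of "UNIV :: 'n set" N] by simp

lemma schwartz_bound:
  fixes f :: "real^'n::finite \<Rightarrow> complex"
  assumes "schwartz f"
  obtains C where "C \<ge> 0" "\<And>\<beta> x. length \<beta> \<le> N \<Longrightarrow> wt x ^ m * norm (Dl \<beta> f x) \<le> C"
  using finite_uniform_bound[OF finite_lists_le, of N "\<lambda>\<beta> x. wt x ^ m * norm (Dl \<beta> f x)"]
    schwartz_wt[OF assms] by auto

text \<open>The multipliers of the Schwartz space, with a growth exponent that may depend on the
  derivative. Characters and coordinate functions belong to it.\<close>

definition slow :: "(real^'n::finite \<Rightarrow> complex) \<Rightarrow> bool" where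
  "slow f \<longleftrightarrow> smooth f \<and> (\<forall>\<beta>. \<exists>C m. \<forall>x. norm (Dl \<beta> f x) \<le> C * wt x ^ m)"

lemma slow_bound:
  fixes f :: "real^'n::finite \<Rightarrow> complex"
  assumes "slow f"
  obtains C m where "C \<ge> 0" "\<And>\<beta> x. length \<beta> \<le> N \<Longrightarrow> norm (Dl \<beta> f x) \<le> C * wt x ^ m"
proof -
  obtain c m where cm: "\<And>\<beta> x. norm (Dl \<beta> f x) \<le> c \<beta> * wt x ^ m \<beta>"
    using assms unfolding slow_def by metis
  \<comment> \<open>The sum is a convenient common upper bound for finitely many exponents.\<close>
  define k where "k = (\<Sum>\<beta> | length \<beta> \<le> N. m \<beta>)"
  have le: "norm (Dl \<beta> f x) / wt x ^ k \<le> \<bar>c \<beta>\<bar>" if "length \<beta> \<le> N" for \<beta> x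
  proof -
    have "m \<beta> \<le> k" unfolding k_def using that by (intro member_le_sum finite_lists_le) auto
    then have "\<bar>c \<beta>\<bar> * wt x ^ m \<beta> \<le> \<bar>c \<beta>\<bar> * wt x ^ k" by (intro mult_left_mono wt_power_mono) auto
    moreover have "c \<beta> * wt x ^ m \<beta> \<le> \<bar>c \<beta>\<bar> * wt x ^ m \<beta>" by (intro mult_right_mono wt_power_nonneg) auto
    ultimately have "norm (Dl \<beta> f x) \<le> \<bar>c \<beta>\<bar> * wt x ^ k" using cm[of \<beta> x] by linarith
    then show ?thesis by (simp add: pos_divide_le_eq wt_power_pos)
  qed
  have "\<exists>C\<ge>0. \<forall>\<beta>\<in>{\<beta>. length \<beta> \<le> N}. \<forall>x. norm (Dl \<beta> f x) / wt x ^ k \<le> C"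
    using le by (intro finite_uniform_bound finite_lists_le) blast
  then obtain C where "C \<ge> 0" "\<And>\<beta> x. length \<beta> \<le> N \<Longrightarrow> norm (Dl \<beta> f x) / wt x ^ k \<le> C" by blast
  then show ?thesis using that[of C k] by (simp add: pos_divide_le_eq wt_power_pos)
qed

lemma schwartz_imp_slow: "schwartz f \<Longrightarrow> slow f"
  unfolding slow_def
proof (intro conjI allI)
  fix \<beta> assume "schwartz f"
  from schwartz_wt[OF this, of 0 \<beta>] show "\<exists>C m. \<forall>x. norm (Dl \<beta> f x) \<le> C * wt x ^ m"
    by (metis mult.right_neutral mult_1 power_0)
qed (rule schwartz_smooth)

lemma schwartz_mult:
  fixes f g :: "real^'n::finite \<Rightarrow> complex"
  assumes f: "slow f" and g: "schwartz g"
  shows "schwartz (\<lambda>x. f x * g x)"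
proof (rule schwartzI_wt)
  have sm: "smooth f" "smooth g" using assms by (auto simp: slow_def schwartz_smooth)
  then show "smooth (\<lambda>x. f x * g x)" by (rule smooth_mult)
  fix \<beta> :: "'n list" and m
  obtain C k where C: "C \<ge> 0" "\<And>\<alpha> x. length \<alpha> \<le> length \<beta> \<Longrightarrow> norm (Dl \<alpha> f x) \<le> C * wt x ^ k"
    using slow_bound[OF f] by metis
  \<comment> \<open>The additional exponent \<open>k\<close> absorbs the growth of
    \<open>f\<close>.\<close>
  obtain D where D: "D \<ge> 0" "\<And>\<alpha> x. length \<alpha> \<le> length \<beta> \<Longrightarrow> wt x ^ (m + k) * norm (Dl \<alpha> g x) \<le> D"
    using schwartz_bound[OF g] by metis
  have "wt x ^ m * norm (Dl \<beta> (\<lambda>x. f x * g x) x) \<le> 2 ^ length \<beta> * C * D" for x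
  proof -
    have "norm (Dl \<beta> (\<lambda>x. f x * g x) x) \<le> 2 ^ length \<beta> * (C * wt x ^ k) * (D / wt x ^ (m + k))"
      by (rule norm_Dl_mult_le[OF sm]) (use C D in \<open>auto simp: pos_le_divide_eq wt_power_pos mult.commute\<close>)
    also have "\<dots> = 2 ^ length \<beta> * C * D / wt x ^ m"
      using wt_pos[of x] by (simp add: power_add field_simps)
    finally show ?thesis by (simp add: pos_le_divide_eq wt_power_pos mult.commute)
  qed
  then show "\<exists>C. \<forall>x. wt x ^ m * norm (Dl \<beta> (\<lambda>x. f x * g x) x) \<le> C" by blast
qed

lemma schwartz_Dl: "schwartz f \<Longrightarrow> schwartz (Dl \<beta> f)"
  by (simp add: schwartz_def smooth_Dl Dl_append[symmetric])

lemma schwartz_pdiff: "schwartz f \<Longrightarrow> schwartz (pdiff i f)"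
  using schwartz_Dl[of f "[i]"] by simp

lemma slow_const [simp]: "slow (\<lambda>x. c)"
  unfolding slow_def
proof (intro conjI allI)
  show "\<exists>C m. \<forall>x. norm (Dl \<beta> (\<lambda>x. c) x) \<le> C * wt x ^ m" for \<beta>
    by (rule exI[of _ "norm c"], rule exI[of _ 0]) (simp add: Dl_const)
qed simp

lemma schwartz_cmult: "schwartz f \<Longrightarrow> schwartz (\<lambda>x. c * f x)"
  by (rule schwartz_mult) auto

lemma schwartz_add:
  fixes f g :: "real^'n::finite \<Rightarrow> complex"
  assumes "schwartz f" "schwartz g" shows "schwartz (\<lambda>x. f x + g x)"
proof (rule schwartzI_wt)
  show "smooth (\<lambda>x. f x + g x)" by (intro smooth_add schwartz_smooth assms)
  fix \<beta> m
  obtain C D where "\<And>x. wt x ^ m * norm (Dl \<beta> f x) \<le> C" "\<And>x. wt x ^ m * norm (Dl \<beta> g x) \<le> D"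
    using assms schwartz_wt by meson
  moreover have "wt x ^ m * norm (Dl \<beta> (\<lambda>x. f x + g x) x)
      \<le> wt x ^ m * norm (Dl \<beta> f x) + wt x ^ m * norm (Dl \<beta> g x)" for x
  proof -
    have "wt x ^ m * norm (Dl \<beta> f x + Dl \<beta> g x) \<le> wt x ^ m * (norm (Dl \<beta> f x) + norm (Dl \<beta> g x))"
      by (intro mult_left_mono norm_triangle_ineq wt_power_nonneg)
    then show ?thesis
      using assms by (simp add: Dl_add schwartz_smooth distrib_left)
  qed
  ultimately show "\<exists>C. \<forall>x. wt x ^ m * norm (Dl \<beta> (\<lambda>x. f x + g x) x) \<le> C"
    by (meson add_mono order_trans)
qed

lemma schwartz_zero [simp]: "schwartz (\<lambda>x. 0)"
  by (rule schwartzI_wt) auto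

lemma schwartz_diff:
  assumes "schwartz f" "schwartz g" shows "schwartz (\<lambda>x. f x - g x)"
  using schwartz_add[OF assms(1) schwartz_cmult[OF assms(2), of "-1"]] by simp

lemma schwartz_sum:
  "(\<And>i. i \<in> A \<Longrightarrow> schwartz (f i)) \<Longrightarrow> schwartz (\<lambda>x. \<Sum>i\<in>A. f i x)"
  by (induction A rule: infinite_finite_induct) (auto intro: schwartz_add)

text \<open>The factor \<open>1 + 1 / c\<^sup>2\<close> undoes the dilation, Peetre's inequality
  undoes the translation by \<open>a\<close>.\<close>

lemma wt_affine:
  assumes "c \<noteq> 0"
  shows "wt y \<le> (2 * (1 + 1 / c\<^sup>2) * wt a) * wt (a + c *\<^sub>R y)"
proof -
  have "wt y \<le> (1 + 1 / c\<^sup>2) * wt ((a + c *\<^sub>R y) - a)"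
  proof -
    have "(1 + 1 / c\<^sup>2) * (1 + c\<^sup>2 * (norm y)\<^sup>2) = 1 + (norm y)\<^sup>2 + c\<^sup>2 * (norm y)\<^sup>2 + 1 / c\<^sup>2"
      using assms by (simp add: field_simps)
    moreover have "0 \<le> c\<^sup>2 * (norm y)\<^sup>2" "0 \<le> 1 / c\<^sup>2" by simp_all
    ultimately show ?thesis by (simp add: wt_def power_mult_distrib)
  qed
  also have "\<dots> \<le> (1 + 1 / c\<^sup>2) * (2 * wt (a + c *\<^sub>R y) * wt a)"
    by (intro mult_left_mono wt_diff) auto
  also have "\<dots> = (2 * (1 + 1 / c\<^sup>2) * wt a) * wt (a + c *\<^sub>R y)" by (simp only: mult_ac)
  finally show ?thesis .
qed

lemma schwartz_affine:
  assumes f: "schwartz f" and c: "c \<noteq> 0"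
  shows "schwartz (\<lambda>y. f (a + c *\<^sub>R y))"
proof (rule schwartzI_wt)
  show "smooth (\<lambda>y. f (a + c *\<^sub>R y))" by (intro smooth_affine schwartz_smooth f)
  fix \<beta> m
  obtain C where C: "\<And>x. wt x ^ m * norm (Dl \<beta> f x) \<le> C" using f schwartz_wt by meson
  let ?K = "2 * (1 + 1 / c\<^sup>2) * wt a"
  have "wt y ^ m * norm (Dl \<beta> (\<lambda>y. f (a + c *\<^sub>R y)) y) \<le> ?K ^ m * \<bar>c\<bar> ^ length \<beta> * C" for y
  proof -
    have "wt y ^ m * norm (Dl \<beta> (\<lambda>y. f (a + c *\<^sub>R y)) y)
      \<le> (?K * wt (a + c *\<^sub>R y)) ^ m * norm (Dl \<beta> (\<lambda>y. f (a + c *\<^sub>R y)) y)"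
      by (intro mult_right_mono power_mono wt_affine c wt_nonneg) auto
    also have "\<dots> = ?K ^ m * \<bar>c\<bar> ^ length \<beta> * (wt (a + c *\<^sub>R y) ^ m * norm (Dl \<beta> f (a + c *\<^sub>R y)))"
      using f by (simp add: Dl_affine schwartz_smooth power_mult_distrib power_abs)
    also have "\<dots> \<le> ?K ^ m * \<bar>c\<bar> ^ length \<beta> * C"
      by (intro mult_left_mono C mult_nonneg_nonneg zero_le_power) (auto simp: wt_nonneg)
    finally show ?thesis .
  qed
  then show "\<exists>C. \<forall>y. wt y ^ m * norm (Dl \<beta> (\<lambda>y. f (a + c *\<^sub>R y)) y) \<le> C" by blast
qed

lemma Dl_zero_outside_tsupp:
  assumes "x \<notin> tsupp f" shows "Dl \<beta> f x = 0"
proof -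
  have "Dl \<beta> f x = Dl \<beta> (\<lambda>x. 0) x"
  proof (rule Dl_local[of "- tsupp f"])
    show "f y = 0" if "y \<in> - tsupp f" for y
      using that closure_subset[of "{x. f x \<noteq> 0}"] by (auto simp: tsupp_def)
  qed (use assms in \<open>auto simp: tsupp_def\<close>)
  then show ?thesis by simp
qed

lemma test_fun_smooth: "test_fun U f \<Longrightarrow> smooth f"
  by (simp add: test_fun_def)

lemma test_fun_schwartz:
  assumes "test_fun U f" shows "schwartz f"
proof (rule schwartzI_wt)
  show sm: "smooth f" using assms by (rule test_fun_smooth)
  fix \<beta> m
  have "continuous_on (tsupp f) (\<lambda>x. wt x ^ m * norm (Dl \<beta> f x))"
    unfolding wt_def by (intro continuous_intros smooth_cont sm)
  then have "compact ((\<lambda>x. wt x ^ m * norm (Dl \<beta> f x)) ` tsupp f)"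
    using assms compact_continuous_image unfolding test_fun_def by blast
  from compact_imp_bounded[OF this] obtain B where "\<forall>x\<in>tsupp f. norm (wt x ^ m * norm (Dl \<beta> f x)) \<le> B"
    unfolding bounded_iff by auto
  then have "wt x ^ m * norm (Dl \<beta> f x) \<le> max B 0" for x
    using Dl_zero_outside_tsupp[of x f \<beta>] by (cases "x \<in> tsupp f") auto
  then show "\<exists>C. \<forall>x. wt x ^ m * norm (Dl \<beta> f x) \<le> C" by blast
qed

section \<open>Smooth cutoff functions\<close>

text \<open>The flat functions \<open>p(1/x) exp(-1/x)\<close>, continued by 0. The polynomial is
  carried along so that the family is closed under differentiation.\<close>

definition expinv :: "real poly \<Rightarrow> real \<Rightarrow> real" where
  "expinv p x = (if x > 0 then poly p (1 / x) * exp (- 1 / x) else 0)"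

lemma poly_exp_decay: "((\<lambda>u. u ^ k * poly p u * exp (- u)) \<longlongrightarrow> (0::real)) at_top"
\<comment> \<open>The power \<open>u ^ k\<close> is kept general because \<open>pCons\<close> hands
  one factor \<open>u\<close> on to the remaining polynomial.\<close>
proof (induction p arbitrary: k)
  case (pCons a p)
  have "((\<lambda>u. a * (u ^ k / exp u) + u ^ Suc k * poly p u * exp (- u)) \<longlongrightarrow> a * 0 + 0) at_top"
    by (intro tendsto_intros tendsto_power_div_exp_0 pCons.IH)
  then show ?case by (simp add: algebra_simps exp_minus field_simps)
qed simp

text \<open>With \<open>u = 1/x\<close>, the chain rule contributes \<open>- u^2\<close>,
  differentiation of \<open>p(u) exp(-u)\<close> contributes \<open>p' - p\<close>; hence the
  polynomial \<open>u^2 (p - p')\<close>. At 0 the same substitution reduces the difference quotient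
  to exponential decay at infinity.\<close>

lemma has_derivative_expinv:
  "(expinv p has_real_derivative expinv (monom 1 2 * (p - pderiv p)) x) (at x)"
proof -
  consider "x > 0" | "x < 0" | "x = 0" by linarith
  then show ?thesis
  proof cases
    case 1
    have "((\<lambda>x. poly p (1 / x) * exp (- 1 / x)) has_real_derivative
        expinv (monom 1 2 * (p - pderiv p)) x) (at x)"
      using 1 by (auto intro!: derivative_eq_intros poly_DERIV[THEN DERIV_chain2]
        simp: expinv_def poly_monom power2_eq_square field_simps)
    then show ?thesis
      by (rule has_field_derivative_transform_within_open[where S = "{0<..}"])
        (use 1 in \<open>auto simp: expinv_def\<close>)
  next
    case 2
    have "((\<lambda>x. 0) has_real_derivative expinv (monom 1 2 * (p - pderiv p)) x) (at x)"
      using 2 by (simp add: expinv_def)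
    then show ?thesis
      by (rule has_field_derivative_transform_within_open[where S = "{..<0}"])
        (use 2 in \<open>auto simp: expinv_def\<close>)
  next
    case 3
    have "((\<lambda>h. expinv p h / h) \<longlongrightarrow> 0) (at_right 0)"
      unfolding filterlim_at_right_to_top
    proof (rule Lim_transform_eventually[OF poly_exp_decay[of 1 p]])
      show "\<forall>\<^sub>F u in at_top. u ^ 1 * poly p u * exp (- u) = expinv p (inverse u) / inverse u"
        using eventually_gt_at_top[of 0] by eventually_elim (simp add: expinv_def field_simps)
    qed
    moreover have "((\<lambda>h. expinv p h / h) \<longlongrightarrow> 0) (at_left 0)"
      by (rule Lim_transform_eventually[of "\<lambda>h. 0"])
        (auto simp: expinv_def eventually_at_left_field intro!: exI[of _ "-1"])
    ultimately have "((\<lambda>h. expinv p h / h) \<longlongrightarrow> 0) (at 0)"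
      by (simp add: filterlim_split_at)
    then show ?thesis
      using 3 by (simp add: DERIV_def expinv_def)
  qed
qed

lemma smooth_expinv_coord:
  "smooth (\<lambda>x::real^'n::finite. complex_of_real (expinv p (a + b * x$i)))"
proof -
  \<comment> \<open>The factor \<open>k\<close> collects the inner derivatives of the affine
    argument, so that the family of all \<open>G k p\<close> is closed under
    differentiation.\<close>
  define G where "G k p = (\<lambda>x::real^'n. complex_of_real (k * expinv p (a + b * x$i)))" for k p
  have pd: "has_pd (G k p) (G (k * (b * (if j = i then 1 else 0))) (monom 1 2 * (p - pderiv p)) x) j x" for k p j x
  proof -
    have "((\<lambda>t. a + b * (x + t *\<^sub>R axis j 1)$i) has_real_derivative b * (if j = i then 1 else 0)) (at 0)"
      by (auto intro!: derivative_eq_intros simp: axis_def)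
    then have "((\<lambda>t. expinv p (a + b * (x + t *\<^sub>R axis j 1)$i)) has_real_derivative
        expinv (monom 1 2 * (p - pderiv p)) (a + b * x$i) * (b * (if j = i then 1 else 0))) (at 0)"
      by (rule DERIV_chain2[rotated]) (simp add: has_derivative_expinv)
    then have "((\<lambda>t. k * expinv p (a + b * (x + t *\<^sub>R axis j 1)$i)) has_real_derivative
        k * (expinv (monom 1 2 * (p - pderiv p)) (a + b * x$i) * (b * (if j = i then 1 else 0)))) (at 0)"
      by (rule DERIV_cmult)
    from has_vector_derivative_of_real[OF this] show ?thesis
      by (simp add: G_def mult_ac)
  qed
  have "continuous_on UNIV (expinv p)" for p
    using has_derivative_expinv DERIV_isCont continuous_at_imp_continuous_on by blast
  then have "continuous_on UNIV (\<lambda>x::real^'n. expinv p (a + b * x$i))" for p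
    by (rule continuous_on_compose2) (auto intro!: continuous_intros)
  then have cont: "continuous_on UNIV (G k p)" for k p
    unfolding G_def by (intro continuous_intros)
  have "smooth (G 1 p)"
  proof (rule smoothI_family[where \<F> = "{G k p | k p. True}" and D = "\<lambda>g i. pdiff i g"])
    fix g j assume "g \<in> {G k p | k p. True}"
    then obtain k p where g: "g = G k p" by auto
    show "continuous_on UNIV g" by (simp add: g cont)
    have eq: "pdiff j g = G (k * (b * (if j = i then 1 else 0))) (monom 1 2 * (p - pderiv p))" for j
      unfolding g by (intro ext pdiff_eqI pd)
    show "has_pd g (pdiff j g x) j x" for x unfolding eq unfolding g by (rule pd)
    show "pdiff j g \<in> {G k p | k p. True}" unfolding eq by blast
  qed auto
  then show ?thesis by (simp add: G_def)
qed

text \<open>The standard smooth transition from 0 on the negative axis to 1 beyond 1. The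
  denominator is positive because \<open>y\<close> and \<open>1 - y\<close> are never both
  nonpositive.\<close>

definition step :: "real \<Rightarrow> real" where
  "step y = expinv 1 y / (expinv 1 y + expinv 1 (1 - y))"

lemma step_0: "y \<le> 0 \<Longrightarrow> step y = 0"
  and step_1: "1 \<le> y \<Longrightarrow> step y = 1"
  by (auto simp: step_def expinv_def)

lemma smooth_step_coord: "smooth (\<lambda>x::real^'n::finite. complex_of_real (step (a + b * x$i)))"
proof -
  let ?p = "\<lambda>x::real^'n. complex_of_real (expinv 1 (a + b * x$i))"
  let ?q = "\<lambda>x::real^'n. complex_of_real (expinv 1 ((1 - a) + (- b) * x$i))"
  have "expinv 1 y + expinv 1 (1 - y) > 0" for y
    by (auto simp: expinv_def add_pos_pos)
  from this[of "a + b * _ $ i"] have "?p x + ?q x \<noteq> 0" for x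
    unfolding of_real_add[symmetric] of_real_eq_0_iff by (simp add: algebra_simps less_imp_neq[symmetric])
  then have "smooth (\<lambda>x. ?p x * inverse (?p x + ?q x))"
    by (intro smooth_mult smooth_inverse smooth_add smooth_expinv_coord)
  moreover have "?p x * inverse (?p x + ?q x) = complex_of_real (step (a + b * x$i))" for x
    by (simp add: step_def divide_inverse algebra_simps)
  ultimately show ?thesis by simp
qed

lemma cutoff_exists: "\<exists>c :: real^'n::finite \<Rightarrow> complex. test_fun UNIV c \<and> (\<forall>x\<in>cball 0 1. c x = 1)"
proof -
  \<comment> \<open>Each coordinate contributes a bump that is 1 for
    \<open>\<bar>x$i\<bar> \<le> 1\<close> and 0 for \<open>\<bar>x$i\<bar> \<ge> 2\<close>; the
    unit ball lies in the cube where all of them are 1.\<close>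
  define c where "c = (\<lambda>x::real^'n. \<Prod>i\<in>UNIV. complex_of_real (step (2 + (-1) * x$i)) * complex_of_real (step (2 + 1 * x$i)))"
  have sm: "smooth c"
    unfolding c_def by (intro smooth_prod smooth_mult smooth_step_coord)
  have "{x. c x \<noteq> 0} \<subseteq> cbox (\<chi> i. -2) (\<chi> i. 2)"
  proof
    fix x assume "x \<in> {x. c x \<noteq> 0}"
    then have "step (2 + (-1) * x$i) \<noteq> 0 \<and> step (2 + 1 * x$i) \<noteq> 0" for i
      by (auto simp: c_def)
    then have "0 < 2 + (-1) * x$i \<and> 0 < 2 + 1 * x$i" for i
      using step_0 not_le by blast
    then show "x \<in> cbox (\<chi> i. -2) (\<chi> i. 2)"
      by (auto simp: mem_box_cart) (smt (verit))+
  qed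
  then have sub: "tsupp c \<subseteq> cbox (\<chi> i. -2) (\<chi> i. 2)"
    unfolding tsupp_def by (rule closure_minimal) (rule closed_cbox)
  have "compact (tsupp c)"
    using sub by (metis bounded_cbox bounded_subset closed_closure compact_eq_bounded_closed tsupp_def)
  moreover have "c x = 1" if "x \<in> cball 0 1" for x
  proof -
    have "\<bar>x$i\<bar> \<le> 1" for i
      using component_le_norm_cart[of x i] that by (auto simp: dist_norm)
    then have "1 \<le> 2 + (-1) * x$i \<and> 1 \<le> 2 + 1 * x$i" for i
      by (smt (verit))
    then show ?thesis unfolding c_def by (intro prod.neutral) (simp add: step_1)
  qed
  ultimately show ?thesis using sm unfolding test_fun_def by (intro exI[of _ c]) auto
qed

lemma test_fun_cutoff: "test_fun UNIV cutoff"
  and cutoff_eq_1: "norm x \<le> 1 \<Longrightarrow> cutoff x = 1"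
  using someI_ex[OF cutoff_exists] unfolding cutoff_def by (auto simp: dist_norm)

section \<open>Integrals of rapidly decaying functions\<close>

text \<open>\<open>lborel\<close> is the image of the product of one-dimensional Lebesgue measures,
  so tensor products integrate factor by factor.\<close>

lemma
  fixes f :: "'a::euclidean_space \<Rightarrow> real \<Rightarrow> 'b::{real_normed_field,banach,second_countable_topology}"
  assumes int: "\<And>b. b \<in> Basis \<Longrightarrow> integrable lborel (f b)"
  shows integrable_lborel_prod_Basis: "integrable lborel (\<lambda>x. \<Prod>b\<in>Basis. f b (x \<bullet> b))"
    and integral_lborel_prod_Basis: "(\<integral>x. (\<Prod>b\<in>Basis. f b (x \<bullet> b)) \<partial>lborel) = (\<Prod>b\<in>Basis. integral\<^sup>L lborel (f b))"
proof -
  interpret product_sigma_finite "\<lambda>b::'a. lborel :: real measure"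
    by standard
  let ?T = "\<lambda>f::'a \<Rightarrow> real. \<Sum>b\<in>Basis. f b *\<^sub>R b"
  let ?M = "\<Pi>\<^sub>M b\<in>(Basis::'a set). (lborel :: real measure)"
  have [measurable]: "\<And>b. b \<in> Basis \<Longrightarrow> f b \<in> borel_measurable borel"
    using int by (simp add: borel_measurable_integrable)
  have T [measurable]: "?T \<in> ?M \<rightarrow>\<^sub>M borel"
    by measurable
  have g [measurable]: "(\<lambda>x. \<Prod>b\<in>Basis. f b (x \<bullet> b)) \<in> borel_measurable borel"
    by measurable
  have eq: "(\<Prod>b\<in>Basis. f b (?T y \<bullet> b)) = (\<Prod>b\<in>Basis. f b (y b))" for y
    by (intro prod.cong) (simp_all)
  show "integrable lborel (\<lambda>x. \<Prod>b\<in>Basis. f b (x \<bullet> b))"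
    by (subst lborel_eq, subst integrable_distr_eq[OF T g]) (unfold eq, intro product_integrable_prod int finite_Basis)
  show "(\<integral>x. (\<Prod>b\<in>Basis. f b (x \<bullet> b)) \<partial>lborel) = (\<Prod>b\<in>Basis. integral\<^sup>L lborel (f b))"
    by (subst lborel_eq, subst integral_distr[OF T g]) (unfold eq, intro product_integral_prod int finite_Basis)
qed

lemma prod_Basis_vec: "(\<Prod>b\<in>(Basis::(real^'n::finite) set). g b) = (\<Prod>i\<in>UNIV. g (axis i 1))"
proof -
  have B: "(Basis::(real^'n) set) = range (\<lambda>i. axis i 1)"
    by (auto simp: Basis_vec_def)
  show ?thesis unfolding B
    by (subst prod.reindex) (auto simp: inj_on_def axis_eq_axis)
qed

lemma
  fixes f :: "'n::finite \<Rightarrow> real \<Rightarrow> 'b::{real_normed_field,banach,second_countable_topology}"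
  assumes int: "\<And>i. integrable lborel (f i)"
  shows integrable_lborel_prod: "integrable lborel (\<lambda>x::real^'n. \<Prod>i\<in>UNIV. f i (x$i))"
    and integral_lborel_prod: "integral\<^sup>L lborel (\<lambda>x::real^'n. \<Prod>i\<in>UNIV. f i (x$i)) = (\<Prod>i\<in>UNIV. integral\<^sup>L lborel (f i))"
proof -
  define g where "g b = f (inv (\<lambda>i. axis i (1::real)) b)" for b :: "real^'n"
  have "inj (\<lambda>i::'n. axis i (1::real))" by (auto simp: inj_on_def axis_eq_axis)
  then have g: "g (axis i 1) = f i" for i using inv_f_f[of "\<lambda>i::'n. axis i (1::real)" i] by (simp add: g_def)
  have int': "integrable lborel (g b)" for b by (simp add: g_def int)
  show "integrable lborel (\<lambda>x::real^'n. \<Prod>i\<in>UNIV. f i (x$i))"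
    using integrable_lborel_prod_Basis[of g] int' by (simp add: prod_Basis_vec g inner_axis)
  show "integral\<^sup>L lborel (\<lambda>x::real^'n. \<Prod>i\<in>UNIV. f i (x$i)) = (\<Prod>i\<in>UNIV. integral\<^sup>L lborel (f i))"
    using integral_lborel_prod_Basis[of g] int' by (simp add: prod_Basis_vec g inner_axis)
qed

lemma continuous_wt [continuous_intros]: "continuous_on S (wt :: real^'n::finite \<Rightarrow> real)"
  unfolding wt_def by (intro continuous_intros)

lemma wt_measurable [measurable]: "(wt :: real^'n::finite \<Rightarrow> real) \<in> borel_measurable borel"
  by (intro borel_measurable_continuous_onI continuous_wt)

text \<open>Every \<open>1 + (x$i)\<^sup>2\<close> is at most \<open>wt x\<close>, so the function
  is dominated by a product of the one-dimensional integrable functions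
  \<open>1 / (1 + t\<^sup>2)\<close>, one for each coordinate. This fixes the weight exponent
  \<open>CARD('n)\<close> used for integrability throughout.\<close>

lemma integrable_wt: "integrable lborel (\<lambda>x::real^'n::finite. 1 / wt x ^ CARD('n))"
proof -
  have 1: "integrable lborel (\<lambda>x::real. inverse (1 + x\<^sup>2))"
    using integrable_inverse_1_plus_square by (simp add: set_integrable_def)
  show ?thesis
  proof (rule Bochner_Integration.integrable_bound)
    show "integrable lborel (\<lambda>x::real^'n. \<Prod>i\<in>UNIV. inverse (1 + (x$i)\<^sup>2))"
      using integrable_lborel_prod[of "\<lambda>i x. inverse (1 + x\<^sup>2)"] 1 by simp
    show "AE x::real^'n in lborel. norm (1 / wt x ^ CARD('n)) \<le> norm (\<Prod>i\<in>UNIV. inverse (1 + (x$i)\<^sup>2))"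
    proof (intro AE_I2)
      fix x :: "real^'n"
      have "(\<Prod>i\<in>(UNIV::'n set). 1 + (x$i)\<^sup>2) \<le> (\<Prod>i\<in>(UNIV::'n set). wt x)"
      proof (rule prod_mono)
        fix i :: 'n
        have "\<bar>x$i\<bar>\<^sup>2 \<le> (norm x)\<^sup>2" by (intro power_mono component_le_norm_cart) auto
        then show "0 \<le> 1 + (x$i)\<^sup>2 \<and> 1 + (x$i)\<^sup>2 \<le> wt x" by (simp add: wt_def)
      qed
      moreover have "0 < (\<Prod>i\<in>(UNIV::'n set). 1 + (x$i)\<^sup>2)"
        by (intro prod_pos) (auto simp: add_pos_nonneg)
      ultimately have "inverse (wt x ^ CARD('n)) \<le> inverse (\<Prod>i\<in>(UNIV::'n set). 1 + (x$i)\<^sup>2)"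
        by (intro le_imp_inverse_le) auto
      then show "norm (1 / wt x ^ CARD('n)) \<le> norm (\<Prod>i\<in>UNIV. inverse (1 + (x$i)\<^sup>2))"
        by (simp add: prod_inversef[symmetric] o_def divide_inverse wt_nonneg abs_of_nonneg prod_nonneg)
    qed
  qed measurable
qed

definition wt_integral :: "'n::finite itself \<Rightarrow> real" where
  "wt_integral _ = integral\<^sup>L lborel (\<lambda>x::real^'n. 1 / wt x ^ CARD('n))"

lemma
  fixes f :: "real^'n::finite \<Rightarrow> 'b::{banach,second_countable_topology}"
  assumes [measurable]: "f \<in> borel_measurable borel"
    and bnd: "\<And>x. wt x ^ CARD('n) * norm (f x) \<le> C"
  shows integrable_wt_bound: "integrable lborel f"
    and integral_wt_bound: "norm (integral\<^sup>L lborel f) \<le> C * wt_integral TYPE('n)"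
proof -
  have *: "norm (f x) \<le> C * (1 / wt x ^ CARD('n))" for x
    using bnd[of x] by (simp add: pos_le_divide_eq wt_power_pos mult.commute)
  have i: "integrable lborel (\<lambda>x::real^'n. C * (1 / wt x ^ CARD('n)))"
    by (intro integrable_mult_right integrable_wt)
  show f: "integrable lborel f"
  proof (rule Bochner_Integration.integrable_bound[OF i])
    have "norm (f x) \<le> norm (C * (1 / wt x ^ CARD('n)))" for x
      by (rule order_trans[OF *[of x]]) (simp only: real_norm_def abs_ge_self)
    then show "AE x in lborel. norm (f x) \<le> norm (C * (1 / wt x ^ CARD('n)))"
      by (rule AE_I2)
  qed simp
  have "norm (integral\<^sup>L lborel f) \<le> (\<integral>x. norm (f x) \<partial>lborel)"
    by (rule integral_norm_bound)
  also have "\<dots> \<le> integral\<^sup>L lborel (\<lambda>x::real^'n. C * (1 / wt x ^ CARD('n)))"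
    by (rule integral_mono[OF integrable_norm[OF f] i *])
  also have "\<dots> = C * wt_integral TYPE('n)"
    unfolding wt_integral_def by (rule integral_mult_right_zero)
  finally show "norm (integral\<^sup>L lborel f) \<le> C * wt_integral TYPE('n)" .
qed

lemma smooth_measurable:
  fixes f :: "real^'n::finite \<Rightarrow> 'b::{real_normed_vector,second_countable_topology}"
  shows "smooth f \<Longrightarrow> f \<in> borel_measurable borel"
  by (intro borel_measurable_continuous_onI smooth_cont0)

lemma schwartz_integrable:
  fixes f :: "real^'n::finite \<Rightarrow> complex"
  assumes "schwartz f" shows "integrable lborel f"
proof -
  obtain C where "\<And>x. wt x ^ CARD('n) * norm (Dl [] f x) \<le> C" using assms schwartz_wt by meson
  then show ?thesis
    by (intro integrable_wt_bound) (auto intro: smooth_measurable schwartz_smooth assms)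
qed

lemma
  fixes f :: "real^'n::finite \<Rightarrow> 'b::{banach,second_countable_topology}"
  assumes int: "integrable lborel f" and c: "c \<noteq> 0"
  shows integrable_affine: "integrable lborel (\<lambda>x. f (t + c *\<^sub>R x))"
    and integral_affine: "integral\<^sup>L lborel f = \<bar>c\<bar> ^ CARD('n) *\<^sub>R (\<integral>x. f (t + c *\<^sub>R x) \<partial>lborel)"
proof -
  have [measurable]: "f \<in> borel_measurable borel" using int by auto
  have eq: "lborel = density (distr lborel borel (\<lambda>x. t + c *\<^sub>R x)) (\<lambda>_. ennreal (\<bar>c\<bar> ^ CARD('n)))"
    using lborel_affine[OF c, of t] by simp
  have "integrable (density (distr lborel borel (\<lambda>x. t + c *\<^sub>R x)) (\<lambda>_. ennreal (\<bar>c\<bar> ^ CARD('n)))) f"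
    using int eq by simp
  then have "integrable (distr lborel borel (\<lambda>x. t + c *\<^sub>R x)) (\<lambda>x. \<bar>c\<bar> ^ CARD('n) *\<^sub>R f x)"
    by (subst (asm) integrable_density) auto
  then have "integrable lborel (\<lambda>x. \<bar>c\<bar> ^ CARD('n) *\<^sub>R f (t + c *\<^sub>R x))"
    by (subst (asm) integrable_distr_eq) auto
  from integrable_scaleR_right[OF this, of "1 / \<bar>c\<bar> ^ CARD('n)"]
  show "integrable lborel (\<lambda>x. f (t + c *\<^sub>R x))"
    using c by simp
  show "integral\<^sup>L lborel f = \<bar>c\<bar> ^ CARD('n) *\<^sub>R (\<integral>x. f (t + c *\<^sub>R x) \<partial>lborel)"
    by (subst eq, subst integral_density) (auto simp: integral_distr)
qed

text \<open>The weight sits at \<open>x\<close> while the second derivative is evaluated at a point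
  at distance at most 1. Peetre's inequality costs 2 and the weight of the shift another 2, hence
  \<open>4 ^ m\<close>.\<close>

lemma schwartz_taylor:
  fixes f :: "real^'n::finite \<Rightarrow> complex"
  assumes "schwartz f"
  obtains K where "K \<ge> 0" "\<And>t x. \<bar>t\<bar> \<le> 1 \<Longrightarrow>
    wt x ^ m * norm (f (x + t *\<^sub>R axis i 1) - f x - t *\<^sub>R pdiff i f x) \<le> K * t\<^sup>2"
proof -
  obtain C where C: "C \<ge> 0" "\<And>\<beta> x. length \<beta> \<le> 2 \<Longrightarrow> wt x ^ m * norm (Dl \<beta> f x) \<le> C"
    using schwartz_bound[OF assms] by metis
  have sm: "smooth f" by (rule schwartz_smooth[OF assms])
  show ?thesis
  proof (rule that[of "4 ^ m * C"])
    show "0 \<le> 4 ^ m * C" using C by simp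
    fix t :: real and x :: "real^'n" assume t: "\<bar>t\<bar> \<le> 1"
    have "norm (f (x + t *\<^sub>R axis i 1) - f (x + 0 *\<^sub>R axis i 1) - t *\<^sub>R pdiff i f (x + 0 *\<^sub>R axis i 1)) \<le> (4 ^ m * C / wt x ^ m) * t\<^sup>2"
    proof (rule taylor_bound)
      show "((\<lambda>t. f (x + t *\<^sub>R axis i 1)) has_vector_derivative pdiff i f (x + s *\<^sub>R axis i 1)) (at s)" for s
        by (rule has_pd_line, rule smooth_pd0, rule sm)
      show "((\<lambda>t. pdiff i f (x + t *\<^sub>R axis i 1)) has_vector_derivative pdiff i (pdiff i f) (x + s *\<^sub>R axis i 1)) (at s)" for s
        by (rule has_pd_line, rule smooth_pd0, rule smooth_pdiff, rule sm)
      fix s :: real assume s: "\<bar>s\<bar> \<le> \<bar>t\<bar>"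
      let ?z = "x + s *\<^sub>R axis i 1"
      have "s\<^sup>2 \<le> 1" using s t by (simp add: abs_square_le_1)
      then have "wt (s *\<^sub>R axis i 1 :: real^'n) \<le> 2" by (simp add: wt_def)
      then have "wt (s *\<^sub>R axis i 1 :: real^'n) ^ m \<le> 2 ^ m" by (intro power_mono wt_nonneg)
      then have "2 ^ m * wt ?z ^ m * wt (s *\<^sub>R axis i 1 :: real^'n) ^ m \<le> 2 ^ m * wt ?z ^ m * 2 ^ m"
        by (rule mult_left_mono) (simp add: wt_nonneg)
      moreover have "wt x ^ m \<le> 2 ^ m * wt ?z ^ m * wt (s *\<^sub>R axis i 1 :: real^'n) ^ m"
        using wt_power_diff[of ?z "s *\<^sub>R axis i 1" m] by simp
      ultimately have "wt x ^ m \<le> 2 ^ m * wt ?z ^ m * 2 ^ m"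
        by (rule order_trans[rotated])
      then have "wt x ^ m * norm (pdiff i (pdiff i f) ?z) \<le> 2 ^ m * wt ?z ^ m * 2 ^ m * norm (Dl [i, i] f ?z)"
        unfolding Dl.simps by (rule mult_right_mono) (rule norm_ge_zero)
      also have "\<dots> = 4 ^ m * (wt ?z ^ m * norm (Dl [i, i] f ?z))"
        using power_mult_distrib[of "2::real" 2 m] by simp
      also have "\<dots> \<le> 4 ^ m * C"
        by (intro mult_left_mono C(2)) auto
      finally show "norm (pdiff i (pdiff i f) ?z) \<le> 4 ^ m * C / wt x ^ m"
        by (simp add: pos_le_divide_eq wt_power_pos mult.commute)
    qed
    then show "wt x ^ m * norm (f (x + t *\<^sub>R axis i 1) - f x - t *\<^sub>R pdiff i f x) \<le> 4 ^ m * C * t\<^sup>2"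
      by (simp add: pos_le_divide_eq wt_power_pos mult.commute)
  qed
qed

lemma norm_le_linear_imp_zero:
  fixes a :: "'b::real_normed_vector"
  assumes "\<And>t::real. 0 < t \<Longrightarrow> t \<le> 1 \<Longrightarrow> norm a \<le> K * t"
  shows "a = 0"
proof -
  have "((\<lambda>t. K * t) \<longlongrightarrow> K * 0) (at_right (0::real))"
    by (intro tendsto_intros)
  then have "norm a \<le> K * 0"
    by (rule tendsto_lowerbound) (auto simp: eventually_at_right_field intro!: exI[of _ 1] assms)
  then show ?thesis by simp
qed

text \<open>By translation invariance \<open>h (x + t *\<^sub>R axis i 1) - h x\<close> has integral
  0. So \<open>t\<close> times the integral of the derivative is, up to sign, the integrated Taylor
  remainder, which is \<open>O(t\<^sup>2)\<close>; dividing by \<open>t\<close> and letting it tend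
  to 0 gives the claim.\<close>

lemma integral_pdiff_zero:
  fixes h :: "real^'n::finite \<Rightarrow> complex"
  assumes h: "schwartz h"
  shows "integral\<^sup>L lborel (pdiff i h) = 0"
proof -
  obtain K where K: "\<And>t x. \<bar>t\<bar> \<le> 1 \<Longrightarrow>
    wt x ^ CARD('n) * norm (h (x + t *\<^sub>R axis i 1) - h x - t *\<^sub>R pdiff i h x) \<le> K * t\<^sup>2"
    using schwartz_taylor[OF h] by metis
  have i1: "integrable lborel h" "integrable lborel (pdiff i h)"
    by (intro schwartz_integrable schwartz_pdiff h)+
  show ?thesis
  proof (rule norm_le_linear_imp_zero)
    fix t :: real assume t: "0 < t" "t \<le> 1"
    have i2: "integrable lborel (\<lambda>x. h (x + t *\<^sub>R axis i 1))"
      using integrable_affine[OF i1(1), of 1 "t *\<^sub>R axis i 1"] by (simp add: add.commute)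
    have e2: "(\<integral>x. h (x + t *\<^sub>R axis i 1) \<partial>lborel) = integral\<^sup>L lborel h"
      using integral_affine[OF i1(1), of 1 "t *\<^sub>R axis i 1"] by (simp add: add.commute)
    have "norm (\<integral>x. h (x + t *\<^sub>R axis i 1) - h x - t *\<^sub>R pdiff i h x \<partial>lborel) \<le> (K * t\<^sup>2) * wt_integral TYPE('n)"
      by (rule integral_wt_bound) (use K t i1 i2 in \<open>auto intro!: borel_measurable_diff borel_measurable_scaleR dest!: borel_measurable_integrable\<close>)
    moreover have "(\<integral>x. h (x + t *\<^sub>R axis i 1) - h x - t *\<^sub>R pdiff i h x \<partial>lborel) = - (t *\<^sub>R integral\<^sup>L lborel (pdiff i h))"
      using i1 i2 e2 by simp
    ultimately have "t * norm (integral\<^sup>L lborel (pdiff i h)) \<le> t * (K * wt_integral TYPE('n) * t)"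
      using t by (simp add: power2_eq_square mult_ac)
    then show "norm (integral\<^sup>L lborel (pdiff i h)) \<le> K * wt_integral TYPE('n) * t"
      using t by simp
  qed
qed

section \<open>The inverse Fourier transform of a Schwartz function\<close>

lemma slow_coordinate: "slow (\<lambda>x::real^'n::finite. complex_of_real (x$i))"
proof -
  let ?X = "\<lambda>x::real^'n. complex_of_real (x$i)"
  have pd: "has_pd ?X (if j = i then 1 else 0) j x" for j x
  proof -
    have "((\<lambda>t. (x + t *\<^sub>R axis j 1)$i) has_real_derivative (if j = i then 1 else 0)) (at 0)"
      by (auto intro!: derivative_eq_intros simp: axis_def)
    from has_vector_derivative_of_real[OF this] show ?thesis by (simp split: if_splits)
  qed
  have eq: "pdiff j ?X = (\<lambda>x. if j = i then 1 else 0)" for j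
    by (intro ext pdiff_eqI pd)
  have sm: "smooth ?X"
  proof (rule smoothI_family[where \<F> = "insert ?X (range (\<lambda>c x. c))" and D = "\<lambda>g j. pdiff j g"])
    fix g j x assume "g \<in> insert ?X (range (\<lambda>c x. c))"
    then consider "g = ?X" | c where "g = (\<lambda>x. c)" by auto
    then show "continuous_on UNIV g" "has_pd g (pdiff j g x) j x" "pdiff j g \<in> insert ?X (range (\<lambda>c x. c))"
      by (cases; auto intro!: continuous_intros simp: eq pd[simplified])+
  qed auto
  have "\<exists>C m. \<forall>x. norm (Dl \<beta> ?X x) \<le> C * wt x ^ m" for \<beta>
  proof (cases \<beta> rule: rev_cases)
    case Nil
    have "norm (?X x) \<le> 1 * wt x ^ 1" for x
      using order_trans[OF component_le_norm_cart norm_power_le_wt[of x 1, simplified]] by simp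
    then show ?thesis using Nil by (metis Dl.simps(1))
  next
    case (snoc \<alpha> j)
    have "norm (Dl \<beta> ?X x) \<le> 1 * wt x ^ 0" for x
      by (simp add: snoc Dl_append eq Dl_const)
    then show ?thesis by blast
  qed
  then show ?thesis using sm by (simp add: slow_def)
qed

text \<open>The symbol of \<open>Dl \<beta>\<close> in the normalisation with \<open>2 * pi\<close>
  in the exponent.\<close>

definition fourier_mult :: "'n::finite list \<Rightarrow> real^'n \<Rightarrow> complex" where
  "fourier_mult \<beta> \<xi> = (\<Prod>i\<leftarrow>\<beta>. 2 * pi * \<i> * of_real (\<xi>$i))"

lemma fourier_mult_simps [simp]:
  "fourier_mult [] \<xi> = 1"
  "fourier_mult (i # \<beta>) \<xi> = 2 * pi * \<i> * of_real (\<xi>$i) * fourier_mult \<beta> \<xi>"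
  "fourier_mult (\<alpha> @ \<beta>) \<xi> = fourier_mult \<alpha> \<xi> * fourier_mult \<beta> \<xi>"
  by (simp_all add: fourier_mult_def)

lemma schwartz_coordinate_mult:
  "schwartz f \<Longrightarrow> schwartz (\<lambda>\<xi>. 2 * pi * \<i> * of_real (\<xi>$i) * f \<xi>)"
  using schwartz_cmult[OF schwartz_mult[OF slow_coordinate], of f "2 * pi * \<i>" i] by (simp add: mult.assoc)

lemma schwartz_fourier_mult: "schwartz f \<Longrightarrow> schwartz (\<lambda>\<xi>. fourier_mult \<beta> \<xi> * f \<xi>)"
proof (induction \<beta>)
  case (Cons i \<beta>)
  from schwartz_coordinate_mult[OF Cons.IH[OF Cons.prems], of i] show ?case by (simp add: mult.assoc)
qed simp

abbreviation echar :: "real^'n::finite \<Rightarrow> real^'n \<Rightarrow> complex" where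
  "echar x \<xi> \<equiv> cis (2 * pi * (x \<bullet> \<xi>))"

lemma echar_pd:
  "((\<lambda>t. echar x (\<xi> + t *\<^sub>R axis i 1)) has_vector_derivative
      2 * pi * \<i> * of_real (x$i) * echar x (\<xi> + s *\<^sub>R axis i 1)) (at s)"
proof -
  have "((\<lambda>t. 2 * pi * (x \<bullet> (\<xi> + t *\<^sub>R axis i 1))) has_vector_derivative 2 * pi * x$i) (at s)"
    by (auto intro!: derivative_eq_intros simp: inner_add_right inner_axis has_real_derivative_iff_has_vector_derivative[symmetric])
  moreover have "(cis has_vector_derivative \<i> * cis y) (at y)" for y
    unfolding cis_conv_exp
    by (rule has_vector_derivative_real_field[where f = "\<lambda>z. exp (\<i> * z)"])
       (auto intro!: derivative_eq_intros)
  ultimately have "(cis \<circ> (\<lambda>t. 2 * pi * (x \<bullet> (\<xi> + t *\<^sub>R axis i 1))) has_vector_derivative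
      (2 * pi * x$i) *\<^sub>R (\<i> * echar x (\<xi> + s *\<^sub>R axis i 1))) (at s)"
    by (rule vector_diff_chain_at)
  moreover have "(2 * pi * x$i) *\<^sub>R (\<i> * z) = 2 * pi * \<i> * of_real (x$i) * z" for z
    by (simp add: scaleR_conv_of_real)
  ultimately show ?thesis
    by (simp only: o_def)
qed

lemma slow_echar: "slow (echar x)"
proof -
  have pd: "has_pd (\<lambda>\<xi>. c * echar x \<xi>) ((c * (2 * pi * \<i> * of_real (x$i))) * echar x \<xi>) i \<xi>" for c i \<xi>
    using has_vector_derivative_mult_right[OF echar_pd[of x \<xi> i 0], of c] by (simp add: mult_ac)
  have "smooth (\<lambda>\<xi>. 1 * echar x \<xi>)"
  proof (rule smoothI_family[where \<F> = "range (\<lambda>c \<xi>. c * echar x \<xi>)" and D = "\<lambda>g j. pdiff j g"])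
    fix g j \<xi> assume "g \<in> range (\<lambda>c \<xi>. c * echar x \<xi>)"
    then obtain c where g: "g = (\<lambda>\<xi>. c * echar x \<xi>)" by auto
    show "continuous_on UNIV g" unfolding g cis_conv_exp by (intro continuous_intros)
    have eq: "pdiff j g = (\<lambda>\<xi>. (c * (2 * pi * \<i> * of_real (x$j))) * echar x \<xi>)" for j
      unfolding g by (intro ext pdiff_eqI pd)
    show "has_pd g (pdiff j g \<xi>) j \<xi>" unfolding eq unfolding g by (rule pd)
    show "pdiff j g \<in> range (\<lambda>c \<xi>. c * echar x \<xi>)" unfolding eq by (rule rangeI)
  qed (rule rangeI)
  moreover have "Dl \<beta> (echar x) = (\<lambda>\<xi>. fourier_mult \<beta> x * echar x \<xi>)" for \<beta>
  proof (induction \<beta>)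
    case (Cons i \<beta>)
    have "pdiff i (\<lambda>\<xi>. fourier_mult \<beta> x * echar x \<xi>) = (\<lambda>\<xi>. fourier_mult \<beta> x * (2 * pi * \<i> * of_real (x$i)) * echar x \<xi>)"
      by (intro ext pdiff_eqI pd)
    then show ?case using Cons by (simp add: mult_ac)
  qed simp
  then have "norm (Dl \<beta> (echar x) \<xi>) \<le> norm (fourier_mult \<beta> x) * wt \<xi> ^ 0" for \<beta> \<xi>
    by (simp add: norm_mult)
  ultimately show ?thesis unfolding slow_def by (simp only: mult_1) blast
qed

lemma schwartz_echar_mult: "schwartz f \<Longrightarrow> schwartz (\<lambda>\<xi>. echar x \<xi> * f \<xi>)"
  by (rule schwartz_mult[OF slow_echar])

lemma inv_fourier_bound:
  assumes "schwartz f"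
  shows "norm (inv_fourier f x) \<le> (\<integral>\<xi>. norm (f \<xi>) \<partial>lborel)"
  unfolding inv_fourier_def
  using integral_norm_bound[of lborel "\<lambda>\<xi>. echar x \<xi> * f \<xi>"] by (simp add: norm_mult)

text \<open>Differentiation under the integral sign. The second-order remainder of the character is
  at most \<open>t\<^sup>2\<close> times the squared modulus of its multiplier, and this multiplier
  leaves \<open>f\<close> integrable.\<close>

lemma inv_fourier_pd:
  fixes f :: "real^'n::finite \<Rightarrow> complex"
  assumes f: "schwartz f"
  shows "has_pd (inv_fourier f) (inv_fourier (\<lambda>\<xi>. 2 * pi * \<i> * of_real (\<xi>$i) * f \<xi>) x) i x"
proof (rule has_vector_derivative_quadratic)
  let ?m = "\<lambda>\<xi>::real^'n. 2 * pi * \<i> * of_real (\<xi>$i)"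
  have s1: "schwartz (\<lambda>\<xi>. ?m \<xi> * f \<xi>)" by (rule schwartz_coordinate_mult[OF f])
  have s2: "schwartz (\<lambda>\<xi>. ?m \<xi> * (?m \<xi> * f \<xi>))" by (rule schwartz_coordinate_mult[OF s1])
  fix t :: real
  let ?y = "x + t *\<^sub>R axis i 1"
  have int: "integrable lborel (\<lambda>\<xi>. echar y \<xi> * g \<xi>)" if "schwartz g" for y g
    by (intro schwartz_integrable schwartz_echar_mult that)
  have eq: "inv_fourier f ?y - inv_fourier f (x + 0 *\<^sub>R axis i 1) - t *\<^sub>R inv_fourier (\<lambda>\<xi>. ?m \<xi> * f \<xi>) x
     = (\<integral>\<xi>. echar ?y \<xi> * f \<xi> - echar x \<xi> * f \<xi> - t *\<^sub>R (echar x \<xi> * (?m \<xi> * f \<xi>)) \<partial>lborel)"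
    unfolding inv_fourier_def
    by (subst Bochner_Integration.integral_diff[OF Bochner_Integration.integrable_diff[OF int[OF f] int[OF f]]
        integrable_scaleR_right[OF int[OF s1]]],
      subst Bochner_Integration.integral_diff[OF int[OF f] int[OF f]]) simp
  have "norm (\<integral>\<xi>. echar ?y \<xi> * f \<xi> - echar x \<xi> * f \<xi> - t *\<^sub>R (echar x \<xi> * (?m \<xi> * f \<xi>)) \<partial>lborel)
      \<le> (\<integral>\<xi>. norm (echar ?y \<xi> * f \<xi> - echar x \<xi> * f \<xi> - t *\<^sub>R (echar x \<xi> * (?m \<xi> * f \<xi>))) \<partial>lborel)"
    by (rule integral_norm_bound)
  also have "\<dots> \<le> (\<integral>\<xi>. norm (?m \<xi> * (?m \<xi> * f \<xi>)) * t\<^sup>2 \<partial>lborel)"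
  proof (rule integral_mono)
    show "integrable lborel (\<lambda>\<xi>. norm (echar ?y \<xi> * f \<xi> - echar x \<xi> * f \<xi> - t *\<^sub>R (echar x \<xi> * (?m \<xi> * f \<xi>))))"
      by (intro integrable_norm Bochner_Integration.integrable_diff integrable_scaleR_right int f s1)
    show "integrable lborel (\<lambda>\<xi>. norm (?m \<xi> * (?m \<xi> * f \<xi>)) * t\<^sup>2)"
      by (intro integrable_mult_left integrable_norm schwartz_integrable s2)
    fix \<xi> :: "real^'n"
    \<comment> \<open>The character is differentiated in its second argument only; symmetry of the
      inner product allows \<open>x\<close> and \<open>\<xi>\<close> to be swapped.\<close>
    let ?h = "\<lambda>s. echar \<xi> (x + s *\<^sub>R axis i 1)"
    have "norm (?h t - ?h 0 - t *\<^sub>R (?m \<xi> * ?h 0)) \<le> norm (?m \<xi> * ?m \<xi>) * t\<^sup>2"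
    proof (rule taylor_bound)
      show "(?h has_vector_derivative ?m \<xi> * ?h s) (at s)" for s
        by (rule echar_pd)
      show "((\<lambda>s. ?m \<xi> * ?h s) has_vector_derivative ?m \<xi> * (?m \<xi> * ?h s)) (at s)" for s
        by (intro has_vector_derivative_mult_right echar_pd)
      show "norm (?m \<xi> * (?m \<xi> * ?h s)) \<le> norm (?m \<xi> * ?m \<xi>)" for s
        by (simp add: norm_mult)
    qed
    then have "norm (?h t - ?h 0 - t *\<^sub>R (?m \<xi> * ?h 0)) * norm (f \<xi>) \<le> norm (?m \<xi> * ?m \<xi>) * t\<^sup>2 * norm (f \<xi>)"
      by (rule mult_right_mono) simp
    moreover have "echar ?y \<xi> * f \<xi> - echar x \<xi> * f \<xi> - t *\<^sub>R (echar x \<xi> * (?m \<xi> * f \<xi>))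
      = (?h t - ?h 0 - t *\<^sub>R (?m \<xi> * ?h 0)) * f \<xi>"
      by (simp add: inner_commute[of \<xi>] algebra_simps scaleR_conv_of_real)
    ultimately show "norm (echar ?y \<xi> * f \<xi> - echar x \<xi> * f \<xi> - t *\<^sub>R (echar x \<xi> * (?m \<xi> * f \<xi>)))
      \<le> norm (?m \<xi> * (?m \<xi> * f \<xi>)) * t\<^sup>2"
      by (simp add: norm_mult mult_ac)
  qed
  finally show "norm (inv_fourier f ?y - inv_fourier f (x + 0 *\<^sub>R axis i 1) - t *\<^sub>R inv_fourier (\<lambda>\<xi>. ?m \<xi> * f \<xi>) x)
     \<le> (\<integral>\<xi>. norm (?m \<xi> * (?m \<xi> * f \<xi>)) \<partial>lborel) * t\<^sup>2"
    unfolding eq by simp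
qed

text \<open>Axis derivatives alone do not imply continuity, but local bounds on them do, through
  \<open>coordinate_telescope\<close>. This supplies the continuity that
  \<open>smoothI_family\<close> asks for.\<close>

lemma continuous_on_bounded_pd:
  fixes F :: "real^'n::finite \<Rightarrow> 'b::real_normed_vector"
  assumes pd: "\<And>i x. has_pd F (D i x) i x"
    and bnd: "\<And>x. \<exists>B. \<forall>i y. norm (y - x) \<le> 1 \<longrightarrow> norm (D i y) \<le> B"
  shows "continuous_on UNIV F"
proof (intro continuous_at_imp_continuous_on ballI)
  fix x
  obtain B where B: "\<And>i y. norm (y - x) \<le> 1 \<Longrightarrow> norm (D i y) \<le> B" using bnd by meson
  have "norm (F y - F x) \<le> B * (\<Sum>i\<in>UNIV. \<bar>y$i - x$i\<bar>)" if y: "norm (y - x) \<le> 1" for y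
  proof (rule coordinate_telescope)
    fix i z assume "\<And>j. \<bar>z$j - x$j\<bar> \<le> \<bar>y$j - x$j\<bar>"
    then have "norm (z - x) \<le> norm (y - x)" by (intro norm_le_componentwise_cart) simp
    with y show "has_pd F (D i z) i z \<and> norm (D i z) \<le> B" using pd B by simp
  qed
  then have "\<forall>\<^sub>F y in at x. norm (F y - F x) \<le> B * (\<Sum>i\<in>UNIV. \<bar>y$i - x$i\<bar>)"
    unfolding eventually_at by (intro exI[of _ 1]) (auto simp: dist_norm)
  moreover have "((\<lambda>y. B * (\<Sum>i\<in>UNIV. \<bar>y$i - x$i\<bar>)) \<longlongrightarrow> B * (\<Sum>i\<in>UNIV. \<bar>x$i - x$i\<bar>)) (at x)"
    by (intro tendsto_intros)
  then have "((\<lambda>y. B * (\<Sum>i\<in>UNIV. \<bar>y$i - x$i\<bar>)) \<longlongrightarrow> 0) (at x)"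
    by simp
  ultimately have "((\<lambda>y. F y - F x) \<longlongrightarrow> 0) (at x)"
    by (rule Lim_null_comparison)
  then show "isCont F x" unfolding isCont_def by (simp add: LIM_zero_iff)
qed

lemma pdiff_inv_fourier:
  "schwartz f \<Longrightarrow> pdiff i (inv_fourier f) = inv_fourier (\<lambda>\<xi>. 2 * pi * \<i> * of_real (\<xi>$i) * f \<xi>)"
  by (intro ext pdiff_eqI inv_fourier_pd)

lemma continuous_inv_fourier:
  assumes "schwartz f" shows "continuous_on UNIV (inv_fourier f)"
proof (rule continuous_on_bounded_pd)
  show "has_pd (inv_fourier f) (inv_fourier (\<lambda>\<xi>. 2 * pi * \<i> * of_real (\<xi>$i) * f \<xi>) x) i x" for i x
    by (rule inv_fourier_pd[OF assms])
  \<comment> \<open>The dummy variable of type \<open>unit\<close> turns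
    \<open>finite_uniform_bound\<close> into a maximum over the finitely many coordinates.\<close>
  obtain B where B: "\<And>i. (\<integral>\<xi>. norm (2 * pi * \<i> * of_real (\<xi>$i) * f \<xi>) \<partial>lborel) \<le> B"
    using finite_uniform_bound[of UNIV "\<lambda>i (_::unit). \<integral>\<xi>. norm (2 * pi * \<i> * of_real (\<xi>$i) * f \<xi>) \<partial>lborel"]
    by auto
  show "\<exists>B. \<forall>i y. norm (y - x) \<le> 1 \<longrightarrow> norm (inv_fourier (\<lambda>\<xi>. 2 * pi * \<i> * of_real (\<xi>$i) * f \<xi>) y) \<le> B" for x
    by (rule exI[of _ B], intro allI impI)
      (rule order_trans[OF inv_fourier_bound[OF schwartz_coordinate_mult[OF assms]] B])
qed

lemma smooth_inv_fourier:
  assumes "schwartz f" shows "smooth (inv_fourier f)"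
proof (rule smoothI_family[where \<F> = "{inv_fourier f | f. schwartz f}" and D = "\<lambda>g j. pdiff j g"])
  fix g i x assume "g \<in> {inv_fourier f | f. schwartz f}"
  then obtain f where f: "schwartz f" "g = inv_fourier f" by auto
  show "continuous_on UNIV g" using f continuous_inv_fourier by simp
  show "has_pd g (pdiff i g x) i x" using f inv_fourier_pd by (simp add: pdiff_inv_fourier)
  show "pdiff i g \<in> {inv_fourier f | f. schwartz f}"
    using f schwartz_coordinate_mult by (auto simp: pdiff_inv_fourier)
qed (use assms in auto)

lemma Dl_inv_fourier:
  assumes "schwartz f"
  shows "Dl \<beta> (inv_fourier f) = inv_fourier (\<lambda>\<xi>. fourier_mult \<beta> \<xi> * f \<xi>)"
proof (induction \<beta>)
  case (Cons i \<beta>)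
  then show ?case
    using assms by (simp add: pdiff_inv_fourier schwartz_fourier_mult mult.assoc)
qed simp

text \<open>Integration by parts against the character: the derivative of
  \<open>echar x \<xi> * f \<xi>\<close> has integral 0, and the product rule splits it into the two
  sides. Smoothness of \<open>f\<close> thereby turns into decay of its transform.\<close>

lemma coordinate_mult_inv_fourier:
  assumes f: "schwartz f"
  shows "2 * pi * \<i> * of_real (x$i) * inv_fourier f x = - inv_fourier (pdiff i f) x"
proof -
  have sm: "smooth (echar x)" "smooth f" using slow_echar f by (auto simp: slow_def schwartz_smooth)
  have "pdiff i (echar x) \<xi> = 2 * pi * \<i> * of_real (x$i) * echar x \<xi>" for \<xi>
    using echar_pd[of x \<xi> i 0] by (intro pdiff_eqI) simp
  then have eq: "pdiff i (\<lambda>\<xi>. echar x \<xi> * f \<xi>)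
      = (\<lambda>\<xi>. echar x \<xi> * pdiff i f \<xi> + 2 * pi * \<i> * of_real (x$i) * (echar x \<xi> * f \<xi>))"
    using sm by (simp add: pdiff_mult mult.assoc)
  have int: "integrable lborel (\<lambda>\<xi>. echar x \<xi> * pdiff i f \<xi>)" "integrable lborel (\<lambda>\<xi>. echar x \<xi> * f \<xi>)"
    by (intro schwartz_integrable schwartz_echar_mult schwartz_pdiff f)+
  have "0 = integral\<^sup>L lborel (pdiff i (\<lambda>\<xi>. echar x \<xi> * f \<xi>))"
    using integral_pdiff_zero[OF schwartz_echar_mult[OF f]] by simp
  also have "\<dots> = inv_fourier (pdiff i f) x + 2 * pi * \<i> * of_real (x$i) * inv_fourier f x"
    unfolding eq inv_fourier_def using int by simp
  finally show ?thesis by (simp add: eq_neg_iff_add_eq_0 add.commute)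
qed

text \<open>One more factor \<open>wt x\<close> is 1 plus the sum of the squares
  \<open>(x$i)\<^sup>2\<close>, and each square is traded for two derivatives of \<open>f\<close>.
  The factor \<open>(2 * pi)\<^sup>2\<close> that appears is at least 1 and helps.\<close>

lemma wt_inv_fourier_bounded:
  assumes "schwartz f"
  shows "\<exists>C. \<forall>x. wt x ^ m * norm (inv_fourier f x) \<le> C"
  using assms
proof (induction m arbitrary: f)
  case 0
  then show ?case using inv_fourier_bound by auto
next
  case (Suc m)
  have "\<exists>C\<ge>0. \<forall>i\<in>UNIV. \<forall>x. wt x ^ m * norm (inv_fourier (pdiff i (pdiff i f)) x) \<le> C"
    by (rule finite_uniform_bound) (auto intro!: Suc.IH schwartz_pdiff Suc.prems)
  then obtain C where C: "\<And>i x. wt x ^ m * norm (inv_fourier (pdiff i (pdiff i f)) x) \<le> C" by auto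
  obtain D where D: "\<And>x. wt x ^ m * norm (inv_fourier f x) \<le> D" using Suc by meson
  have "wt x ^ Suc m * norm (inv_fourier f x) \<le> D + CARD('a) * C" for x
  proof -
    have "wt x ^ m * ((x$i)\<^sup>2 * norm (inv_fourier f x)) \<le> C" for i
    proof -
      have "inv_fourier (pdiff i (pdiff i f)) x = (2 * pi * \<i> * of_real (x$i)) * ((2 * pi * \<i> * of_real (x$i)) * inv_fourier f x)"
        using coordinate_mult_inv_fourier[OF Suc.prems, of x i]
          coordinate_mult_inv_fourier[OF schwartz_pdiff[OF Suc.prems], of x i i] by simp
      then have "(2 * pi)\<^sup>2 * ((x$i)\<^sup>2 * norm (inv_fourier f x)) = norm (inv_fourier (pdiff i (pdiff i f)) x)"
        by (simp add: norm_mult power2_eq_square abs_mult_self_eq)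
      moreover have "1 * ((x$i)\<^sup>2 * norm (inv_fourier f x)) \<le> (2 * pi)\<^sup>2 * ((x$i)\<^sup>2 * norm (inv_fourier f x))"
        using pi_gt3 by (intro mult_right_mono one_le_power) auto
      ultimately have "(x$i)\<^sup>2 * norm (inv_fourier f x) \<le> norm (inv_fourier (pdiff i (pdiff i f)) x)" by simp
      from mult_left_mono[OF this wt_power_nonneg] show ?thesis using C order_trans by blast
    qed
    then have "(\<Sum>i\<in>UNIV. wt x ^ m * ((x$i)\<^sup>2 * norm (inv_fourier f x))) \<le> (\<Sum>i\<in>(UNIV::'a set). C)"
      by (intro sum_mono)
    moreover have "(\<Sum>i\<in>UNIV. wt x ^ m * ((x$i)\<^sup>2 * norm (inv_fourier f x))) = wt x ^ m * ((norm x)\<^sup>2 * norm (inv_fourier f x))"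
      unfolding power2_norm_eq_inner inner_vec_def by (simp add: sum_distrib_left sum_distrib_right power2_eq_square)
    moreover have "wt x ^ Suc m * norm (inv_fourier f x) = wt x ^ m * norm (inv_fourier f x) + wt x ^ m * ((norm x)\<^sup>2 * norm (inv_fourier f x))"
      by (simp add: wt_def algebra_simps)
    ultimately show ?thesis using D[of x] by simp
  qed
  then show ?case by blast
qed

lemma schwartz_inv_fourier:
  assumes "schwartz f" shows "schwartz (inv_fourier f)"
proof (rule schwartzI_wt)
  show "smooth (inv_fourier f)" by (rule smooth_inv_fourier[OF assms])
  show "\<exists>C. \<forall>x. wt x ^ m * norm (Dl \<beta> (inv_fourier f) x) \<le> C" for \<beta> m
    unfolding Dl_inv_fourier[OF assms] by (intro wt_inv_fourier_bounded schwartz_fourier_mult assms)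
qed

section \<open>Gaussian summation and Fourier inversion at the origin\<close>

definition gauss :: "real^'n::finite \<Rightarrow> real" where
  "gauss u = (\<Prod>i\<in>UNIV. std_normal_density (u$i))"

definition gauss0 :: "'n::finite itself \<Rightarrow> real" where
  "gauss0 _ = (1 / sqrt (2 * pi)) ^ CARD('n)"

lemma gauss0_pos: "0 < gauss0 TYPE('n::finite)"
  by (simp add: gauss0_def)

lemma gauss_eq: "gauss (u::real^'n::finite) = gauss0 TYPE('n) * (\<Prod>i\<in>UNIV. exp (- (u$i)\<^sup>2 / 2))"
proof -
  have "std_normal_density x = (1 / sqrt (2 * pi)) * exp (- x\<^sup>2 / 2)" for x
    by (simp add: std_normal_density_def)
  then show ?thesis
    unfolding gauss_def gauss0_def by (simp only: prod.distrib prod_constant)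
qed

lemma gauss_nonneg: "0 \<le> gauss u"
  by (simp add: gauss_def prod_nonneg normal_density_nonneg)

lemma gauss_zero: "gauss (0::real^'n::finite) = gauss0 TYPE('n)"
  by (simp add: gauss_eq)

lemma gauss_le: "gauss (u::real^'n::finite) \<le> gauss0 TYPE('n)"
proof -
  have "(\<Prod>i\<in>UNIV. exp (- (u$i)\<^sup>2 / 2)) \<le> 1"
    by (rule prod_le_1) auto
  then show ?thesis unfolding gauss_eq using gauss0_pos[where 'n='n] by (simp add: mult_left_le)
qed

lemma continuous_gauss [continuous_intros]: "continuous_on S (gauss :: real^'n::finite \<Rightarrow> real)"
  unfolding gauss_eq by (intro continuous_intros) auto

lemma gauss_measurable [measurable]: "(gauss :: real^'n::finite \<Rightarrow> real) \<in> borel_measurable borel"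
  by (intro borel_measurable_continuous_onI continuous_gauss)

lemma integrable_std_normal: "integrable lborel std_normal_density"
  by (rule integrable_normal_density) simp

lemma integrable_gauss: "integrable lborel (gauss :: real^'n::finite \<Rightarrow> real)"
  unfolding gauss_def by (rule integrable_lborel_prod) (rule integrable_std_normal)

lemma integral_gauss: "integral\<^sup>L lborel (gauss :: real^'n::finite \<Rightarrow> real) = 1"
  unfolding gauss_def by (subst integral_lborel_prod) (simp_all add: integrable_std_normal)

lemma fourier_std_normal:
  "(\<integral>x. cis (s * x) * complex_of_real (std_normal_density x) \<partial>lborel) = of_real (exp (- s\<^sup>2 / 2))"
proof -
  have "char std_normal_distribution s = (\<integral>x. std_normal_density x *\<^sub>R iexp (s * x) \<partial>lborel)"
    unfolding char_def by (subst integral_density) (auto simp: normal_density_nonneg)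
  also have "\<dots> = (\<integral>x. cis (s * x) * complex_of_real (std_normal_density x) \<partial>lborel)"
    by (intro Bochner_Integration.integral_cong) (simp_all add: cis_conv_exp scaleR_conv_of_real mult.commute)
  finally show ?thesis by (simp add: char_std_normal_distribution)
qed

text \<open>The transform factors over the coordinates, and each factor is the characteristic
  function of the standard normal distribution. Dividing by \<open>gauss0\<close> removes the
  normalising constant.\<close>

lemma fourier_gauss:
  fixes s :: "real^'n::finite"
  shows "(\<integral>u. cis (s \<bullet> u) * complex_of_real (gauss u) \<partial>lborel) = of_real (gauss s / gauss0 TYPE('n))"
proof -
  have eq: "cis (s \<bullet> u) * complex_of_real (gauss u) = (\<Prod>i\<in>UNIV. cis (s$i * u$i) * complex_of_real (std_normal_density (u$i)))" for u
    by (simp add: gauss_def prod.distrib inner_vec_def cis_conv_exp sum_distrib_left exp_sum)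
  have int: "integrable lborel (\<lambda>x. cis (s$i * x) * complex_of_real (std_normal_density x))" for i
  proof (rule Bochner_Integration.integrable_bound[OF integrable_std_normal])
    show "(\<lambda>x. cis (s$i * x) * complex_of_real (std_normal_density x)) \<in> borel_measurable lborel"
      unfolding cis_conv_exp by measurable
  qed (simp add: norm_mult)
  have "(\<integral>u. cis (s \<bullet> u) * complex_of_real (gauss u) \<partial>lborel) = (\<Prod>i\<in>(UNIV::'n set). of_real (exp (- (s$i)\<^sup>2 / 2)))"
    unfolding eq by (subst integral_lborel_prod[OF int]) (simp add: fourier_std_normal)
  then show ?thesis
    using gauss0_pos[where 'n='n] by (simp add: gauss_eq)
qed

lemma fourier_gauss_scaled:
  fixes \<xi> :: "real^'n::finite"
  assumes d: "d > 0"
  shows "(\<integral>x. echar x \<xi> * complex_of_real (gauss (d *\<^sub>R x)) \<partial>lborel)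
    = of_real ((1 / d ^ CARD('n)) * (gauss ((2 * pi / d) *\<^sub>R \<xi>) / gauss0 TYPE('n)))"
proof -
  let ?f = "\<lambda>u. cis (((2 * pi / d) *\<^sub>R \<xi>) \<bullet> u) * complex_of_real (gauss u)"
  have int: "integrable lborel ?f"
  proof (rule Bochner_Integration.integrable_bound[OF integrable_gauss])
    show "?f \<in> borel_measurable lborel"
      unfolding cis_conv_exp by measurable
  qed (simp add: norm_mult gauss_nonneg)
  have h1: "of_real (gauss ((2 * pi / d) *\<^sub>R \<xi>) / gauss0 TYPE('n)) = \<bar>d\<bar> ^ CARD('n) *\<^sub>R (\<integral>x. ?f (0 + d *\<^sub>R x) \<partial>lborel)"
    using integral_affine[OF int, of d 0] d unfolding fourier_gauss by blast
  have h2: "?f (0 + d *\<^sub>R x) = echar x \<xi> * complex_of_real (gauss (d *\<^sub>R x))" for x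
    using d by (simp add: inner_commute mult.assoc)
  have h3: "I = of_real (1 / d ^ CARD('n) * G)" if "of_real G = \<bar>d\<bar> ^ CARD('n) *\<^sub>R I" for I :: complex and G
    using that d by (simp add: scaleR_conv_of_real[where 'a=complex] field_simps)
  show ?thesis
    by (rule h3) (rule h1[unfolded h2])
qed

text \<open>The Gaussian makes the double integral absolutely convergent, so Fubini moves the
  transform from \<open>f\<close> onto the Gaussian. The substitution
  \<open>\<xi> = (d / (2 * pi)) *\<^sub>R v\<close> then puts the dependence on \<open>d\<close>
  into the argument of \<open>f\<close>.\<close>

lemma integral_inv_fourier_gauss:
  fixes f :: "real^'n::finite \<Rightarrow> complex"
  assumes f: "schwartz f" and d: "d > 0"
  shows "(\<integral>x. inv_fourier f x * complex_of_real (gauss (d *\<^sub>R x)) \<partial>lborel)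
    = of_real (1 / ((2 * pi) ^ CARD('n) * gauss0 TYPE('n))) * (\<integral>v. f ((d / (2 * pi)) *\<^sub>R v) * complex_of_real (gauss v) \<partial>lborel)"
proof -
  interpret lborel_pair: pair_sigma_finite "lborel :: (real^'n) measure" "lborel :: (real^'n) measure" ..
  have [measurable]: "f \<in> borel_measurable borel" by (intro smooth_measurable schwartz_smooth f)
  let ?F = "\<lambda>x \<xi>. echar x \<xi> * f \<xi> * complex_of_real (gauss (d *\<^sub>R x))"
  have intd: "integrable lborel (\<lambda>x::real^'n. gauss (d *\<^sub>R x))"
    using integrable_affine[OF integrable_gauss, of d 0] d by simp
  have int: "integrable (lborel \<Otimes>\<^sub>M lborel) (\<lambda>(x, \<xi>). ?F x \<xi>)"
  proof (rule lborel_pair.Fubini_integrable)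
    show "(\<lambda>(x, \<xi>). ?F x \<xi>) \<in> borel_measurable (lborel \<Otimes>\<^sub>M lborel)"
      unfolding cis_conv_exp by measurable
    show "integrable lborel (\<lambda>x. \<integral>\<xi>. norm (case (x, \<xi>) of (x, \<xi>) \<Rightarrow> ?F x \<xi>) \<partial>lborel)"
      using intd by (simp add: norm_mult gauss_nonneg)
    have "integrable lborel (?F x)" for x
      by (rule integrable_mult_left, rule schwartz_integrable, rule schwartz_echar_mult, rule f)
    then show "AE x in lborel. integrable lborel (\<lambda>\<xi>. case (x, \<xi>) of (x, \<xi>) \<Rightarrow> ?F x \<xi>)"
      by (intro AE_I2) simp
  qed
  have "(\<integral>x. inv_fourier f x * complex_of_real (gauss (d *\<^sub>R x)) \<partial>lborel) = (\<integral>x. (\<integral>\<xi>. ?F x \<xi> \<partial>lborel) \<partial>lborel)"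
    unfolding inv_fourier_def by simp
  also have "\<dots> = (\<integral>\<xi>. (\<integral>x. ?F x \<xi> \<partial>lborel) \<partial>lborel)"
    using lborel_pair.Fubini_integral[OF int] by simp
  also have "\<dots> = (\<integral>\<xi>. f \<xi> * (\<integral>x. echar x \<xi> * complex_of_real (gauss (d *\<^sub>R x)) \<partial>lborel) \<partial>lborel)"
    by (intro Bochner_Integration.integral_cong refl) (simp add: mult_ac flip: integral_mult_right_zero)
  also have "\<dots> = (\<integral>\<xi>. of_real (1 / (d ^ CARD('n) * gauss0 TYPE('n))) * (f \<xi> * complex_of_real (gauss ((2 * pi / d) *\<^sub>R \<xi>))) \<partial>lborel)"
    unfolding fourier_gauss_scaled[OF d] by (intro Bochner_Integration.integral_cong refl) simp
  also have "\<dots> = of_real (1 / (d ^ CARD('n) * gauss0 TYPE('n))) * (\<integral>\<xi>. f \<xi> * complex_of_real (gauss ((2 * pi / d) *\<^sub>R \<xi>)) \<partial>lborel)"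
    by (rule integral_mult_right_zero)
  also have "(\<integral>\<xi>. f \<xi> * complex_of_real (gauss ((2 * pi / d) *\<^sub>R \<xi>)) \<partial>lborel)
     = of_real ((d / (2 * pi)) ^ CARD('n)) * (\<integral>v. f ((d / (2 * pi)) *\<^sub>R v) * complex_of_real (gauss v) \<partial>lborel)"
  proof -
    have "integrable lborel (\<lambda>\<xi>. f \<xi> * complex_of_real (gauss ((2 * pi / d) *\<^sub>R \<xi>)))"
    proof (rule Bochner_Integration.integrable_bound)
      show "integrable lborel (\<lambda>\<xi>. gauss0 TYPE('n) * norm (f \<xi>))"
        by (intro integrable_mult_right integrable_norm schwartz_integrable f)
      show "AE \<xi> in lborel. norm (f \<xi> * complex_of_real (gauss ((2 * pi / d) *\<^sub>R \<xi>))) \<le> norm (gauss0 TYPE('n) * norm (f \<xi>))"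
        using gauss0_pos[where 'n='n] by (intro AE_I2) (simp add: norm_mult gauss_nonneg mult.commute[of "norm (f _)"] mult_right_mono gauss_le)
    qed measurable
    from integral_affine[OF this, of "d / (2 * pi)" 0] d show ?thesis
      by (simp add: scaleR_conv_of_real[where 'a=complex])
  qed
  finally show ?thesis
    using d gauss0_pos[where 'n='n] by (simp add: field_simps power_divide)
qed

text \<open>Both sides of \<open>integral_inv_fourier_gauss\<close> converge by dominated
  convergence as \<open>d\<close> tends to 0: on the left the Gaussian flattens to its value at 0,
  on the right \<open>f\<close> is frozen at 0 and the Gaussian has mass 1.\<close>

lemma integral_inv_fourier:
  fixes f :: "real^'n::finite \<Rightarrow> complex"
  assumes f: "schwartz f"
  shows "integral\<^sup>L lborel (inv_fourier f) = f 0"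
proof -
  define d where "d k = 1 / real (Suc k)" for k
  have d: "d k > 0" for k by (simp add: d_def)
  have d0: "d \<longlonglongrightarrow> 0" unfolding d_def by (rule LIMSEQ_inverse_real_of_nat[unfolded inverse_eq_divide])
  note [measurable] = smooth_measurable[OF schwartz_smooth[OF f]]
    smooth_measurable[OF schwartz_smooth[OF schwartz_inv_fourier[OF f]]]
  have g0: "isCont gauss (0::real^'n)" using continuous_gauss[where 'n='n and S=UNIV] by (simp add: continuous_on_eq_continuous_at)
  have f0: "isCont f 0" using smooth_cont0[OF schwartz_smooth[OF f], of UNIV] by (simp add: continuous_on_eq_continuous_at)
  have lim1: "(\<lambda>k. \<integral>x. inv_fourier f x * complex_of_real (gauss (d k *\<^sub>R x)) \<partial>lborel)
      \<longlonglongrightarrow> (\<integral>x. inv_fourier f x * complex_of_real (gauss (0::real^'n)) \<partial>lborel)"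
  proof (rule integral_dominated_convergence)
    show "integrable lborel (\<lambda>x. gauss0 TYPE('n) * norm (inv_fourier f x))"
      by (intro integrable_mult_right integrable_norm schwartz_integrable schwartz_inv_fourier f)
    show "AE x in lborel. norm (inv_fourier f x * complex_of_real (gauss (d k *\<^sub>R x))) \<le> gauss0 TYPE('n) * norm (inv_fourier f x)" for k
      by (intro AE_I2) (simp add: norm_mult gauss_nonneg mult.commute[of "norm (inv_fourier f _)"] mult_right_mono gauss_le)
    have "(\<lambda>k. gauss (d k *\<^sub>R x)) \<longlonglongrightarrow> gauss (0::real^'n)" for x :: "real^'n"
      by (rule isCont_tendsto_compose[OF g0]) (use tendsto_scaleR[OF d0 tendsto_const, of x] in simp)
    then show "AE x in lborel. (\<lambda>k. inv_fourier f x * complex_of_real (gauss (d k *\<^sub>R x))) \<longlonglongrightarrow> inv_fourier f x * complex_of_real (gauss (0::real^'n))"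
      by (intro AE_I2 tendsto_intros)
  qed measurable
  obtain B where B: "\<And>x. norm (f x) \<le> B"
    using schwartz_wt[OF f, of 0 "[]"] by auto
  have lim2: "(\<lambda>k. \<integral>v. f ((d k / (2 * pi)) *\<^sub>R v) * complex_of_real (gauss v) \<partial>lborel)
      \<longlonglongrightarrow> (\<integral>v. f 0 * complex_of_real (gauss (v::real^'n)) \<partial>lborel)"
  proof (rule integral_dominated_convergence)
    show "integrable lborel (\<lambda>v::real^'n. B * gauss v)"
      by (intro integrable_mult_right integrable_gauss)
    show "AE v in lborel. norm (f ((d k / (2 * pi)) *\<^sub>R v) * complex_of_real (gauss v)) \<le> B * gauss v" for k
      by (intro AE_I2) (simp add: norm_mult gauss_nonneg mult_right_mono B)
    have "(\<lambda>k. f ((d k / (2 * pi)) *\<^sub>R x)) \<longlonglongrightarrow> f 0" for x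
    proof (rule isCont_tendsto_compose[OF f0])
      have "(\<lambda>k. (d k / (2 * pi)) *\<^sub>R x) \<longlonglongrightarrow> (0 / (2 * pi)) *\<^sub>R x"
        by (intro tendsto_intros d0) simp
      then show "(\<lambda>k. (d k / (2 * pi)) *\<^sub>R x) \<longlonglongrightarrow> 0" by simp
    qed
    then show "AE x in lborel. (\<lambda>k. f ((d k / (2 * pi)) *\<^sub>R x) * complex_of_real (gauss x)) \<longlonglongrightarrow> f 0 * complex_of_real (gauss x)"
      by (intro AE_I2 tendsto_intros)
  qed measurable
  have "integral\<^sup>L lborel (inv_fourier f) * of_real (gauss0 TYPE('n))
      = of_real (1 / ((2 * pi) ^ CARD('n) * gauss0 TYPE('n))) * (f 0 * of_real (integral\<^sup>L lborel (gauss :: real^'n \<Rightarrow> real)))"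
    using LIMSEQ_unique[OF lim1 tendsto_mult_left[OF lim2, of "of_real (1 / ((2 * pi) ^ CARD('n) * gauss0 TYPE('n)))",
        folded integral_inv_fourier_gauss[OF f d]]]
    by (simp add: gauss_zero)
  \<comment> \<open>Since \<open>gauss0\<close> is \<open>(2 * pi)\<close> to the power
    \<open>- n / 2\<close>, the two limits carry the same constant.\<close>
  moreover have "1 / ((2 * pi) ^ CARD('n) * gauss0 TYPE('n)) = gauss0 TYPE('n)"
  proof -
    have "gauss0 TYPE('n) * gauss0 TYPE('n) * (2 * pi) ^ CARD('n) = 1"
    proof -
      have "gauss0 TYPE('n) * gauss0 TYPE('n) * (2 * pi) ^ CARD('n)
          = ((1 / sqrt (2 * pi)) * (1 / sqrt (2 * pi)) * (2 * pi)) ^ CARD('n)"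
        unfolding gauss0_def by (simp only: power_mult_distrib)
      also have "(1 / sqrt (2 * pi)) * (1 / sqrt (2 * pi)) * (2 * pi) = 1"
        by simp
      finally show ?thesis by (simp only: power_one)
    qed
    moreover have "1 / (P * g) = g" if "g * g * P = 1" "0 < g" for g P :: real
    proof -
      have "P * g * g = 1" using that(1) by (simp only: mult_ac)
      then have "P * g = 1 / g" using that(2) by (simp add: eq_divide_eq)
      then show ?thesis by simp
    qed
    ultimately show ?thesis using gauss0_pos[where 'n='n] by blast
  qed
  ultimately have "integral\<^sup>L lborel (inv_fourier f) * of_real (gauss0 TYPE('n)) = f 0 * of_real (gauss0 TYPE('n))"
    by (simp only: integral_gauss of_real_1 mult_1_right mult_1_left mult.commute)
  then show ?thesis using gauss0_pos[where 'n='n] by simp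
qed

section \<open>Tempered functionals\<close>

text \<open>The seminorm is represented by its upper bounds \<open>M\<close>, in the style of the
  continuity estimate in \<open>distribution\<close>, so no supremum has to be formed.\<close>

definition sbound :: "nat \<Rightarrow> nat \<Rightarrow> real \<Rightarrow> (real^'n::finite \<Rightarrow> complex) \<Rightarrow> bool" where
  "sbound m N M f \<longleftrightarrow> (\<forall>\<beta> x. length \<beta> \<le> N \<longrightarrow> wt x ^ m * norm (Dl \<beta> f x) \<le> M)"

lemma sbound_diff:
  assumes "smooth f" "smooth g" "sbound m N A f" "sbound m N B g"
  shows "sbound m N (A + B) (\<lambda>x. f x - g x)"
  unfolding sbound_def Dl_diff[OF assms(1,2)]
proof (intro allI impI)
  fix \<beta> x assume "length (\<beta> :: 'a list) \<le> N"
  then have "wt x ^ m * norm (Dl \<beta> f x) + wt x ^ m * norm (Dl \<beta> g x) \<le> A + B"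
    using assms(3,4) unfolding sbound_def by (intro add_mono) auto
  moreover have "wt x ^ m * norm (Dl \<beta> f x - Dl \<beta> g x) \<le> wt x ^ m * (norm (Dl \<beta> f x) + norm (Dl \<beta> g x))"
    by (intro mult_left_mono norm_triangle_ineq4 wt_power_nonneg)
  ultimately show "wt x ^ m * norm (Dl \<beta> f x - Dl \<beta> g x) \<le> A + B"
    by (simp add: distrib_left)
qed

lemma sbound_diff':
  assumes "smooth f" "smooth g" "sbound m N A (\<lambda>x. f x - g x)" "sbound m N B g"
  shows "sbound m N (A + B) f"
proof -
  have "sbound m N B (\<lambda>x. (-1) * g x)"
    using assms(4) unfolding sbound_def Dl_cmult[OF assms(2)] by simp
  from sbound_diff[OF smooth_diff[OF assms(1,2)] smooth_cmult[OF assms(2)] assms(3) this]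
  show ?thesis by simp
qed

lemma schwartz_sbound:
  assumes "schwartz f" obtains M where "M \<ge> 0" "sbound m N M f"
  using schwartz_bound[OF assms, of N m] unfolding sbound_def by metis

lemma compact_closure_subset: "S \<subseteq> K \<Longrightarrow> compact K \<Longrightarrow> compact (closure S)" for K :: "'a::heine_borel set"
  by (meson bounded_closure bounded_subset closed_closure compact_eq_bounded_closed)

lemma test_fun_mult:
  assumes "test_fun U f" "smooth g"
  shows "test_fun U (\<lambda>x. f x * g x)"
proof -
  have "{x. f x * g x \<noteq> 0} \<subseteq> tsupp f" using closure_subset[of "{x. f x \<noteq> 0}"] by (auto simp: tsupp_def)
  then have sub: "tsupp (\<lambda>x. f x * g x) \<subseteq> tsupp f"
    unfolding tsupp_def by (intro closure_minimal) auto
  have "compact (tsupp (\<lambda>x. f x * g x))"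
    using sub assms(1) compact_closure_subset[of _ "tsupp f"] closure_subset unfolding test_fun_def
    by (metis (no_types, lifting) subset_trans tsupp_def)
  then show ?thesis using assms sub smooth_mult unfolding test_fun_def by blast
qed

lemma test_fun_lin:
  assumes "test_fun U f" "test_fun U g"
  shows "test_fun U (\<lambda>x. a * f x + b * g x)"
proof -
  have "tsupp (\<lambda>x. a * f x + b * g x) \<subseteq> tsupp f \<union> tsupp g"
    unfolding tsupp_def closure_Un[symmetric] by (rule closure_mono) auto
  moreover from this have "compact (tsupp (\<lambda>x. a * f x + b * g x))"
    using assms unfolding test_fun_def tsupp_def
    by (meson bounded_subset bounded_Un closed_closure compact_eq_bounded_closed)
  ultimately show ?thesis
    using assms unfolding test_fun_def by (auto intro!: smooth_add smooth_cmult)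
qed

lemma test_fun_diff:
  assumes "test_fun U f" "test_fun U g"
  shows "test_fun U (\<lambda>x. f x - g x)"
  using test_fun_lin[OF assms, of 1 "-1"] by simp

section \<open>Truncations and the extension of a functional to Schwartz functions\<close>

definition cut :: "nat \<Rightarrow> real^'n::finite \<Rightarrow> complex" where
  "cut j y = cutoff ((1 / real (Suc j)) *\<^sub>R y)"

lemma smooth_cut: "smooth (cut j)"
  using smooth_affine[OF test_fun_smooth[OF test_fun_cutoff], of 0 "1 / real (Suc j)"] by (simp add: cut_def[abs_def])

lemma cut_eq_1: "norm x \<le> real (Suc j) \<Longrightarrow> cut j x = 1"
  unfolding cut_def by (rule cutoff_eq_1) (simp add: field_simps)

lemma test_fun_cut: "test_fun UNIV (cut j)"
proof -
  have "{x. cut j x \<noteq> 0} \<subseteq> (\<lambda>y. real (Suc j) *\<^sub>R y) ` tsupp cutoff"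
  proof
    fix x assume "x \<in> {x. cut j x \<noteq> (0::complex)}"
    then have "(1 / real (Suc j)) *\<^sub>R x \<in> tsupp cutoff"
      using closure_subset[of "{x. cutoff x \<noteq> (0::complex)}"] by (auto simp: tsupp_def cut_def)
    then show "x \<in> (\<lambda>y. real (Suc j) *\<^sub>R y) ` tsupp cutoff"
      by (intro image_eqI[of _ _ "(1 / real (Suc j)) *\<^sub>R x"]) auto
  qed
  moreover have "compact ((\<lambda>y. real (Suc j) *\<^sub>R y) ` tsupp cutoff)"
    using test_fun_cutoff unfolding test_fun_def by (intro compact_scaling) auto
  ultimately have "compact (tsupp (cut j))"
    unfolding tsupp_def[of "cut j"] by (rule compact_closure_subset)
  then show ?thesis by (simp add: test_fun_def smooth_cut)
qed

text \<open>Each derivative of \<open>cut j\<close> brings a factor \<open>1 / Suc j\<close>, at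
  most 1, so the bound for \<open>cutoff\<close> holds uniformly in \<open>j\<close>.\<close>

lemma cut_Dl_bound:
  obtains A where "A \<ge> 0" "\<And>\<gamma> j x. length \<gamma> \<le> N \<Longrightarrow> norm (Dl \<gamma> (cut j) (x :: real^'n::finite)) \<le> A"
proof -
  have sm: "smooth (cutoff :: real^'n \<Rightarrow> complex)" by (rule test_fun_smooth[OF test_fun_cutoff])
  obtain A where A: "A \<ge> 0" "\<And>\<gamma> x. length \<gamma> \<le> N \<Longrightarrow> wt x ^ 0 * norm (Dl \<gamma> cutoff (x :: real^'n)) \<le> A"
    using schwartz_bound[OF test_fun_schwartz[OF test_fun_cutoff]] by metis
  show ?thesis
  proof (rule that[OF A(1)])
    fix \<gamma> :: "'n list" and j and x :: "real^'n" assume len: "length \<gamma> \<le> N"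
    have "Dl \<gamma> (cut j) x = (1 / real (Suc j)) ^ length \<gamma> *\<^sub>R Dl \<gamma> cutoff ((1 / real (Suc j)) *\<^sub>R x)"
      using fun_cong[OF Dl_affine[OF sm, of \<gamma> 0 "1 / real (Suc j)"], of x] by (simp add: cut_def[abs_def])
    moreover have "(1 / real (Suc j)) ^ length \<gamma> \<le> 1" by (intro power_le_one) auto
    ultimately have "norm (Dl \<gamma> (cut j) x) \<le> 1 * norm (Dl \<gamma> cutoff ((1 / real (Suc j)) *\<^sub>R x))"
      by (simp only: norm_scaleR) (intro mult_right_mono; simp)
    also have "\<dots> \<le> A" using A(2)[OF len] by simp
    finally show "norm (Dl \<gamma> (cut j) x) \<le> A" .
  qed
qed

text \<open>The error vanishes on the ball of radius \<open>Suc j\<close>. Outside it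
  \<open>wt x\<close> is at least \<open>Suc j\<close>, so one spare power of the weight is traded
  for the rate \<open>1 / Suc j\<close>.\<close>

lemma cut_approx:
  fixes g :: "real^'n::finite \<Rightarrow> complex"
  assumes g: "schwartz g"
  obtains B where "B \<ge> 0" "\<And>j. sbound m N (B / real (Suc j)) (\<lambda>x. cut j x * g x - g x)"
proof -
  obtain A where A: "A \<ge> 0" "\<And>\<gamma> j x. length \<gamma> \<le> N \<Longrightarrow> norm (Dl \<gamma> (cut j) (x :: real^'n)) \<le> A"
    using cut_Dl_bound by metis
  obtain D where D: "D \<ge> 0" "\<And>\<beta> x. length \<beta> \<le> N \<Longrightarrow> wt x ^ (m + 1) * norm (Dl \<beta> g x) \<le> D"
    using schwartz_bound[OF g] by metis
  have smg: "smooth g" by (rule schwartz_smooth[OF g])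
  show ?thesis
  proof (rule that[of "2 ^ N * (A + 1) * D"])
    show "0 \<le> 2 ^ N * (A + 1) * D" using A D by simp
    fix j
    let ?h = "\<lambda>x. cut j x - 1"
    have smh: "smooth ?h" by (intro smooth_diff smooth_cut smooth_const)
    have eq: "(\<lambda>x. cut j x * g x - g x) = (\<lambda>x. ?h x * g x)" by (simp add: algebra_simps)
    show "sbound m N (2 ^ N * (A + 1) * D / real (Suc j)) (\<lambda>x. cut j x * g x - g x)"
      unfolding sbound_def eq
    proof (intro allI impI)
      fix \<beta> :: "'n list" and x assume len: "length \<beta> \<le> N"
      show "wt x ^ m * norm (Dl \<beta> (\<lambda>x. ?h x * g x) x) \<le> 2 ^ N * (A + 1) * D / real (Suc j)"
      proof (cases "norm x < real (Suc j)")
        case True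
        have "Dl \<beta> (\<lambda>x. ?h x * g x) x = Dl \<beta> (\<lambda>x. 0) x"
        proof (rule Dl_local[of "ball 0 (real (Suc j))"])
          show "?h y * g y = 0" if "y \<in> ball 0 (real (Suc j))" for y
            using that cut_eq_1[of y j] by simp
        qed (use True in auto)
        then show ?thesis using A D by simp
      next
        case False
        \<comment> \<open>Here \<open>Suc j\<close> in place of \<open>j\<close> matters: it is at
          least 1, hence below its square.\<close>
        have "real (Suc j) \<le> real (Suc j) * real (Suc j)" by simp
        also have "\<dots> \<le> (norm x)\<^sup>2" unfolding power2_eq_square using False by (intro mult_mono) auto
        finally have wj: "real (Suc j) \<le> wt x" by (simp add: wt_def)
        have "norm (Dl \<gamma> ?h x) \<le> A + 1" if "length \<gamma> \<le> length \<beta>" for \<gamma>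
        proof -
          have "norm (Dl \<gamma> (cut j) x) \<le> A" using A that len by simp
          moreover have "norm (Dl \<gamma> (\<lambda>x. 1::complex) x) \<le> 1" by (simp add: Dl_const)
          ultimately show ?thesis
            unfolding Dl_diff[OF smooth_cut smooth_const]
            using norm_triangle_ineq4[of "Dl \<gamma> (cut j) x" "Dl \<gamma> (\<lambda>x. 1::complex) x"] by linarith
        qed
        moreover have "norm (Dl \<gamma> g x) \<le> D / wt x ^ (m + 1)" if "length \<gamma> \<le> length \<beta>" for \<gamma>
          using D(2)[of \<gamma> x] that len by (simp add: pos_le_divide_eq wt_pos mult.commute)
        ultimately have "norm (Dl \<beta> (\<lambda>x. ?h x * g x) x) \<le> 2 ^ length \<beta> * (A + 1) * (D / wt x ^ (m + 1))"
          by (rule norm_Dl_mult_le[OF smh smg])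
        also have "\<dots> \<le> 2 ^ N * (A + 1) * (D / wt x ^ (m + 1))"
          using len A D by (intro mult_right_mono power_increasing) (auto simp: wt_nonneg)
        finally have "wt x ^ m * norm (Dl \<beta> (\<lambda>x. ?h x * g x) x) \<le> wt x ^ m * (2 ^ N * (A + 1) * (D / wt x ^ (m + 1)))"
          by (rule mult_left_mono) (rule wt_power_nonneg)
        also have "\<dots> = 2 ^ N * (A + 1) * D / wt x"
          using wt_pos[of x] by (simp add: field_simps)
        also have "\<dots> \<le> 2 ^ N * (A + 1) * D / real (Suc j)"
          using wj A D by (intro divide_left_mono) (auto simp: wt_pos)
        finally show ?thesis .
      qed
    qed
  qed
qed

definition ext :: "'n::finite distr \<Rightarrow> (real^'n \<Rightarrow> complex) \<Rightarrow> complex" where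
  "ext T g = lim (\<lambda>j. T (\<lambda>y. cut j y * g y))"

lemma tconv_eq_ext: "tconv T f x = ext T (\<lambda>y. f (x - y))"
  by (simp add: tconv_def ext_def cut_def)

text \<open>Linearity and the estimate are demanded on test functions only; the weight
  \<open>m\<close> and the order \<open>N\<close> are what carries them over to Schwartz functions
  through \<open>ext\<close>.\<close>

locale tempered_functional =
  fixes T :: "'n::finite distr" and m N :: nat and C :: real
  assumes C_nonneg: "C \<ge> 0"
    and lin: "\<And>f g a b. test_fun UNIV f \<Longrightarrow> test_fun UNIV g \<Longrightarrow> T (\<lambda>x. a * f x + b * g x) = a * T f + b * T g"
    and bound: "\<And>f M. test_fun UNIV f \<Longrightarrow> sbound m N M f \<Longrightarrow> norm (T f) \<le> C * M"
begin

lemma T_diff: "test_fun UNIV f \<Longrightarrow> test_fun UNIV g \<Longrightarrow> T f - T g = T (\<lambda>x. f x - g x)"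
  using lin[of f g 1 "-1"] by simp

lemma test_cut: "schwartz g \<Longrightarrow> test_fun UNIV (\<lambda>y. cut j y * g y)"
  by (intro test_fun_mult test_fun_cut schwartz_smooth)

text \<open>\<open>lim\<close> carries information only for convergent sequences. Two truncations of
  \<open>g\<close> differ by errors controlled by \<open>cut_approx\<close>, so their images under
  \<open>T\<close> form a Cauchy sequence.\<close>

lemma ext_limit:
  assumes g: "schwartz g"
  shows "(\<lambda>j. T (\<lambda>y. cut j y * g y)) \<longlonglongrightarrow> ext T g"
proof -
  obtain B where B: "B \<ge> 0" "\<And>j. sbound m N (B / real (Suc j)) (\<lambda>x. cut j x * g x - g x)"
    using cut_approx[OF g] by metis
  have sm: "smooth g" "smooth (\<lambda>x. cut j x * g x)" for j
    using g by (auto intro: schwartz_smooth smooth_mult smooth_cut)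
  have le: "norm (T (\<lambda>y. cut j y * g y) - T (\<lambda>y. cut k y * g y)) \<le> C * (B / real (Suc j) + B / real (Suc k))" for j k
  proof -
    have "sbound m N (B / real (Suc j) + B / real (Suc k)) (\<lambda>x. (cut j x * g x - g x) - (cut k x * g x - g x))"
      by (intro sbound_diff smooth_diff sm B)
    then show ?thesis
      unfolding T_diff[OF test_cut[OF g] test_cut[OF g]]
      by (intro bound test_fun_diff test_cut g) simp
  qed
  have "Cauchy (\<lambda>j. T (\<lambda>y. cut j y * g y))"
  proof (rule CauchyI)
    fix e :: real assume e: "e > 0"
    have "(\<lambda>j. 2 * C * B * inverse (real (Suc j))) \<longlonglongrightarrow> 2 * C * B * 0"
      by (intro tendsto_intros LIMSEQ_inverse_real_of_nat)
    then have "\<forall>\<^sub>F j in sequentially. 2 * C * B * inverse (real (Suc j)) < e"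
      using e by (intro order_tendstoD) auto
    then obtain n where n: "2 * C * B * inverse (real (Suc n)) < e"
      by (auto simp: eventually_sequentially)
    show "\<exists>M. \<forall>j\<ge>M. \<forall>k\<ge>M. norm (T (\<lambda>y. cut j y * g y) - T (\<lambda>y. cut k y * g y)) < e"
    proof (intro exI[of _ n] allI impI)
      fix j k assume jk: "n \<le> j" "n \<le> k"
      have "C * (B / real (Suc j) + B / real (Suc k)) \<le> C * (B / real (Suc n) + B / real (Suc n))"
        using jk B C_nonneg by (intro mult_left_mono add_mono divide_left_mono) auto
      also have "\<dots> = 2 * C * B * inverse (real (Suc n))" by (simp add: divide_inverse)
      finally show "norm (T (\<lambda>y. cut j y * g y) - T (\<lambda>y. cut k y * g y)) < e"
        using le[of j k] n by linarith
    qed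
  qed
  then show ?thesis unfolding ext_def by (simp add: Cauchy_convergent_iff convergent_LIMSEQ_iff)
qed

lemma ext_bound:
  assumes g: "schwartz g" and M: "sbound m N M g"
  shows "norm (ext T g) \<le> C * M"
proof -
  obtain B where B: "B \<ge> 0" "\<And>j. sbound m N (B / real (Suc j)) (\<lambda>x. cut j x * g x - g x)"
    using cut_approx[OF g] by metis
  have sm: "smooth g" "smooth (\<lambda>x. cut j x * g x)" for j
    using g by (auto intro: schwartz_smooth smooth_mult smooth_cut)
  have "(\<lambda>j. C * (B * inverse (real (Suc j)) + M)) \<longlonglongrightarrow> C * (B * 0 + M)"
    by (intro tendsto_intros LIMSEQ_inverse_real_of_nat)
  moreover have "norm (T (\<lambda>y. cut j y * g y)) \<le> C * (B * inverse (real (Suc j)) + M)" for j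
    unfolding divide_inverse[symmetric]
    by (intro bound test_cut g sbound_diff'[OF sm(2) sm(1) B(2) M])
  ultimately have "norm (ext T g) \<le> C * (B * 0 + M)"
    by (intro LIMSEQ_le[OF tendsto_norm[OF ext_limit[OF g]]]) auto
  then show ?thesis by simp
qed

lemma ext_lin:
  assumes f: "schwartz f" and g: "schwartz g"
  shows "ext T (\<lambda>x. a * f x + b * g x) = a * ext T f + b * ext T g"
proof -
  have "(\<lambda>j. a * T (\<lambda>y. cut j y * f y) + b * T (\<lambda>y. cut j y * g y)) \<longlonglongrightarrow> a * ext T f + b * ext T g"
    by (intro tendsto_intros ext_limit f g)
  moreover have "a * T (\<lambda>y. cut j y * f y) + b * T (\<lambda>y. cut j y * g y) = T (\<lambda>y. cut j y * (a * f y + b * g y))" for j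
    unfolding lin[OF test_cut[OF f] test_cut[OF g], symmetric] by (simp add: algebra_simps)
  moreover have "(\<lambda>j. T (\<lambda>y. cut j y * (a * f y + b * g y))) \<longlonglongrightarrow> ext T (\<lambda>x. a * f x + b * g x)"
    by (intro ext_limit schwartz_add schwartz_cmult f g)
  ultimately show ?thesis using LIMSEQ_unique by simp
qed

lemma ext_diff:
  assumes "schwartz f" "schwartz g"
  shows "ext T (\<lambda>x. f x - g x) = ext T f - ext T g"
  using ext_lin[OF assms, of 1 "-1"] by simp

lemma ext_sum:
  assumes "finite A" "\<And>i. i \<in> A \<Longrightarrow> schwartz (f i)"
  shows "ext T (\<lambda>x. \<Sum>i\<in>A. c i * f i x) = (\<Sum>i\<in>A. c i * ext T (f i))"
  using assms
proof (induction A)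
  case empty
  have "ext T (\<lambda>x. 0) = 0"
    using ext_lin[of "\<lambda>x. 0" "\<lambda>x. 0" 0 0] by simp
  then show ?case by simp
next
  case (insert i A)
  then show ?case
    using ext_lin[of "f i" "\<lambda>x. \<Sum>i\<in>A. c i * f i x" "c i" 1] by (simp add: schwartz_sum schwartz_cmult)
qed

lemma ext_test:
  assumes f: "test_fun UNIV f"
  shows "ext T f = T f"
proof -
  have g: "schwartz f" by (rule test_fun_schwartz[OF f])
  obtain B where B: "B \<ge> 0" "\<And>j. sbound m N (B / real (Suc j)) (\<lambda>x. cut j x * f x - f x)"
    using cut_approx[OF g] by metis
  have "(\<lambda>j. C * (B * inverse (real (Suc j)))) \<longlonglongrightarrow> C * (B * 0)"
    by (intro tendsto_intros LIMSEQ_inverse_real_of_nat)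
  moreover have "norm (T (\<lambda>y. cut j y * f y) - T f) \<le> C * (B * inverse (real (Suc j)))" for j
    unfolding divide_inverse[symmetric] T_diff[OF test_cut[OF g] f]
    by (intro bound test_fun_diff test_cut g f B)
  ultimately have "norm (ext T f - T f) \<le> C * (B * 0)"
    by (intro LIMSEQ_le[OF tendsto_norm[OF tendsto_diff[OF ext_limit[OF g] tendsto_const]]]) auto
  then show ?thesis by simp
qed

end

section \<open>Convolution of a tempered functional with a Schwartz function\<close>

lemma schwartz_reflect:
  assumes "schwartz f" shows "schwartz (\<lambda>y. f (x - y))"
  using schwartz_affine[OF assms, of "-1" x] by simp

lemma Dl_reflect:
  assumes "smooth f" shows "Dl \<alpha> (\<lambda>y. f (x - y)) = (\<lambda>y. (-1) ^ length \<alpha> *\<^sub>R Dl \<alpha> f (x - y))"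
  using Dl_affine[OF assms, of \<alpha> x "-1"] by simp

lemma norm_Dl_reflect:
  assumes "smooth f" shows "norm (Dl \<alpha> (\<lambda>y. f (x - y)) y) = norm (Dl \<alpha> f (x - y))"
  unfolding Dl_reflect[OF assms] by (simp add: power_abs)

text \<open>Symmetry of mixed derivatives as a property of one function. It is used to differentiate
  a convolution repeatedly and to undo the reversal of a multi-index by integration by
  parts.\<close>

definition Dl_commutes :: "(real^'n::finite \<Rightarrow> complex) \<Rightarrow> bool" where
  "Dl_commutes f \<longleftrightarrow> (\<forall>\<alpha> i. Dl \<alpha> (pdiff i f) = pdiff i (Dl \<alpha> f))"

lemma Dl_commutes_Dl: "Dl_commutes f \<Longrightarrow> Dl_commutes (Dl \<beta> f)"
  unfolding Dl_commutes_def by (metis Dl_append)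

lemma Dl_commutes_pdiff: "Dl_commutes f \<Longrightarrow> Dl_commutes (pdiff i f)"
  using Dl_commutes_Dl[of f "[i]"] by simp

lemma Dl_rev: "Dl_commutes f \<Longrightarrow> Dl (rev \<alpha>) f = Dl \<alpha> f"
  by (induction \<alpha>) (auto simp: Dl_append Dl_commutes_def)

lemma Dl_commutes_inv_fourier: "schwartz f \<Longrightarrow> Dl_commutes (inv_fourier f)"
  unfolding Dl_commutes_def
proof (intro allI)
  fix \<alpha> i assume f: "schwartz f"
  have "Dl (\<alpha> @ [i]) (inv_fourier f) = Dl (i # \<alpha>) (inv_fourier f)"
    unfolding Dl_inv_fourier[OF f] by (simp add: mult_ac)
  then show "Dl \<alpha> (pdiff i (inv_fourier f)) = pdiff i (Dl \<alpha> (inv_fourier f))" by (simp add: Dl_append)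
qed

lemma wt_reflect: "wt y ^ m \<le> 2 ^ m * wt x ^ m * wt (x - y) ^ m"
  using wt_power_diff[of x "x - y" m] by simp

context tempered_functional
begin

abbreviation conv :: "(real^'n \<Rightarrow> complex) \<Rightarrow> real^'n \<Rightarrow> complex" where
  "conv f x \<equiv> ext T (\<lambda>y. f (x - y))"

text \<open>Reflection and translation preserve the size of derivatives, and Peetre's inequality
  moves the weight from \<open>y\<close> to \<open>x - y\<close> at the price
  \<open>2 ^ m * wt x ^ m\<close>.\<close>

lemma conv_bound:
  assumes f: "schwartz f" and M: "sbound m N M f"
  shows "norm (conv f x) \<le> C * (2 ^ m * wt x ^ m * M)"
proof (rule ext_bound[OF schwartz_reflect[OF f]])
  show "sbound m N (2 ^ m * wt x ^ m * M) (\<lambda>y. f (x - y))"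
    unfolding sbound_def norm_Dl_reflect[OF schwartz_smooth[OF f]]
  proof (intro allI impI)
    fix \<beta> :: "'n list" and y assume len: "length \<beta> \<le> N"
    have "wt y ^ m * norm (Dl \<beta> f (x - y)) \<le> (2 ^ m * wt x ^ m * wt (x - y) ^ m) * norm (Dl \<beta> f (x - y))"
      by (intro mult_right_mono wt_reflect) auto
    also have "\<dots> = 2 ^ m * wt x ^ m * (wt (x - y) ^ m * norm (Dl \<beta> f (x - y)))" by simp
    also have "\<dots> \<le> 2 ^ m * wt x ^ m * M"
      using M len unfolding sbound_def by (intro mult_left_mono) (auto simp: wt_nonneg)
    finally show "wt y ^ m * norm (Dl \<beta> f (x - y)) \<le> 2 ^ m * wt x ^ m * M" .
  qed
qed

text \<open>The Taylor remainder of \<open>f\<close> in direction \<open>i\<close> is itself a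
  Schwartz function whose seminorm is \<open>O(t\<^sup>2)\<close>; \<open>conv_bound\<close>
  transfers this to the remainder of the convolution. Commuting derivatives identify the derivatives
  of the remainder with remainders of derivatives.\<close>

lemma conv_pd:
  assumes f: "schwartz f" and comm: "Dl_commutes f"
  shows "has_pd (conv f) (conv (pdiff i f) x) i x"
proof -
  have "\<exists>K\<ge>0. \<forall>t z. \<bar>t\<bar> \<le> 1 \<longrightarrow> wt z ^ m * norm (Dl \<alpha> f (z + t *\<^sub>R axis i 1) - Dl \<alpha> f z - t *\<^sub>R pdiff i (Dl \<alpha> f) z) \<le> K * t\<^sup>2" for \<alpha>
    using schwartz_taylor[OF schwartz_Dl[OF f]] by metis
  then obtain k where k: "\<And>\<alpha>. k \<alpha> \<ge> 0" "\<And>\<alpha> t z. \<bar>t\<bar> \<le> 1 \<Longrightarrow>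
      wt z ^ m * norm (Dl \<alpha> f (z + t *\<^sub>R axis i 1) - Dl \<alpha> f z - t *\<^sub>R pdiff i (Dl \<alpha> f) z) \<le> k \<alpha> * t\<^sup>2"
    by metis
  define K where "K = (\<Sum>\<alpha> | length \<alpha> \<le> N. k \<alpha>)"
  have kK: "k \<alpha> \<le> K" if "length \<alpha> \<le> N" for \<alpha>
    unfolding K_def using that k(1) by (intro member_le_sum finite_lists_le) auto
  show ?thesis
  proof (rule has_vector_derivative_quadratic)
    fix t :: real assume t: "\<bar>t\<bar> \<le> 1"
    define R where "R z = f (t *\<^sub>R axis i 1 + 1 *\<^sub>R z) - f z - of_real t * pdiff i f z" for z
    have s: "schwartz (\<lambda>z. f (t *\<^sub>R axis i 1 + 1 *\<^sub>R z))" by (rule schwartz_affine[OF f]) simp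
    have sR: "schwartz R" unfolding R_def
      by (intro schwartz_diff s f schwartz_cmult schwartz_pdiff)
    have sm: "smooth f" by (rule schwartz_smooth[OF f])
    have "Dl \<alpha> R z = Dl \<alpha> f (z + t *\<^sub>R axis i 1) - Dl \<alpha> f z - t *\<^sub>R pdiff i (Dl \<alpha> f) z" for \<alpha> z
    proof -
      have "Dl \<alpha> R z = Dl \<alpha> (\<lambda>z. f (t *\<^sub>R axis i 1 + 1 *\<^sub>R z)) z - Dl \<alpha> f z - of_real t * Dl \<alpha> (pdiff i f) z"
        unfolding R_def
        by (simp add: Dl_diff Dl_cmult smooth_diff smooth_cmult smooth_pdiff sm schwartz_smooth[OF s, simplified])
      then show ?thesis
        using comm unfolding Dl_affine[OF sm] Dl_commutes_def by (simp add: add.commute scaleR_conv_of_real[where 'a=complex])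
    qed
    then have "sbound m N (K * t\<^sup>2) R"
      unfolding sbound_def using k(2)[OF t] kK
      by (metis mult_right_mono order_trans zero_le_power2)
    from conv_bound[OF sR this, of x]
    have "norm (conv R x) \<le> C * (2 ^ m * wt x ^ m * K) * t\<^sup>2" by (simp add: mult_ac)
    moreover have "conv R x = conv f (x + t *\<^sub>R axis i 1) - conv f (x + 0 *\<^sub>R axis i 1) - t *\<^sub>R conv (pdiff i f) x"
    proof -
      have "(\<lambda>y. R (x - y)) = (\<lambda>y. f ((x + t *\<^sub>R axis i 1) - y) - f (x - y) - of_real t * pdiff i f (x - y))"
        by (simp add: R_def algebra_simps)
      then show ?thesis
        using ext_lin[OF schwartz_reflect[OF schwartz_pdiff[OF f]] schwartz_zero, where a = "of_real t" and b = 0]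
        by (simp add: ext_diff schwartz_diff schwartz_reflect schwartz_cmult schwartz_pdiff f scaleR_conv_of_real[where 'a=complex])
    qed
    ultimately show "norm (conv f (x + t *\<^sub>R axis i 1) - conv f (x + 0 *\<^sub>R axis i 1) - t *\<^sub>R conv (pdiff i f) x)
        \<le> C * (2 ^ m * wt x ^ m * K) * t\<^sup>2" by simp
  qed
qed

lemma pdiff_conv: "schwartz f \<Longrightarrow> Dl_commutes f \<Longrightarrow> pdiff i (conv f) = conv (pdiff i f)"
  by (intro ext pdiff_eqI conv_pd)

lemma Dl_conv:
  assumes "schwartz f" "Dl_commutes f"
  shows "Dl \<beta> (conv f) = conv (Dl \<beta> f)"
proof (induction \<beta>)
  case (Cons i \<beta>)
  then show ?case
    using pdiff_conv[OF schwartz_Dl[OF assms(1)] Dl_commutes_Dl[OF assms(2)], of i \<beta>] by simp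
qed simp

lemma continuous_conv:
  assumes f: "schwartz f" "Dl_commutes f"
  shows "continuous_on UNIV (conv f)"
proof (rule continuous_on_bounded_pd)
  show "has_pd (conv f) (conv (pdiff i f) x) i x" for i x by (rule conv_pd[OF f])
  \<comment> \<open>The order is \<open>Suc N\<close> because the partial derivative of
    \<open>f\<close> uses up one.\<close>
  obtain M where M: "M \<ge> 0" "sbound m (Suc N) M f" using schwartz_sbound[OF f(1)] by metis
  have Mi: "sbound m N M (pdiff i f)" for i
    unfolding sbound_def
  proof (intro allI impI)
    fix \<beta> :: "'n list" and x assume "length \<beta> \<le> N"
    then show "wt x ^ m * norm (Dl \<beta> (pdiff i f) x) \<le> M"
      using M(2)[unfolded sbound_def, rule_format, of "\<beta> @ [i]" x] by (simp add: Dl_append)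
  qed
  fix x :: "real^'n"
  show "\<exists>B. \<forall>i y. norm (y - x) \<le> 1 \<longrightarrow> norm (conv (pdiff i f) y) \<le> B"
  proof (intro exI allI impI)
    fix i and y :: "real^'n" assume "norm (y - x) \<le> 1"
    then have "norm y \<le> norm x + 1" using norm_triangle_ineq[of "y - x" x] by simp
    then have "wt y \<le> 1 + (norm x + 1)\<^sup>2" by (simp add: wt_def power_mono)
    then have "C * (2 ^ m * wt y ^ m * M) \<le> C * (2 ^ m * (1 + (norm x + 1)\<^sup>2) ^ m * M)"
      using M(1) C_nonneg by (intro mult_left_mono mult_right_mono power_mono) (auto simp: wt_nonneg)
    with conv_bound[OF schwartz_pdiff[OF f(1)] Mi]
    show "norm (conv (pdiff i f) y) \<le> C * (2 ^ m * (1 + (norm x + 1)\<^sup>2) ^ m * M)"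
      by (rule order_trans)
  qed
qed

lemma smooth_conv:
  assumes f: "schwartz f" "Dl_commutes f"
  shows "smooth (conv f)"
proof (rule smoothI_family[where \<F> = "{conv f | f. schwartz f \<and> Dl_commutes f}" and D = "\<lambda>g j. pdiff j g"])
  fix g i x assume "g \<in> {conv f | f. schwartz f \<and> Dl_commutes f}"
  then obtain f where f: "schwartz f" "Dl_commutes f" "g = conv f" by auto
  show "continuous_on UNIV g" using continuous_conv f by simp
  show "has_pd g (pdiff i g x) i x" unfolding f(3) pdiff_conv[OF f(1,2)] by (rule conv_pd[OF f(1,2)])
  show "pdiff i g \<in> {conv f | f. schwartz f \<and> Dl_commutes f}"
    unfolding f(3) pdiff_conv[OF f(1,2)] using f schwartz_pdiff Dl_commutes_pdiff by blast
qed (use f in auto)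

end

section \<open>The space \<open>\<F>\<close> and the extension operator\<close>

lemma enn2real_ge1: "1 \<le> p \<Longrightarrow> p \<noteq> \<infinity> \<Longrightarrow> 1 \<le> enn2real p"
  using enn2real_mono[of 1 p] by (simp add: less_top)

text \<open>For finite \<open>p\<close> the inequality \<open>t \<le> 1 + t powr p\<close>, valid
  for \<open>t \<ge> 0\<close> as \<open>p \<ge> 1\<close>, gives the splitting with
  \<open>c = 1\<close>. All exponents are thereby treated alike.\<close>

lemma Lp_split:
  assumes Lp: "Lp U p g" and p: "1 \<le> p" and U: "U \<in> sets lebesgue"
  obtains c h where "c \<ge> 0" "\<And>x. 0 \<le> h x" "integrable lebesgue h"
    "AE x in lebesgue. x \<in> U \<longrightarrow> norm (g x) \<le> c + h x"
proof (cases "p = \<infinity>")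
  case True
  then obtain C where "AE x in lebesgue. x \<in> U \<longrightarrow> norm (g x) \<le> C"
    using Lp by (auto simp: Lp_def)
  then have "AE x in lebesgue. x \<in> U \<longrightarrow> norm (g x) \<le> max C 0 + 0"
    by eventually_elim auto
  then show ?thesis by (intro that[of "max C 0" "\<lambda>x. 0"]) auto
next
  case False
  let ?q = "enn2real p"
  let ?h = "\<lambda>x. norm (g x) powr ?q * indicator U x"
  have [measurable]: "g \<in> borel_measurable lebesgue" "U \<in> sets lebesgue" using Lp U by (auto simp: Lp_def)
  have fin: "(\<integral>\<^sup>+x. ennreal (norm (g x) powr ?q) * indicator U x \<partial>lebesgue) < \<infinity>"
    using Lp False by (simp add: Lp_def)
  show ?thesis
  proof (rule that[of 1 ?h])
    have "ennreal (norm (?h x)) = ennreal (norm (g x) powr ?q) * indicator U x" for x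
      by (simp split: split_indicator)
    then show "integrable lebesgue ?h"
      using fin unfolding integrable_iff_bounded by simp
    have "norm (g x) \<le> 1 + norm (g x) powr ?q" for x
    proof (cases "norm (g x) \<le> 1")
      case False
      then have "norm (g x) powr 1 \<le> norm (g x) powr ?q"
        using enn2real_ge1[OF p \<open>p \<noteq> \<infinity>\<close>] by (intro powr_mono) auto
      then show ?thesis using False by simp
    qed (simp add: add_increasing2)
    then show "AE x in lebesgue. x \<in> U \<longrightarrow> norm (g x) \<le> 1 + ?h x"
      by (intro AE_I2) simp
  qed auto
qed

lemma Lp_pairing:
  fixes g :: "real^'n::finite \<Rightarrow> complex"
  assumes Lp: "Lp U p g" and p: "1 \<le> p" and U: "U \<in> sets lebesgue"
  obtains C where "C \<ge> 0"
    "\<And>f M. f \<in> borel_measurable borel \<Longrightarrow> (\<And>x. wt x ^ CARD('n) * norm (f x) \<le> M) \<Longrightarrow>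
        set_integrable lebesgue U (\<lambda>x. g x * f x) \<and> norm (fdist U g f) \<le> C * M"
proof -
  obtain c h where ch: "c \<ge> 0" "\<And>x. 0 \<le> h x" "integrable lebesgue h"
    "AE x in lebesgue. x \<in> U \<longrightarrow> norm (g x) \<le> c + h x"
    using Lp_split[OF assms] by blast
  have [measurable]: "g \<in> borel_measurable lebesgue" "U \<in> sets lebesgue" using Lp U by (auto simp: Lp_def)
  \<comment> \<open>The constant part of \<open>g\<close> is paired with the decay of
    \<open>f\<close>, the integrable part only with its boundedness.\<close>
  define W where "W x = c * (1 / wt x ^ CARD('n)) + h x" for x
  have "integrable lebesgue (\<lambda>x::real^'n. 1 / wt x ^ CARD('n))"
    using integrable_wt by (simp add: integrable_completion)
  then have W: "integrable lebesgue W"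
    unfolding W_def by (intro Bochner_Integration.integrable_add integrable_mult_right ch)
  have W0: "0 \<le> W x" for x using ch by (simp add: W_def wt_nonneg)
  show ?thesis
  proof (rule that[of "integral\<^sup>L lebesgue W"])
    show "0 \<le> integral\<^sup>L lebesgue W" using W0 by simp
    fix f :: "real^'n \<Rightarrow> complex" and M assume f: "f \<in> borel_measurable borel" and M: "\<And>x. wt x ^ CARD('n) * norm (f x) \<le> M"
    have [measurable]: "f \<in> borel_measurable lebesgue" using f by (simp add: measurable_completion)
    have M0: "0 \<le> M" using order_trans[OF _ M[of 0]] by (simp add: wt_nonneg)
    have ae: "AE x in lebesgue. norm (indicat_real U x *\<^sub>R (g x * f x)) \<le> M * W x"
      using ch(4)
    proof eventually_elim
      fix x assume x: "x \<in> U \<longrightarrow> norm (g x) \<le> c + h x"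
      show "norm (indicat_real U x *\<^sub>R (g x * f x)) \<le> M * W x"
      proof (cases "x \<in> U")
        case True
        have f1: "norm (f x) \<le> M * (1 / wt x ^ CARD('n))"
          using M[of x] by (simp add: pos_le_divide_eq wt_power_pos mult.commute)
        have "1 / wt x ^ CARD('n) \<le> 1" by (simp add: wt_power_pos wt_power_ge1)
        then have "M * (1 / wt x ^ CARD('n)) \<le> M * 1" by (intro mult_left_mono M0)
        with f1 have f2: "norm (f x) \<le> M" by simp
        have "norm (g x) * norm (f x) \<le> (c + h x) * norm (f x)" using x True by (intro mult_right_mono) auto
        also have "\<dots> \<le> c * (M * (1 / wt x ^ CARD('n))) + h x * M"
          unfolding distrib_right by (intro add_mono mult_left_mono f1 f2 ch)
        finally show ?thesis using True by (simp add: W_def norm_mult algebra_simps)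
      qed (use M0 W0 in simp)
    qed
    have int: "integrable lebesgue (\<lambda>x. M * W x)" by (intro integrable_mult_right W)
    have i: "integrable lebesgue (\<lambda>x. indicat_real U x *\<^sub>R (g x * f x))"
    proof (rule Bochner_Integration.integrable_bound[OF int])
      show "AE x in lebesgue. norm (indicat_real U x *\<^sub>R (g x * f x)) \<le> norm (M * W x)"
        using ae by eventually_elim (use abs_ge_self order_trans in auto)
    qed measurable
    have "norm (fdist U g f) \<le> (\<integral>x. norm (indicat_real U x *\<^sub>R (g x * f x)) \<partial>lebesgue)"
      unfolding fdist_def set_lebesgue_integral_def by (rule integral_norm_bound)
    also have "\<dots> \<le> (\<integral>x. M * W x \<partial>lebesgue)"
      by (rule integral_mono_AE[OF integrable_norm[OF i] int ae])
    finally show "set_integrable lebesgue U (\<lambda>x. g x * f x) \<and> norm (fdist U g f) \<le> integral\<^sup>L lebesgue W * M"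
      using i by (simp add: set_integrable_def mult.commute)
  qed
qed

lemma fdist_integrable:
  fixes f :: "real^'n::finite \<Rightarrow> complex"
  assumes "Lp U p g" "1 \<le> p" "U \<in> sets lebesgue" "test_fun V f"
  shows "set_integrable lebesgue U (\<lambda>x. g x * f x)"
proof -
  have s: "schwartz f" using assms(4) by (rule test_fun_schwartz)
  obtain M where "sbound CARD('n) 0 M f" using schwartz_sbound[OF s] by metis
  then have "wt x ^ CARD('n) * norm (f x) \<le> M" for x by (auto simp: sbound_def)
  then show ?thesis
    using Lp_pairing[OF assms(1-3)] smooth_measurable[OF schwartz_smooth[OF s]] by metis
qed

lemma fdist_lin:
  fixes f g :: "real^'n::finite \<Rightarrow> complex"
  assumes Lp: "Lp U p w" "1 \<le> p" "U \<in> sets lebesgue" and f: "test_fun V f" and g: "test_fun V g"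
  shows "fdist U w (\<lambda>x. a * f x + b * g x) = a * fdist U w f + b * fdist U w g"
proof -
  note [simp] = fdist_integrable[OF Lp f] fdist_integrable[OF Lp g]
  have "(\<lambda>x. w x * (a * f x + b * g x)) = (\<lambda>x. a * (w x * f x) + b * (w x * g x))"
    by (simp add: algebra_simps)
  then show ?thesis unfolding fdist_def by (simp add: set_integral_add set_integrable_mult_right)
qed

lemma fdist_tempered:
  fixes g :: "real^'n::finite \<Rightarrow> complex"
  assumes Lp: "Lp UNIV p g" "1 \<le> p"
  obtains C where "tempered_functional (fdist UNIV g) CARD('n) 0 C"
proof -
  obtain C where C: "C \<ge> 0"
    "\<And>f M. f \<in> borel_measurable borel \<Longrightarrow> (\<And>x. wt x ^ CARD('n) * norm (f x) \<le> M) \<Longrightarrow> norm (fdist UNIV g f) \<le> C * M"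
    by (rule Lp_pairing[OF Lp]) (simp, blast)
  show ?thesis
  proof (rule that[of C], unfold_locales)
    fix f M assume "test_fun UNIV f" "sbound CARD('n) 0 M (f :: real^'n \<Rightarrow> complex)"
    then show "norm (fdist UNIV g f) \<le> C * M"
      by (intro C) (auto simp: sbound_def dest!: test_fun_smooth smooth_measurable)
  qed (use C fdist_lin[OF Lp] in auto)
qed

lemma distribution_linD:
  "distribution U T \<Longrightarrow> test_fun U f \<Longrightarrow> test_fun U g \<Longrightarrow> T (\<lambda>x. a * f x + b * g x) = a * T f + b * T g"
  by (simp add: distribution_def)

text \<open>Multiplying by a cutoff that is 1 on a ball around \<open>\<Omega>\<close> leaves
  \<open>S f\<close> unchanged and confines the support to one compact set. There the distribution
  estimate applies with a fixed order, and the Leibniz bound returns to \<open>f\<close>.\<close>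

lemma compact_support_tempered:
  fixes S :: "'n::finite distr"
  assumes S: "distribution UNIV S" and van: "\<And>f. test_fun UNIV f \<Longrightarrow> tsupp f \<inter> \<Omega> = {} \<Longrightarrow> S f = 0"
    and bdd: "bounded \<Omega>"
  obtains N C where "tempered_functional S 0 N C"
proof -
  have lin: "\<And>f g a b. test_fun UNIV f \<Longrightarrow> test_fun UNIV g \<Longrightarrow> S (\<lambda>x. a * f x + b * g x) = a * S f + b * S g"
    by (rule distribution_linD[OF S])
  obtain r where r: "\<And>x. x \<in> \<Omega> \<Longrightarrow> norm x \<le> r" using bdd by (auto simp: bounded_iff)
  obtain R where R: "r < real R" using reals_Archimedean2 by blast
  have "compact (tsupp (cut R :: real^'n \<Rightarrow> complex))" using test_fun_cut[of R] unfolding test_fun_def by blast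
  then obtain c N where cN: "\<And>f M. test_fun UNIV f \<Longrightarrow> tsupp f \<subseteq> tsupp (cut R) \<Longrightarrow>
      (\<And>\<beta> x. length \<beta> \<le> N \<Longrightarrow> norm (Dl \<beta> f x) \<le> M) \<Longrightarrow> norm (S f) \<le> c * M"
    using S unfolding distribution_def by (metis subset_UNIV)
  obtain A where A: "A \<ge> 0" "\<And>\<gamma> j x. length \<gamma> \<le> N \<Longrightarrow> norm (Dl \<gamma> (cut j) (x :: real^'n)) \<le> A"
    using cut_Dl_bound by metis
  show ?thesis
  proof (rule that[of N "\<bar>c\<bar> * (2 ^ N * A)"], unfold_locales)
    show "0 \<le> \<bar>c\<bar> * (2 ^ N * A)" using A by simp
    fix f M assume f: "test_fun UNIV f" and M: "sbound 0 N M (f :: real^'n \<Rightarrow> complex)"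
    have sm: "smooth f" by (rule test_fun_smooth[OF f])
    let ?g = "\<lambda>x. cut R x * f x"
    have g: "test_fun UNIV ?g" by (intro test_fun_mult test_fun_cut sm)
    have M0: "0 \<le> M" using order_trans[OF _ M[unfolded sbound_def, rule_format, of "[]" 0], of 0] by simp
    have "S (\<lambda>x. f x - ?g x) = 0"
    proof (rule van[OF test_fun_diff[OF f g]])
      have "tsupp (\<lambda>x. f x - ?g x) \<subseteq> - ball 0 (real (Suc R))"
        unfolding tsupp_def
      proof (rule closure_minimal)
        show "{x. f x - ?g x \<noteq> 0} \<subseteq> - ball 0 (real (Suc R))"
          using cut_eq_1[of "_ :: real^'n" R] by auto
      qed (simp add: closed_Compl)
      moreover have "\<Omega> \<subseteq> ball 0 (real (Suc R))" using r R by fastforce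
      ultimately show "tsupp (\<lambda>x. f x - ?g x) \<inter> \<Omega> = {}" by blast
    qed
    then have eq: "S f = S ?g" using lin[OF f g, of 1 "-1"] by simp
    have sub: "tsupp ?g \<subseteq> tsupp (cut R)"
      unfolding tsupp_def by (intro closure_mono) auto
    have "norm (S ?g) \<le> c * (2 ^ N * A * M)"
    proof (rule cN[OF g sub])
      fix \<beta> :: "'n list" and x assume len: "length \<beta> \<le> N"
      have "norm (Dl \<beta> ?g x) \<le> 2 ^ length \<beta> * A * M"
        by (rule norm_Dl_mult_le[OF smooth_cut sm]) (use len A M in \<open>auto simp: sbound_def\<close>)
      also have "\<dots> \<le> 2 ^ N * A * M"
        using len A M0 by (intro mult_right_mono power_increasing) auto
      finally show "norm (Dl \<beta> ?g x) \<le> 2 ^ N * A * M" .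
    qed
    also have "\<dots> \<le> \<bar>c\<bar> * (2 ^ N * A * M)" using A M0 by (intro mult_right_mono) auto
    finally show "norm (S f) \<le> \<bar>c\<bar> * (2 ^ N * A) * M" by (simp add: eq mult_ac)
  qed (rule lin)
qed

lemma tempered_functional_add:
  fixes S T :: "'n::finite distr"
  assumes S: "tempered_functional S m1 N1 C1" and T: "tempered_functional T m2 N2 C2"
  shows "tempered_functional (\<lambda>f. S f + T f) (max m1 m2) (max N1 N2) (C1 + C2)"
proof -
  interpret S: tempered_functional S m1 N1 C1 by (rule S)
  interpret T: tempered_functional T m2 N2 C2 by (rule T)
  have mono: "sbound m' N' M f" if "m' \<le> m" "N' \<le> N" "sbound m N M f" for m m' N N' M and f :: "real^'n \<Rightarrow> complex"
    unfolding sbound_def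
  proof (intro allI impI)
    fix \<beta> :: "'n list" and x assume "length \<beta> \<le> N'"
    then have "wt x ^ m * norm (Dl \<beta> f x) \<le> M" using that by (auto simp: sbound_def)
    moreover have "wt x ^ m' * norm (Dl \<beta> f x) \<le> wt x ^ m * norm (Dl \<beta> f x)"
      using that by (intro mult_right_mono wt_power_mono) auto
    ultimately show "wt x ^ m' * norm (Dl \<beta> f x) \<le> M" by simp
  qed
  show ?thesis
  proof
    fix f M assume f: "test_fun UNIV f" "sbound (max m1 m2) (max N1 N2) M (f :: real^'n \<Rightarrow> complex)"
    have "norm (S f) \<le> C1 * M" using f by (intro S.bound mono[of m1 "max m1 m2" N1 "max N1 N2"]) auto
    moreover have "norm (T f) \<le> C2 * M" using f by (intro T.bound mono[of m2 "max m1 m2" N2 "max N1 N2"]) auto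
    ultimately show "norm (S f + T f) \<le> (C1 + C2) * M"
      using norm_triangle_ineq[of "S f" "T f"] by (simp add: distrib_right)
  qed (use S.C_nonneg T.C_nonneg S.lin T.lin in \<open>auto simp: algebra_simps\<close>)
qed

lemma tempered_functional_cong:
  assumes "tempered_functional S m N C" "dist_eq UNIV T S"
  shows "tempered_functional T m N C"
proof -
  interpret tempered_functional S m N C by fact
  have eq: "T f = S f" if "test_fun UNIV f" for f
    using assms(2) that by (simp add: dist_eq_def)
  show ?thesis
    by unfold_locales (simp_all add: eq C_nonneg lin bound test_fun_lin)
qed

section \<open>The space \<open>Fprime\<close> is closed under linear combinations\<close>

lemma Lp_1_iff:
  assumes U: "U \<in> sets lebesgue"
  shows "Lp U 1 w \<longleftrightarrow> w \<in> borel_measurable lebesgue \<and> set_integrable lebesgue U w"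
proof -
  have "ennreal (norm (indicat_real U x *\<^sub>R w x)) = ennreal (norm (w x) powr enn2real 1) * indicator U x" for x
    by (simp split: split_indicator)
  moreover have "w \<in> borel_measurable lebesgue \<Longrightarrow> (\<lambda>x. indicat_real U x *\<^sub>R w x) \<in> borel_measurable lebesgue"
    using U by measurable
  ultimately show ?thesis
    unfolding Lp_def set_integrable_def integrable_iff_bounded by auto
qed

text \<open>On a set of finite measure the constant part of \<open>Lp_split\<close> is integrable
  too.\<close>

lemma Lp_bounded_imp_Lp_1:
  assumes Lp: "Lp U p w" "1 \<le> p" and U: "open U" "bounded U"
  shows "Lp U 1 w"
proof -
  have UL: "U \<in> sets lebesgue" using U by (simp add: borel_open)
  have w [measurable]: "w \<in> borel_measurable lebesgue" using Lp by (simp add: Lp_def)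
  obtain c h where ch: "c \<ge> 0" "\<And>x. 0 \<le> h x" "integrable lebesgue h"
    "AE x in lebesgue. x \<in> U \<longrightarrow> norm (w x) \<le> c + h x"
    using Lp_split[OF Lp UL] by blast
  have "emeasure lebesgue U < \<infinity>" using U emeasure_bounded_finite[of U] by (simp add: borel_open)
  then have int: "integrable lebesgue (\<lambda>x. c * indicat_real U x + h x)"
    using UL by (intro Bochner_Integration.integrable_add ch integrable_mult_right) (simp add: less_top)
  have "integrable lebesgue (\<lambda>x. indicat_real U x *\<^sub>R w x)"
  proof (rule Bochner_Integration.integrable_bound[OF int])
    show "(\<lambda>x. indicat_real U x *\<^sub>R w x) \<in> borel_measurable lebesgue" using UL by measurable
    show "AE x in lebesgue. norm (indicat_real U x *\<^sub>R w x) \<le> norm (c * indicat_real U x + h x)"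
      using ch(4) by eventually_elim (use ch in \<open>auto split: split_indicator\<close>)
  qed
  then show ?thesis using w by (simp add: Lp_1_iff[OF UL] set_integrable_def)
qed

lemma sobolev_0_iff: "sobolev U 0 p u \<longleftrightarrow> 1 \<le> p \<and> Lp U p u"
  by (auto simp: sobolev_def weak_deriv_def zero_enat_def)

lemma distribution_lin:
  assumes S: "distribution U S" and T: "distribution U T"
  shows "distribution U (\<lambda>f. a * S f + b * T f)"
  unfolding distribution_def
proof (intro conjI allI impI)
  fix f g c d assume fg: "test_fun U f" "test_fun U g"
  have "S (\<lambda>x. c * f x + d * g x) = c * S f + d * S g" "T (\<lambda>x. c * f x + d * g x) = c * T f + d * T g"
    by (rule distribution_linD[OF S fg] distribution_linD[OF T fg])+
  then show "a * S (\<lambda>x. c * f x + d * g x) + b * T (\<lambda>x. c * f x + d * g x)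
    = c * (a * S f + b * T f) + d * (a * S g + b * T g)" by (simp add: algebra_simps)
next
  fix K assume K: "compact K \<and> K \<subseteq> U"
  obtain C1 N1 where 1: "\<And>f M. test_fun U f \<and> tsupp f \<subseteq> K \<and> (\<forall>\<beta> x. length \<beta> \<le> N1 \<longrightarrow> norm (Dl \<beta> f x) \<le> M) \<Longrightarrow> norm (S f) \<le> C1 * M"
    using S K unfolding distribution_def by metis
  obtain C2 N2 where 2: "\<And>f M. test_fun U f \<and> tsupp f \<subseteq> K \<and> (\<forall>\<beta> x. length \<beta> \<le> N2 \<longrightarrow> norm (Dl \<beta> f x) \<le> M) \<Longrightarrow> norm (T f) \<le> C2 * M"
    using T K unfolding distribution_def by metis
  show "\<exists>C N. \<forall>f M. test_fun U f \<and> tsupp f \<subseteq> K \<and> (\<forall>\<beta> x. length \<beta> \<le> N \<longrightarrow> norm (Dl \<beta> f x) \<le> M) \<longrightarrow> norm (a * S f + b * T f) \<le> C * M"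
  proof (intro exI allI impI)
    fix f M assume f: "test_fun U f \<and> tsupp f \<subseteq> K \<and> (\<forall>\<beta> x. length \<beta> \<le> max N1 N2 \<longrightarrow> norm (Dl \<beta> f x) \<le> M)"
    have "norm (S f) \<le> C1 * M" by (rule 1) (use f in auto)
    then have "norm a * norm (S f) \<le> norm a * (C1 * M)" by (rule mult_left_mono) simp
    moreover have "norm (T f) \<le> C2 * M" by (rule 2) (use f in auto)
    then have "norm b * norm (T f) \<le> norm b * (C2 * M)" by (rule mult_left_mono) simp
    ultimately show "norm (a * S f + b * T f) \<le> (norm a * C1 + norm b * C2) * M"
      using norm_triangle_ineq[of "a * S f" "b * T f"] by (simp add: norm_mult algebra_simps)
  qed
qed

lemma compact_distr_lin:
  assumes S: "compact_distr \<Omega> \<Omega>' S" and T: "compact_distr \<Omega> \<Omega>' T"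
  shows "compact_distr \<Omega> \<Omega>' (\<lambda>f. a * S f + b * T f)"
proof -
  obtain K where K: "compact K" "K \<subseteq> \<Omega>'" "\<And>f. test_fun \<Omega> f \<and> tsupp f \<inter> K = {} \<Longrightarrow> S f = 0"
    using S unfolding compact_distr_def by blast
  obtain L where L: "compact L" "L \<subseteq> \<Omega>'" "\<And>f. test_fun \<Omega> f \<and> tsupp f \<inter> L = {} \<Longrightarrow> T f = 0"
    using T unfolding compact_distr_def by blast
  show ?thesis
    unfolding compact_distr_def
  proof (intro conjI exI[of _ "K \<union> L"] allI impI)
    show "distribution \<Omega> (\<lambda>f. a * S f + b * T f)"
      using S T unfolding compact_distr_def by (blast intro: distribution_lin)
    fix f assume "test_fun \<Omega> f \<and> tsupp f \<inter> (K \<union> L) = {}"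
    then have "S f = 0" "T f = 0" using K L by blast+
    then show "a * S f + b * T f = 0" by simp
  qed (use K L in auto)
qed

lemma compact_distr_zero: "compact_distr \<Omega> \<Omega>' (\<lambda>f. 0)"
  unfolding compact_distr_def distribution_def by (auto intro!: exI[of _ 0] exI[of _ "{}"])

lemma Lp_zero: "Lp U 1 (\<lambda>x. 0)"
  by (simp add: Lp_def)

lemma fdist_zero [simp]: "fdist U (\<lambda>x. 0) f = 0"
  by (simp add: fdist_def set_lebesgue_integral_def)

lemma compact_distr_Fprime: "compact_distr \<Omega> \<Omega>' v \<Longrightarrow> Fprime \<Omega> \<Omega>' v"
  unfolding Fprime_def
  by (intro exI[of _ v] exI[of _ "\<lambda>x. 0"] exI[of _ 0] exI[of _ 1]) (simp add: sobolev_0_iff Lp_zero dist_eq_def)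

lemma sobolev_Fprime: "sobolev \<Omega> k p w \<Longrightarrow> Fprime \<Omega> \<Omega>' (fdist \<Omega> w)"
  unfolding Fprime_def
  by (intro exI[of _ "\<lambda>f. 0"] exI[of _ w] exI[of _ k] exI[of _ p]) (simp add: compact_distr_zero dist_eq_def)

text \<open>The Sobolev parts of \<open>u\<close> and \<open>v\<close> may have different exponents,
  so their sum need not lie in either space. Both lie in L^1 of the bounded set, hence the
  combination is exhibited with \<open>k = 0\<close> and \<open>p = 1\<close>.\<close>

lemma Fprime_lin:
  assumes \<Omega>: "open \<Omega>" "bounded \<Omega>" and u: "Fprime \<Omega> \<Omega>' u" and v: "Fprime \<Omega> \<Omega>' v"
  shows "Fprime \<Omega> \<Omega>' (\<lambda>f. a * u f + b * v f)"
proof -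
  have UL: "\<Omega> \<in> sets lebesgue" using \<Omega> by (simp add: borel_open)
  obtain v1 w1 k1 p1 where 1: "compact_distr \<Omega> \<Omega>' v1" "sobolev \<Omega> k1 p1 w1" "dist_eq \<Omega> u (\<lambda>f. v1 f + fdist \<Omega> w1 f)"
    using u unfolding Fprime_def by blast
  obtain v2 w2 k2 p2 where 2: "compact_distr \<Omega> \<Omega>' v2" "sobolev \<Omega> k2 p2 w2" "dist_eq \<Omega> v (\<lambda>f. v2 f + fdist \<Omega> w2 f)"
    using v unfolding Fprime_def by blast
  have L: "Lp \<Omega> 1 w1" "Lp \<Omega> 1 w2"
    using 1(2) 2(2) Lp_bounded_imp_Lp_1[OF _ _ \<Omega>] by (auto simp: sobolev_def)
  have "Lp \<Omega> 1 (\<lambda>x. a * w1 x + b * w2 x)"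
    using L unfolding Lp_1_iff[OF UL] by (auto intro!: set_integral_add set_integrable_mult_right)
  then have "sobolev \<Omega> 0 1 (\<lambda>x. a * w1 x + b * w2 x)" by (simp add: sobolev_0_iff)
  moreover have "dist_eq \<Omega> (\<lambda>f. a * u f + b * v f) (\<lambda>f. (a * v1 f + b * v2 f) + fdist \<Omega> (\<lambda>x. a * w1 x + b * w2 x) f)"
    unfolding dist_eq_def
  proof (intro allI impI)
    fix f assume f: "test_fun \<Omega> f"
    have i: "set_integrable lebesgue \<Omega> (\<lambda>x. w1 x * f x)" "set_integrable lebesgue \<Omega> (\<lambda>x. w2 x * f x)"
      using L fdist_integrable[OF _ _ UL f] by auto
    have "(\<lambda>x. (a * w1 x + b * w2 x) * f x) = (\<lambda>x. a * (w1 x * f x) + b * (w2 x * f x))"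
      by (simp add: algebra_simps)
    then have "fdist \<Omega> (\<lambda>x. a * w1 x + b * w2 x) f = a * fdist \<Omega> w1 f + b * fdist \<Omega> w2 f"
      unfolding fdist_def using i by (simp add: set_integral_add set_integrable_mult_right)
    then show "a * u f + b * v f = (a * v1 f + b * v2 f) + fdist \<Omega> (\<lambda>x. a * w1 x + b * w2 x) f"
      using 1(3) 2(3) f by (simp add: dist_eq_def algebra_simps)
  qed
  ultimately show ?thesis
    unfolding Fprime_def using compact_distr_lin[OF 1(1) 2(1), of a b] by blast
qed

locale extension_operator =
  fixes \<Omega> \<Omega>' :: "(real^'n::finite) set" and E :: "'n distr \<Rightarrow> 'n distr"
  assumes open_\<Omega>: "open \<Omega>" and bounded_\<Omega>: "bounded \<Omega>"
    and E_wd: "\<And>u v. Fprime \<Omega> \<Omega>' u \<Longrightarrow> Fprime \<Omega> \<Omega>' v \<Longrightarrow> dist_eq \<Omega> u v \<Longrightarrow> dist_eq UNIV (E u) (E v)"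
    and E_lin: "\<And>u v a b. Fprime \<Omega> \<Omega>' u \<Longrightarrow> Fprime \<Omega> \<Omega>' v \<Longrightarrow>
      dist_eq UNIV (E (\<lambda>\<phi>. a * u \<phi> + b * v \<phi>)) (\<lambda>\<phi>. a * E u \<phi> + b * E v \<phi>)"
    and E_sob: "\<And>k p w. sobolev \<Omega> k p w \<Longrightarrow> \<exists>g. sobolev UNIV k p g \<and> dist_eq UNIV (E (fdist \<Omega> w)) (fdist UNIV g)"
    and E_cpt: "\<And>u. compact_distr \<Omega> \<Omega>' u \<Longrightarrow> distribution UNIV (E u) \<and>
      (\<forall>\<phi>. test_fun UNIV \<phi> \<and> tsupp \<phi> \<inter> \<Omega> = {} \<longrightarrow> E u \<phi> = 0)"
    and E_ext: "\<And>u. Fprime \<Omega> \<Omega>' u \<Longrightarrow> dist_eq \<Omega> (E u) u"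
begin

text \<open>The decomposition of \<open>u\<close> holds only up to \<open>dist_eq\<close>, so
  \<open>E_wd\<close> is needed before linearity can split \<open>E u\<close> into a compactly
  supported part and an L^p function. Membership of the sum in the domain of \<open>E\<close> comes
  from \<open>Fprime_lin\<close>.\<close>

lemma E_tempered:
  assumes u: "Fprime \<Omega> \<Omega>' u"
  obtains m N C where "tempered_functional (E u) m N C"
proof -
  obtain v w k p where vw: "compact_distr \<Omega> \<Omega>' v" "sobolev \<Omega> k p w" "dist_eq \<Omega> u (\<lambda>f. v f + fdist \<Omega> w f)"
    using u unfolding Fprime_def by blast
  obtain g where g: "sobolev UNIV k p g" "dist_eq UNIV (E (fdist \<Omega> w)) (fdist UNIV g)"
    using E_sob[OF vw(2)] by blast
  note F = compact_distr_Fprime[OF vw(1)] sobolev_Fprime[OF vw(2), of \<Omega>']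
  have "Fprime \<Omega> \<Omega>' (\<lambda>f. v f + fdist \<Omega> w f)"
    using Fprime_lin[OF open_\<Omega> bounded_\<Omega> F, of 1 1] by simp
  then have "dist_eq UNIV (E u) (E (\<lambda>f. v f + fdist \<Omega> w f))"
    by (rule E_wd[OF u _ vw(3)])
  moreover have "dist_eq UNIV (E (\<lambda>f. v f + fdist \<Omega> w f)) (\<lambda>f. E v f + E (fdist \<Omega> w) f)"
    using E_lin[OF F, of 1 1] by simp
  ultimately have eq: "dist_eq UNIV (E u) (\<lambda>f. E v f + fdist UNIV g f)"
    using g(2) by (simp add: dist_eq_def)
  obtain N C where "tempered_functional (E v) 0 N C"
    using E_cpt[OF vw(1)] compact_support_tempered[OF _ _ bounded_\<Omega>] by metis
  moreover obtain D where "tempered_functional (fdist UNIV g) CARD('n) 0 D"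
    using g(1) fdist_tempered unfolding sobolev_def by metis
  ultimately show ?thesis
    using that tempered_functional_cong[OF tempered_functional_add eq] by blast
qed

end

section \<open>Approximate identities and Riemann sums\<close>

lemma wt_nonzero [simp]: "wt x \<noteq> 0"
  using wt_pos[of x] by simp

text \<open>The rescaling in \<open>mollifier\<close>, for an arbitrary profile in place of
  \<open>inv_fourier \<psi>\<close>.\<close>

definition dilate :: "(real^'n::finite \<Rightarrow> complex) \<Rightarrow> real \<Rightarrow> real^'n \<Rightarrow> complex" where
  "dilate \<phi> \<epsilon> x = complex_of_real (1 / \<epsilon> ^ CARD('n)) * \<phi> ((1 / \<epsilon>) *\<^sub>R x)"

lemma schwartz_dilate:
  assumes "schwartz \<phi>" "\<epsilon> > 0" shows "schwartz (dilate \<phi> \<epsilon>)"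
  unfolding dilate_def[abs_def]
  by (rule schwartz_cmult) (use schwartz_affine[OF assms(1), of "1 / \<epsilon>" 0] assms(2) in simp)

lemma Dl_dilate:
  fixes \<phi> :: "real^'n::finite \<Rightarrow> complex"
  assumes "smooth \<phi>"
  shows "Dl \<alpha> (dilate \<phi> \<epsilon>) x = complex_of_real ((1 / \<epsilon>) ^ (CARD('n) + length \<alpha>)) * Dl \<alpha> \<phi> ((1 / \<epsilon>) *\<^sub>R x)"
proof -
  have eq: "dilate \<phi> \<epsilon> = (\<lambda>x. complex_of_real (1 / \<epsilon> ^ CARD('n)) * \<phi> (0 + (1 / \<epsilon>) *\<^sub>R x))"
    by (simp add: dilate_def[abs_def])
  show ?thesis
    unfolding eq Dl_cmult[OF smooth_affine[OF assms]] Dl_affine[OF assms]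
    by (simp add: scaleR_conv_of_real[where 'a=complex] power_add power_one_over)
qed

lemma Dl_commutes_dilate:
  assumes "smooth \<phi>" "Dl_commutes \<phi>" shows "Dl_commutes (dilate \<phi> \<epsilon>)"
proof -
  have "Dl (\<alpha> @ [i]) (dilate \<phi> \<epsilon>) = Dl (i # \<alpha>) (dilate \<phi> \<epsilon>)" for \<alpha> i
    unfolding Dl_dilate[OF assms(1), abs_def] using assms(2) by (simp add: Dl_commutes_def Dl_append)
  then show ?thesis unfolding Dl_commutes_def by (simp add: Dl_append)
qed

text \<open>The normalisation costs \<open>CARD('n)\<close> powers of \<open>1 / \<epsilon>\<close>
  and each derivative one more: \<open>k\<close> for derivatives of the net and \<open>N\<close> for
  the order of the functional. The weight costs nothing, since the argument only grows under scaling
  by \<open>1 / \<epsilon>\<close>.\<close>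

lemma dilate_sbound:
  fixes \<phi> :: "real^'n::finite \<Rightarrow> complex"
  assumes \<phi>: "schwartz \<phi>"
  obtains M where "M \<ge> 0" "\<And>\<epsilon> \<beta>. 0 < \<epsilon> \<Longrightarrow> \<epsilon> \<le> 1 \<Longrightarrow> length \<beta> \<le> k \<Longrightarrow>
    sbound m N ((1 / \<epsilon>) ^ (CARD('n) + (N + k)) * M) (Dl \<beta> (dilate \<phi> \<epsilon>))"
proof -
  obtain M where M: "M \<ge> 0" "\<And>\<beta> x. length \<beta> \<le> N + k \<Longrightarrow> wt x ^ m * norm (Dl \<beta> \<phi> x) \<le> M"
    using schwartz_bound[OF \<phi>] by metis
  show ?thesis
  proof (rule that[OF M(1)])
    fix \<epsilon> :: real and \<beta> :: "'n list" assume e: "0 < \<epsilon>" "\<epsilon> \<le> 1" and len: "length \<beta> \<le> k"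
    show "sbound m N ((1 / \<epsilon>) ^ (CARD('n) + (N + k)) * M) (Dl \<beta> (dilate \<phi> \<epsilon>))"
      unfolding sbound_def Dl_append[symmetric]
    proof (intro allI impI)
      fix \<alpha> :: "'n list" and x :: "real^'n" assume len': "length \<alpha> \<le> N"
      let ?z = "(1 / \<epsilon>) *\<^sub>R x" and ?l = "CARD('n) + length (\<alpha> @ \<beta>)"
      have "norm x \<le> norm ?z" using e by (simp add: pos_le_divide_eq mult_left_le)
      then have "wt x ^ m \<le> wt ?z ^ m" by (intro power_mono wt_mono wt_nonneg)
      then have "wt x ^ m * norm (Dl (\<alpha> @ \<beta>) \<phi> ?z) \<le> wt ?z ^ m * norm (Dl (\<alpha> @ \<beta>) \<phi> ?z)"
        by (rule mult_right_mono) simp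
      also have "\<dots> \<le> M" using len len' by (intro M) simp
      finally have 1: "wt x ^ m * norm (Dl (\<alpha> @ \<beta>) \<phi> ?z) \<le> M" .
      have "wt x ^ m * norm (Dl (\<alpha> @ \<beta>) (dilate \<phi> \<epsilon>) x) = (1 / \<epsilon>) ^ ?l * (wt x ^ m * norm (Dl (\<alpha> @ \<beta>) \<phi> ?z))"
        unfolding Dl_dilate[OF schwartz_smooth[OF \<phi>]] norm_mult norm_of_real using e by (simp add: abs_of_pos)
      also have "\<dots> \<le> (1 / \<epsilon>) ^ (CARD('n) + (N + k)) * M"
        using 1 len len' e M(1) by (intro mult_mono power_increasing) (auto simp: wt_nonneg)
      finally show "wt x ^ m * norm (Dl (\<alpha> @ \<beta>) (dilate \<phi> \<epsilon>) x) \<le> (1 / \<epsilon>) ^ (CARD('n) + (N + k)) * M" .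
    qed
  qed
qed

lemma pdiff_shift:
  assumes "smooth g" shows "pdiff i (\<lambda>x. g (x - y)) = (\<lambda>x. pdiff i g (x - y))"
  using Dl_affine[OF assms, of "[i]" "- y" 1] by simp

lemma schwartz_shift: "schwartz g \<Longrightarrow> schwartz (\<lambda>x. g (x - y))"
  using schwartz_affine[of g 1 "- y"] by simp

lemma integration_by_parts:
  fixes f g :: "real^'n::finite \<Rightarrow> complex"
  assumes f: "schwartz f" and g: "schwartz g"
  shows "(\<integral>x. f x * pdiff i g x \<partial>lborel) = - (\<integral>x. pdiff i f x * g x \<partial>lborel)"
proof -
  have int: "integrable lborel (\<lambda>x. f x * pdiff i g x)" "integrable lborel (\<lambda>x. pdiff i f x * g x)"
    by (intro schwartz_integrable schwartz_mult schwartz_imp_slow schwartz_pdiff f g)+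
  have "0 = integral\<^sup>L lborel (pdiff i (\<lambda>x. f x * g x))"
    by (rule integral_pdiff_zero[symmetric]) (intro schwartz_mult schwartz_imp_slow f g)
  also have "\<dots> = (\<integral>x. f x * pdiff i g x \<partial>lborel) + (\<integral>x. pdiff i f x * g x \<partial>lborel)"
    using int f g by (simp add: pdiff_mult schwartz_smooth)
  finally show ?thesis by (simp add: eq_neg_iff_add_eq_0)
qed

text \<open>The outermost derivative is moved first and ends up innermost on \<open>f\<close>, hence
  \<open>rev \<alpha>\<close>.\<close>

lemma integration_by_parts_Dl:
  fixes f g :: "real^'n::finite \<Rightarrow> complex"
  assumes f: "schwartz f" and g: "schwartz g"
  shows "(-1) ^ length \<alpha> * (\<integral>x. f x * Dl \<alpha> g (x - y) \<partial>lborel) = (\<integral>x. Dl (rev \<alpha>) f x * g (x - y) \<partial>lborel)"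
  using f
proof (induction \<alpha> arbitrary: f)
  case (Cons i \<alpha>)
  let ?g = "Dl \<alpha> g"
  have "(\<integral>x. f x * Dl (i # \<alpha>) g (x - y) \<partial>lborel) = - (\<integral>x. pdiff i f x * ?g (x - y) \<partial>lborel)"
    using integration_by_parts[OF Cons.prems schwartz_shift[OF schwartz_Dl[OF g]], of i \<alpha> y]
    by (simp add: pdiff_shift schwartz_smooth schwartz_Dl g)
  then show ?case using Cons.IH[OF schwartz_pdiff[OF Cons.prems], of i] by (simp add: Dl_append)
qed simp

lemma sum_abs_le_wt: "(\<Sum>i\<in>UNIV. \<bar>w$i\<bar>) \<le> real CARD('n) * wt (w::real^'n::finite)"
proof -
  have "\<bar>w$i\<bar> \<le> wt w" for i
    using component_le_norm_cart[of w i] norm_power_le_wt[of w 1] by simp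
  then show ?thesis using sum_bounded_above[of UNIV "\<lambda>i. \<bar>w$i\<bar>" "wt w"] by simp
qed

text \<open>Since \<open>\<epsilon> \<le> 1\<close>, intermediate points have distance at most
  \<open>norm w\<close> from \<open>y\<close>, so comparing weights costs
  \<open>2 ^ m * wt w ^ m\<close>. The length of the path contributes \<open>\<epsilon>\<close> and
  one more factor \<open>wt w\<close>.\<close>

lemma dilate_increment_bound:
  fixes F :: "real^'n::finite \<Rightarrow> complex"
  assumes F: "smooth F" and B: "\<And>i z. wt z ^ m * norm (pdiff i F z) \<le> B" "B \<ge> 0"
    and e: "0 < \<epsilon>" "\<epsilon> \<le> 1"
  shows "wt y ^ m * norm (F (y + \<epsilon> *\<^sub>R w) - F y) \<le> \<epsilon> * (real CARD('n) * B * 2 ^ m * wt w ^ (m + 1))"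
proof -
  let ?B = "B * 2 ^ m * wt w ^ m / wt y ^ m"
  have B0: "0 \<le> ?B" using B(2) by (simp add: wt_nonneg)
  have "norm (F (y + \<epsilon> *\<^sub>R w) - F y) \<le> ?B * (\<Sum>i\<in>UNIV. \<bar>(y + \<epsilon> *\<^sub>R w)$i - y$i\<bar>)"
  proof (rule coordinate_telescope)
    fix i z assume "\<And>j. \<bar>z$j - y$j\<bar> \<le> \<bar>(y + \<epsilon> *\<^sub>R w)$j - y$j\<bar>"
    then have "norm (z - y) \<le> norm (\<epsilon> *\<^sub>R w)" by (intro norm_le_componentwise_cart) simp
    also have "\<dots> \<le> norm w" using e by (simp add: mult_left_le_one_le)
    finally have "wt (z - y) ^ m \<le> wt w ^ m" by (intro power_mono wt_mono wt_nonneg)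
    then have "2 ^ m * wt z ^ m * wt (z - y) ^ m \<le> 2 ^ m * wt z ^ m * wt w ^ m"
      by (rule mult_left_mono) (simp add: wt_nonneg)
    with wt_reflect[of y m z] have "wt y ^ m \<le> 2 ^ m * wt z ^ m * wt w ^ m" by (rule order_trans)
    then have "wt y ^ m * norm (pdiff i F z) \<le> (2 ^ m * wt z ^ m * wt w ^ m) * norm (pdiff i F z)"
      by (rule mult_right_mono) simp
    also have "\<dots> = (2 ^ m * wt w ^ m) * (wt z ^ m * norm (pdiff i F z))" by simp
    also have "\<dots> \<le> (2 ^ m * wt w ^ m) * B" by (intro mult_left_mono B) (simp add: wt_nonneg)
    finally have "norm (pdiff i F z) \<le> ?B"
      by (simp add: pos_le_divide_eq wt_power_pos mult_ac)
    then show "has_pd F (pdiff i F z) i z \<and> norm (pdiff i F z) \<le> ?B"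
      using smooth_pd0[OF F] by blast
  qed
  also have "(\<Sum>i\<in>UNIV. \<bar>(y + \<epsilon> *\<^sub>R w)$i - y$i\<bar>) = \<epsilon> * (\<Sum>i\<in>UNIV. \<bar>w$i\<bar>)"
    using e by (simp add: abs_mult sum_distrib_left)
  also have "?B * (\<epsilon> * (\<Sum>i\<in>UNIV. \<bar>w$i\<bar>)) \<le> ?B * (\<epsilon> * (real CARD('n) * wt w))"
    by (intro mult_left_mono sum_abs_le_wt B0) (use e in auto)
  finally have "wt y ^ m * norm (F (y + \<epsilon> *\<^sub>R w) - F y) \<le> wt y ^ m * (?B * (\<epsilon> * (real CARD('n) * wt w)))"
    by (rule mult_left_mono) (rule wt_power_nonneg)
  also have "\<dots> = \<epsilon> * (real CARD('n) * B * 2 ^ m * wt w ^ (m + 1))"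
    using wt_power_pos[of y m] by simp
  finally show ?thesis .
qed

text \<open>After the substitution \<open>x = y + \<epsilon> *\<^sub>R w\<close>, unit mass turns
  the error into the integral of \<open>(F (y + \<epsilon> *\<^sub>R w) - F y) * \<phi> w\<close>,
  and the increment is linear in \<open>\<epsilon>\<close>.\<close>

lemma approximate_identity:
  fixes F \<phi> :: "real^'n::finite \<Rightarrow> complex"
  assumes F: "schwartz F" and \<phi>: "schwartz \<phi>" "integral\<^sup>L lborel \<phi> = 1"
  obtains K where "K \<ge> 0" "\<And>\<epsilon> y. 0 < \<epsilon> \<Longrightarrow> \<epsilon> \<le> 1 \<Longrightarrow>
    wt y ^ m * norm ((\<integral>x. F x * dilate \<phi> \<epsilon> (x - y) \<partial>lborel) - F y) \<le> K * \<epsilon>"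
proof -
  have smF: "smooth F" by (rule schwartz_smooth[OF F])
  obtain B where B: "B \<ge> 0" "\<And>\<beta> z. length \<beta> \<le> 1 \<Longrightarrow> wt z ^ m * norm (Dl \<beta> F z) \<le> B"
    using schwartz_bound[OF F] by metis
  have B1: "wt z ^ m * norm (pdiff i F z) \<le> B" for i z using B(2)[of "[i]" z] by simp
  \<comment> \<open>Of the exponent, \<open>m + 1\<close> compensates the growth of the increment in
    \<open>w\<close> and \<open>CARD('n)\<close> secures integrability.\<close>
  obtain M where M: "M \<ge> 0" "\<And>\<beta> z. length \<beta> \<le> 0 \<Longrightarrow> wt z ^ (CARD('n) + (m + 1)) * norm (Dl \<beta> \<phi> z) \<le> M"
    using schwartz_bound[OF \<phi>(1)] by metis
  let ?c = "real CARD('n) * B * 2 ^ m"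
  have w0: "0 \<le> wt_integral TYPE('n)" by (simp add: wt_integral_def wt_nonneg)
  show ?thesis
  proof (rule that[of "?c * M * wt_integral TYPE('n)"])
    show "0 \<le> ?c * M * wt_integral TYPE('n)" using B M w0 by simp
    fix \<epsilon> :: real and y :: "real^'n" assume e: "0 < \<epsilon>" "\<epsilon> \<le> 1"
    have s: "schwartz (\<lambda>w. F (y + \<epsilon> *\<^sub>R w))" by (rule schwartz_affine[OF F]) (use e in simp)
    have i1: "integrable lborel (\<lambda>x. F x * dilate \<phi> \<epsilon> (x - y))"
      by (intro schwartz_integrable schwartz_mult schwartz_imp_slow F schwartz_shift schwartz_dilate \<phi> e)
    have i2: "integrable lborel (\<lambda>w. F (y + \<epsilon> *\<^sub>R w) * \<phi> w)"
      by (intro schwartz_integrable schwartz_mult schwartz_imp_slow s \<phi>)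
    have i3: "integrable lborel (\<lambda>w. F y * \<phi> w)"
      by (intro integrable_mult_right schwartz_integrable \<phi>)
    have "(\<integral>x. F x * dilate \<phi> \<epsilon> (x - y) \<partial>lborel)
       = \<bar>\<epsilon>\<bar> ^ CARD('n) *\<^sub>R (\<integral>w. F (y + \<epsilon> *\<^sub>R w) * dilate \<phi> \<epsilon> ((y + \<epsilon> *\<^sub>R w) - y) \<partial>lborel)"
      by (rule integral_affine[OF i1]) (use e in simp)
    also have "\<dots> = (\<integral>w. \<bar>\<epsilon>\<bar> ^ CARD('n) *\<^sub>R (F (y + \<epsilon> *\<^sub>R w) * dilate \<phi> \<epsilon> ((y + \<epsilon> *\<^sub>R w) - y)) \<partial>lborel)"
      by (rule integral_scaleR_right[symmetric])
    also have "\<dots> = (\<integral>w. F (y + \<epsilon> *\<^sub>R w) * \<phi> w \<partial>lborel)"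
      by (intro Bochner_Integration.integral_cong refl)
        (use e in \<open>simp add: dilate_def scaleR_conv_of_real[where 'a=complex]\<close>)
    finally have "(\<integral>x. F x * dilate \<phi> \<epsilon> (x - y) \<partial>lborel) - F y
        = (\<integral>w. F (y + \<epsilon> *\<^sub>R w) * \<phi> w \<partial>lborel) - (\<integral>w. F y * \<phi> w \<partial>lborel)"
      using \<phi>(2) by simp
    also have "\<dots> = (\<integral>w. F (y + \<epsilon> *\<^sub>R w) * \<phi> w - F y * \<phi> w \<partial>lborel)"
      by (rule Bochner_Integration.integral_diff[OF i2 i3, symmetric])
    finally have eq: "(\<integral>x. F x * dilate \<phi> \<epsilon> (x - y) \<partial>lborel) - F y
        = (\<integral>w. F (y + \<epsilon> *\<^sub>R w) * \<phi> w - F y * \<phi> w \<partial>lborel)" .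
    have "norm (\<integral>w. F (y + \<epsilon> *\<^sub>R w) * \<phi> w - F y * \<phi> w \<partial>lborel) \<le> (\<epsilon> * ?c * M / wt y ^ m) * wt_integral TYPE('n)"
    proof (rule integral_wt_bound)
      show "(\<lambda>w. F (y + \<epsilon> *\<^sub>R w) * \<phi> w - F y * \<phi> w) \<in> borel_measurable borel"
        using Bochner_Integration.integrable_diff[OF i2 i3] by (simp add: borel_measurable_integrable)
      fix w :: "real^'n"
      have "wt y ^ m * (wt w ^ CARD('n) * norm (F (y + \<epsilon> *\<^sub>R w) * \<phi> w - F y * \<phi> w))
         = (wt y ^ m * norm (F (y + \<epsilon> *\<^sub>R w) - F y)) * (wt w ^ CARD('n) * norm (\<phi> w))"
        by (simp add: norm_mult flip: left_diff_distrib)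
      also have "\<dots> \<le> (\<epsilon> * (?c * wt w ^ (m + 1))) * (wt w ^ CARD('n) * norm (\<phi> w))"
        by (intro mult_right_mono dilate_increment_bound smF B1 B(1) e) (simp add: wt_nonneg)
      also have "\<dots> = \<epsilon> * ?c * (wt w ^ (CARD('n) + (m + 1)) * norm (Dl [] \<phi> w))"
        by (simp add: power_add)
      also have "\<dots> \<le> \<epsilon> * ?c * M"
        by (intro mult_left_mono M(2)) (use e B in auto)
      finally show "wt w ^ CARD('n) * norm (F (y + \<epsilon> *\<^sub>R w) * \<phi> w - F y * \<phi> w) \<le> \<epsilon> * ?c * M / wt y ^ m"
        by (simp add: pos_le_divide_eq wt_power_pos mult.commute)
    qed
    then have "wt y ^ m * norm ((\<integral>x. F x * dilate \<phi> \<epsilon> (x - y) \<partial>lborel) - F y)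
        \<le> wt y ^ m * ((\<epsilon> * ?c * M / wt y ^ m) * wt_integral TYPE('n))"
      unfolding eq by (rule mult_left_mono) (rule wt_power_nonneg)
    then show "wt y ^ m * norm ((\<integral>x. F x * dilate \<phi> \<epsilon> (x - y) \<partial>lborel) - F y) \<le> ?c * M * wt_integral TYPE('n) * \<epsilon>"
      using wt_power_pos[of y m] by (simp add: mult_ac)
  qed
qed

section \<open>Riemann sums with uniform error\<close>

lemma riemann_sum_bound:
  fixes f :: "'a::euclidean_space \<Rightarrow> 'b::euclidean_space"
  assumes f: "f integrable_on cbox a b" and p: "p tagged_division_of cbox a b" and e: "e \<ge> 0"
    and osc: "\<And>x k z. (x, k) \<in> p \<Longrightarrow> z \<in> k \<Longrightarrow> norm (f x - f z) \<le> e"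
  shows "norm ((\<Sum>q\<in>p. measure lborel (snd q) *\<^sub>R f (fst q)) - integral (cbox a b) f) \<le> e * measure lborel (cbox a b)"
proof -
  have "integral (cbox a b) f = (\<Sum>q\<in>p. integral (snd q) f)"
    using integral_combine_tagged_division_topdown[OF f p] by (simp add: case_prod_unfold)
  then have "norm ((\<Sum>q\<in>p. measure lborel (snd q) *\<^sub>R f (fst q)) - integral (cbox a b) f)
      = norm (\<Sum>q\<in>p. measure lborel (snd q) *\<^sub>R f (fst q) - integral (snd q) f)"
    by (simp add: sum_subtractf)
  also have "\<dots> \<le> (\<Sum>q\<in>p. e * measure lborel (snd q))"
  proof (rule sum_norm_le)
    fix q assume q: "q \<in> p"
    obtain x k where xk: "q = (x, k)" by (cases q)
    obtain u v where k: "k = cbox u v" using p q xk tagged_division_ofD(4) by blast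
    have sub: "k \<subseteq> cbox a b" using p q xk tagged_division_ofD(3) by blast
    have i: "f integrable_on k" using f sub unfolding k by (rule integrable_on_subcbox)
    have "measure lborel k *\<^sub>R f x - integral k f = integral k (\<lambda>z. f x - f z)"
      using i unfolding k by (simp add: integral_diff integrable_on_const)
    also have "norm \<dots> \<le> e * measure lborel k"
      unfolding k
    proof (rule integrable_bound[OF e])
      show "(\<lambda>z. f x - f z) integrable_on cbox u v"
        using i unfolding k by (intro integrable_diff) auto
      show "norm (f x - f z) \<le> e" if "z \<in> cbox u v" for z
        using osc q xk k that by blast
    qed
    finally show "norm (measure lborel (snd q) *\<^sub>R f (fst q) - integral (snd q) f) \<le> e * measure lborel (snd q)"
      by (simp add: xk)
  qed
  also have "\<dots> = e * measure lborel (cbox a b)"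
    using additive_content_tagged_division[OF p] by (simp add: case_prod_unfold flip: sum_distrib_left)
  finally show ?thesis .
qed

text \<open>One mesh size has to serve all \<open>y\<close>, even after multiplication by the
  weight. This works because the Lipschitz constant of \<open>\<theta> x * g (x - y)\<close> in
  \<open>x\<close> decays like \<open>1 / wt y ^ m\<close>: by Peetre's inequality the weight is
  shared between \<open>\<theta>\<close> and \<open>g\<close>.\<close>

lemma uniform_riemann_sum:
  fixes \<theta> g :: "real^'n::finite \<Rightarrow> complex"
  assumes \<theta>: "test_fun UNIV \<theta>" "tsupp \<theta> \<subseteq> cbox a b" and g: "schwartz g" and \<eta>: "\<eta> > 0"
  obtains \<delta> where "\<delta> > 0" "\<And>p y. p tagged_division_of cbox a b \<Longrightarrow> (\<lambda>x. ball x \<delta>) fine p \<Longrightarrow>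
    wt y ^ m * norm ((\<Sum>q\<in>p. measure lborel (snd q) *\<^sub>R (\<theta> (fst q) * g (fst q - y))) - (\<integral>x. \<theta> x * g (x - y) \<partial>lborel)) \<le> \<eta>"
proof -
  have s\<theta>: "schwartz \<theta>" by (rule test_fun_schwartz[OF \<theta>(1)])
  obtain A where A: "A \<ge> 0" "\<And>\<beta> x. length \<beta> \<le> 1 \<Longrightarrow> wt x ^ m * norm (Dl \<beta> \<theta> x) \<le> A"
    using schwartz_bound[OF s\<theta>] by metis
  obtain B where B: "B \<ge> 0" "\<And>\<beta> x. length \<beta> \<le> 1 \<Longrightarrow> wt x ^ m * norm (Dl \<beta> g x) \<le> B"
    using schwartz_bound[OF g] by metis
  \<comment> \<open>The factor 2 counts the terms of the product rule; \<open>2 ^ m\<close> comes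
    from splitting the weight.\<close>
  define L where "L = 2 ^ m * (2 * A * B)"
  have L0: "0 \<le> L" using A B by (simp add: L_def)
  define Q where "Q y x = \<theta> x * g (x - y)" for y x
  have sQ: "schwartz (Q y)" for y unfolding Q_def
    by (intro schwartz_mult schwartz_imp_slow schwartz_shift s\<theta> g)
  have dQ: "wt y ^ m * norm (pdiff i (Q y) x) \<le> L" for i x y
  proof -
    have dec: "wt y ^ m * norm (Dl \<beta> \<theta> x * Dl \<gamma> g (x - y)) \<le> 2 ^ m * (A * B)" if "length \<beta> \<le> 1" "length \<gamma> \<le> 1" for \<beta> \<gamma>
    proof -
      have "wt y ^ m * norm (Dl \<beta> \<theta> x * Dl \<gamma> g (x - y)) \<le> (2 ^ m * wt x ^ m * wt (x - y) ^ m) * norm (Dl \<beta> \<theta> x * Dl \<gamma> g (x - y))"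
        by (intro mult_right_mono wt_reflect) simp
      also have "\<dots> = 2 ^ m * ((wt x ^ m * norm (Dl \<beta> \<theta> x)) * (wt (x - y) ^ m * norm (Dl \<gamma> g (x - y))))"
        by (simp add: norm_mult mult_ac)
      also have "\<dots> \<le> 2 ^ m * (A * B)"
        by (intro mult_left_mono mult_mono A B that) (auto simp: wt_nonneg A)
      finally show ?thesis .
    qed
    have "pdiff i (Q y) x = Dl [] \<theta> x * Dl [i] g (x - y) + Dl [i] \<theta> x * Dl [] g (x - y)"
      unfolding Q_def by (simp add: pdiff_mult pdiff_shift schwartz_smooth schwartz_shift s\<theta> g)
    then have "wt y ^ m * norm (pdiff i (Q y) x)
        \<le> wt y ^ m * (norm (Dl [] \<theta> x * Dl [i] g (x - y)) + norm (Dl [i] \<theta> x * Dl [] g (x - y)))"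
      by (metis mult_left_mono norm_triangle_ineq wt_power_nonneg)
    also have "\<dots> \<le> L"
      using dec[of "[]" "[i]"] dec[of "[i]" "[]"] by (simp add: L_def distrib_left)
    finally show ?thesis .
  qed
  have lip: "norm (Q y x - Q y z) \<le> L / wt y ^ m * (real CARD('n) * norm (x - z))" for x y z
  proof -
    have "norm (Q y x - Q y z) \<le> L / wt y ^ m * (\<Sum>i\<in>UNIV. \<bar>x$i - z$i\<bar>)"
    proof (rule coordinate_telescope)
      show "has_pd (Q y) (pdiff i (Q y) u) i u \<and> norm (pdiff i (Q y) u) \<le> L / wt y ^ m" for i u
        using smooth_pd0[OF schwartz_smooth[OF sQ]] dQ[of y i u] by (simp add: pos_le_divide_eq wt_power_pos mult.commute)
    qed
    also have "\<dots> \<le> L / wt y ^ m * (real CARD('n) * norm (x - z))"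
    proof (rule mult_left_mono)
      show "(\<Sum>i\<in>UNIV. \<bar>x$i - z$i\<bar>) \<le> real CARD('n) * norm (x - z)"
        using sum_bounded_above[of UNIV "\<lambda>i. \<bar>x$i - z$i\<bar>" "norm (x - z)"] component_le_norm_cart[of "x - z"] by simp
    qed (simp add: L0 wt_nonneg)
    finally show ?thesis .
  qed
  \<comment> \<open>The summand 1 keeps \<open>D\<close> positive when the box or \<open>L\<close>
    degenerates; the final factor \<open>(D - 1) / D\<close> is at most 1.\<close>
  define D where "D = L * real CARD('n) * measure lborel (cbox a b) + 1"
  have D: "D > 0" using L0 by (simp add: D_def add_nonneg_pos)
  show ?thesis
  proof (rule that[of "\<eta> / D"])
    show "0 < \<eta> / D" using \<eta> D by simp
    fix p and y :: "real^'n" assume p: "p tagged_division_of cbox a b" and fine: "(\<lambda>x. ball x (\<eta> / D)) fine p"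
    have int: "(Q y has_integral integral\<^sup>L lborel (Q y)) UNIV"
      by (rule has_integral_integral_lborel[OF schwartz_integrable[OF sQ]])
    have "Q y x = 0" if "x \<notin> cbox a b" for x
      using that \<theta>(2) Dl_zero_outside_tsupp[of x \<theta> "[]"] by (auto simp: Q_def)
    then have "(\<lambda>x. if x \<in> cbox a b then Q y x else 0) = Q y" by auto
    with int have int': "(Q y has_integral integral\<^sup>L lborel (Q y)) (cbox a b)"
      using has_integral_restrict_UNIV[of "cbox a b" "Q y"] by simp
    have "norm ((\<Sum>q\<in>p. measure lborel (snd q) *\<^sub>R Q y (fst q)) - integral (cbox a b) (Q y))
        \<le> (L / wt y ^ m * (real CARD('n) * (\<eta> / D))) * measure lborel (cbox a b)"
    proof (rule riemann_sum_bound[OF _ p])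
      show "Q y integrable_on cbox a b" using int' by blast
      show "0 \<le> L / wt y ^ m * (real CARD('n) * (\<eta> / D))" using L0 \<eta> D by (simp add: wt_nonneg)
      fix x k z assume "(x, k) \<in> p" "z \<in> k"
      then have "dist x z < \<eta> / D" using fine unfolding fine_def by (metis (no_types, lifting) case_prodD mem_ball subsetD)
      then have "L / wt y ^ m * (real CARD('n) * norm (x - z)) \<le> L / wt y ^ m * (real CARD('n) * (\<eta> / D))"
        using L0 by (intro mult_left_mono) (auto simp: dist_norm wt_nonneg)
      with lip show "norm (Q y x - Q y z) \<le> L / wt y ^ m * (real CARD('n) * (\<eta> / D))" by (rule order_trans)
    qed
    then have "wt y ^ m * norm ((\<Sum>q\<in>p. measure lborel (snd q) *\<^sub>R Q y (fst q)) - integral\<^sup>L lborel (Q y))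
        \<le> wt y ^ m * ((L / wt y ^ m * (real CARD('n) * (\<eta> / D))) * measure lborel (cbox a b))"
      unfolding integral_unique[OF int'] by (rule mult_left_mono) (rule wt_power_nonneg)
    also have "\<dots> = (L * real CARD('n) * measure lborel (cbox a b)) * (\<eta> / D)"
      by simp
    also have "\<dots> = (D - 1) / D * \<eta>"
      by (simp add: D_def)
    also have "\<dots> \<le> 1 * \<eta>" using D \<eta> by (intro mult_right_mono) (auto simp: field_simps)
    finally show "wt y ^ m * norm ((\<Sum>q\<in>p. measure lborel (snd q) *\<^sub>R (\<theta> (fst q) * g (fst q - y))) - (\<integral>x. \<theta> x * g (x - y) \<partial>lborel)) \<le> \<eta>"
      by (simp add: Q_def[abs_def])
  qed
qed

section \<open>The embedding\<close>

lemma smooth_on_subset: "smooth f \<Longrightarrow> smooth_on S f"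
  unfolding smooth_on_def by (meson UNIV_I continuous_on_subset subset_UNIV)

lemma smooth_imp_smooth_closure: "smooth f \<Longrightarrow> smooth_closure \<Omega> f"
  unfolding smooth_closure_def using smooth_on_subset smooth_cont by blast

context tempered_functional
begin

lemma moderate_conv_dilate:
  assumes \<Omega>: "bounded \<Omega>" and \<phi>: "schwartz \<phi>" "Dl_commutes \<phi>"
  shows "moderate \<Omega> (\<lambda>\<epsilon>. conv (dilate \<phi> \<epsilon>))"
  unfolding moderate_def
proof (intro conjI ballI allI)
  fix \<epsilon> :: real assume "\<epsilon> \<in> {0<..1}"
  then show "smooth_closure \<Omega> (conv (dilate \<phi> \<epsilon>))"
    by (intro smooth_imp_smooth_closure smooth_conv schwartz_dilate Dl_commutes_dilate schwartz_smooth \<phi>) auto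
next
  fix k :: nat
  obtain r where r: "r \<ge> 0" "\<And>x. x \<in> \<Omega> \<Longrightarrow> norm x \<le> r"
    using \<Omega> by (meson bounded_pos less_imp_le)
  obtain M where M: "M \<ge> 0" "\<And>\<epsilon> \<beta>. 0 < \<epsilon> \<Longrightarrow> \<epsilon> \<le> 1 \<Longrightarrow> length \<beta> \<le> k \<Longrightarrow>
    sbound m N ((1 / \<epsilon>) ^ (CARD('n) + (N + k)) * M) (Dl \<beta> (dilate \<phi> \<epsilon>))"
    using dilate_sbound[OF \<phi>(1)] by blast
  let ?j = "CARD('n) + (N + k)" and ?W = "(1 + r\<^sup>2) ^ m"
  have "norm (Dl \<beta> (conv (dilate \<phi> \<epsilon>)) x) \<le> C * (2 ^ m * ?W * M) * \<epsilon> powr (- real ?j)"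
    if e: "0 < \<epsilon>" "\<epsilon> < 1" and len: "length \<beta> \<le> k" and x: "x \<in> \<Omega>" for \<epsilon> \<beta> x
  proof -
    have s: "schwartz (dilate \<phi> \<epsilon>)" by (intro schwartz_dilate \<phi> e)
    have c: "Dl_commutes (dilate \<phi> \<epsilon>)" by (intro Dl_commutes_dilate schwartz_smooth \<phi>)
    have "sbound m N ((1 / \<epsilon>) ^ ?j * M) (Dl \<beta> (dilate \<phi> \<epsilon>))"
      by (rule M(2)) (use e len in auto)
    from conv_bound[OF schwartz_Dl[OF s] this, of x]
    have "norm (Dl \<beta> (conv (dilate \<phi> \<epsilon>)) x) \<le> C * (2 ^ m * wt x ^ m * ((1 / \<epsilon>) ^ ?j * M))"
      unfolding Dl_conv[OF s c] .
    also have "\<dots> \<le> C * (2 ^ m * ?W * ((1 / \<epsilon>) ^ ?j * M))"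
    proof -
      have "wt x \<le> 1 + r\<^sup>2" using r(2)[OF x] by (simp add: wt_def power_mono)
      then have "wt x ^ m \<le> ?W" by (intro power_mono wt_nonneg)
      then show ?thesis
        using C_nonneg M(1) e by (intro mult_left_mono mult_right_mono) auto
    qed
    also have "(1 / \<epsilon>) ^ ?j = \<epsilon> powr (- real ?j)"
      using e by (simp only: powr_minus powr_realpow power_one_over inverse_eq_divide)
    finally show ?thesis by (simp only: mult_ac)
  qed
  then show "\<exists>a C. \<exists>\<epsilon>0>0. \<forall>\<epsilon>. 0 < \<epsilon> \<and> \<epsilon> < \<epsilon>0 \<longrightarrow>
      (\<forall>\<beta> x. length \<beta> \<le> k \<and> x \<in> \<Omega> \<longrightarrow> norm (Dl \<beta> (conv (dilate \<phi> \<epsilon>)) x) \<le> C * \<epsilon> powr a)"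
    by (intro exI[of _ "- real ?j"] exI[of _ "C * (2 ^ m * ?W * M)"] exI[of _ 1]) auto
qed

text \<open>The Riemann sums \<open>S\<close> of \<open>\<theta> * (\<phi>\<^sub>\<epsilon> reflected)\<close> approximate \<open>\<theta>\<close> in the seminorms
  controlling \<open>T\<close>, and \<open>T S\<close> only involves values of \<open>T * \<phi>\<^sub>\<epsilon>\<close> on the support of \<open>\<theta>\<close>;
  this replaces an interchange of \<open>T\<close> with an integral.\<close>
lemma functional_zero_of_conv_small:
  assumes \<theta>: "test_fun \<Omega> \<theta>"
    and \<phi>: "schwartz \<phi>" "Dl_commutes \<phi>" "integral\<^sup>L lborel \<phi> = 1"
    and small: "\<epsilon>0 > 0" "\<And>\<epsilon> x. 0 < \<epsilon> \<Longrightarrow> \<epsilon> < \<epsilon>0 \<Longrightarrow> x \<in> \<Omega> \<Longrightarrow> norm (conv (dilate \<phi> \<epsilon>) x) \<le> D * \<epsilon>"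
  shows "T \<theta> = 0"
proof -
  have \<theta>U: "test_fun UNIV \<theta>" using \<theta> by (simp add: test_fun_def)
  have s\<theta>: "schwartz \<theta>" by (rule test_fun_schwartz[OF \<theta>])
  have "bounded (tsupp \<theta>)" using \<theta> by (simp add: test_fun_def compact_imp_bounded)
  then obtain a b where box: "tsupp \<theta> \<subseteq> cbox a b" using bounded_subset_cbox_symmetric by metis
  obtain A where A: "A \<ge> 0" "\<And>x. norm (\<theta> x) \<le> A"
  proof -
    obtain A where "A \<ge> 0" "sbound 0 0 A \<theta>" using schwartz_sbound[OF s\<theta>] by metis
    then show ?thesis using that by (auto simp: sbound_def)
  qed
  \<comment> \<open>The predicate packages the estimate so that one constant for each multi-index
    can be chosen; the constants must be independent of \<open>\<epsilon>\<close>, hence the choice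
    outside \<open>main\<close>.\<close>
  define P where "P \<alpha> K \<longleftrightarrow> K \<ge> 0 \<and> (\<forall>\<epsilon> y. 0 < \<epsilon> \<and> \<epsilon> \<le> 1 \<longrightarrow>
      wt y ^ m * norm ((\<integral>x. Dl \<alpha> \<theta> x * dilate \<phi> \<epsilon> (x - y) \<partial>lborel) - Dl \<alpha> \<theta> y) \<le> K * \<epsilon>)" for \<alpha> K
  have "\<exists>K. P \<alpha> K" for \<alpha>
    unfolding P_def by (rule approximate_identity[OF schwartz_Dl[OF s\<theta>, of \<alpha>] \<phi>(1,3), of m]) blast
  then obtain k where "\<And>\<alpha>. P \<alpha> (k \<alpha>)" by metis
  then have k: "k \<alpha> \<ge> 0" "0 < \<epsilon> \<Longrightarrow> \<epsilon> \<le> 1 \<Longrightarrow>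
      wt y ^ m * norm ((\<integral>x. Dl \<alpha> \<theta> x * dilate \<phi> \<epsilon> (x - y) \<partial>lborel) - Dl \<alpha> \<theta> y) \<le> k \<alpha> * \<epsilon>" for \<alpha> \<epsilon> y
    unfolding P_def by blast+
  define K where "K = (\<Sum>\<alpha> | length \<alpha> \<le> N. k \<alpha>)"
  have kK: "k \<alpha> \<le> K" if "length \<alpha> \<le> N" for \<alpha>
    unfolding K_def using that k(1) by (intro member_le_sum finite_lists_le) auto
  let ?V = "measure lborel (cbox a b)"
  \<comment> \<open>The first summand bounds \<open>ext T S\<close> by the smallness of the net. In
    the second, 1 is the error of the Riemann sum and \<open>K\<close> that of the approximate
    identity.\<close>
  have main: "norm (T \<theta>) \<le> (?V * A * \<bar>D\<bar> + C * (1 + K)) * \<epsilon>" if e: "0 < \<epsilon>" "\<epsilon> < \<epsilon>0" "\<epsilon> \<le> 1" for \<epsilon>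
  proof -
    let ?\<phi> = "dilate \<phi> \<epsilon>"
    have s\<phi>: "schwartz ?\<phi>" by (intro schwartz_dilate \<phi> e)
    have c\<phi>: "Dl_commutes ?\<phi>" by (intro Dl_commutes_dilate schwartz_smooth \<phi>)
    \<comment> \<open>The tolerance of the Riemann sums is \<open>\<epsilon>\<close> itself, which
      gives their error the order of the other terms. The mesh may depend on
      \<open>\<epsilon>\<close>.\<close>
    define P where "P \<alpha> d \<longleftrightarrow> d > 0 \<and> (\<forall>p y. p tagged_division_of cbox a b \<and> (\<lambda>x. ball x d) fine p \<longrightarrow>
        wt y ^ m * norm ((\<Sum>q\<in>p. measure lborel (snd q) *\<^sub>R (\<theta> (fst q) * Dl \<alpha> ?\<phi> (fst q - y)))
          - (\<integral>x. \<theta> x * Dl \<alpha> ?\<phi> (x - y) \<partial>lborel)) \<le> \<epsilon>)" for \<alpha> d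
    have "\<exists>d. P \<alpha> d" for \<alpha>
      unfolding P_def by (rule uniform_riemann_sum[OF \<theta>U box schwartz_Dl[OF s\<phi>, of \<alpha>] e(1), of m]) blast
    then obtain d where "\<And>\<alpha>. P \<alpha> (d \<alpha>)" by metis
    then have d: "d \<alpha> > 0" "p tagged_division_of cbox a b \<Longrightarrow> (\<lambda>x. ball x (d \<alpha>)) fine p \<Longrightarrow>
        wt y ^ m * norm ((\<Sum>q\<in>p. measure lborel (snd q) *\<^sub>R (\<theta> (fst q) * Dl \<alpha> ?\<phi> (fst q - y)))
          - (\<integral>x. \<theta> x * Dl \<alpha> ?\<phi> (x - y) \<partial>lborel)) \<le> \<epsilon>" for \<alpha> p y
      unfolding P_def by blast+
    \<comment> \<open>A minimum over finitely many multi-indices: a single partition must serve all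
      derivatives up to order \<open>N\<close>.\<close>
    define \<delta> where "\<delta> = Min (d ` {\<alpha>. length \<alpha> \<le> N})"
    have ne: "{\<alpha> :: 'n list. length \<alpha> \<le> N} \<noteq> {}" by (auto intro!: exI[of _ "[]"])
    have \<delta>0: "\<delta> > 0" unfolding \<delta>_def using d(1) ne by (subst Min_gr_iff) (auto simp: finite_lists_le)
    have \<delta>d: "\<delta> \<le> d \<alpha>" if "length \<alpha> \<le> N" for \<alpha>
      unfolding \<delta>_def using that by (intro Min_le) (auto simp: finite_lists_le)
    obtain p where p: "p tagged_division_of cbox a b" "(\<lambda>x. ball x \<delta>) fine p"
      using fine_division_exists[of "\<lambda>x. ball x \<delta>"] \<delta>0 by (metis gauge_ball)
    have finp: "finite p" using p(1) by blast
    define S where "S y = (\<Sum>q\<in>p. (of_real (measure lborel (snd q)) * \<theta> (fst q)) * ?\<phi> (fst q - y))" for y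
    have sS: "schwartz S" unfolding S_def
      by (intro schwartz_sum schwartz_cmult schwartz_reflect s\<phi>)
    have "sbound m N ((1 + K) * \<epsilon>) (\<lambda>y. S y - \<theta> y)"
      unfolding sbound_def
    proof (intro allI impI)
      fix \<alpha> :: "'n list" and y assume len: "length \<alpha> \<le> N"
      let ?R = "\<Sum>q\<in>p. measure lborel (snd q) *\<^sub>R (\<theta> (fst q) * Dl \<alpha> ?\<phi> (fst q - y))"
      let ?I = "\<integral>x. \<theta> x * Dl \<alpha> ?\<phi> (x - y) \<partial>lborel"
      let ?J = "\<integral>x. Dl \<alpha> \<theta> x * ?\<phi> (x - y) \<partial>lborel"
      have sm\<phi>: "smooth ?\<phi>" by (rule schwartz_smooth[OF s\<phi>])
      have sr: "smooth (\<lambda>y. ?\<phi> (x - y))" for x by (rule schwartz_smooth[OF schwartz_reflect[OF s\<phi>]])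
      have "Dl \<alpha> S y = (\<Sum>q\<in>p. (of_real (measure lborel (snd q)) * \<theta> (fst q)) * ((-1) ^ length \<alpha> *\<^sub>R Dl \<alpha> ?\<phi> (fst q - y)))"
        unfolding S_def
        by (subst Dl_sum, rule smooth_cmult, rule sr) (simp only: Dl_cmult[OF sr] Dl_reflect[OF sm\<phi>])
      also have "\<dots> = (-1) ^ length \<alpha> * ?R"
        by (simp add: sum_distrib_left scaleR_conv_of_real[where 'a=complex] mult_ac)
      finally have DS: "Dl \<alpha> S y = (-1) ^ length \<alpha> * ?R" .
      \<comment> \<open>Integration by parts reverses the list. Starting from
        \<open>rev \<alpha>\<close>, which \<open>Dl_rev\<close> permits on the mollifier, puts
        \<open>\<alpha>\<close> itself on \<open>\<theta>\<close>.\<close>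
      have "(-1) ^ length \<alpha> * ?I = (-1) ^ length (rev \<alpha>) * (\<integral>x. \<theta> x * Dl (rev \<alpha>) ?\<phi> (x - y) \<partial>lborel)"
        by (simp add: Dl_rev[OF c\<phi>])
      also have "\<dots> = ?J"
        by (subst integration_by_parts_Dl[OF s\<theta> s\<phi>]) simp
      finally have IJ: "(-1) ^ length \<alpha> * ?I = ?J" .
      have "(\<lambda>x. ball x (d \<alpha>)) fine p"
        using p(2) \<delta>d[OF len] unfolding fine_def by fastforce
      from d(2)[OF p(1) this, of y] have 1: "wt y ^ m * norm (?R - ?I) \<le> \<epsilon>" .
      have "wt y ^ m * norm (?J - Dl \<alpha> \<theta> y) \<le> k \<alpha> * \<epsilon>" by (rule k(2)[OF e(1,3)])
      also have "\<dots> \<le> K * \<epsilon>" using kK[OF len] e by (intro mult_right_mono) auto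
      finally have 2: "wt y ^ m * norm (?J - Dl \<alpha> \<theta> y) \<le> K * \<epsilon>" .
      have "Dl \<alpha> (\<lambda>y. S y - \<theta> y) y = (-1) ^ length \<alpha> * (?R - ?I) + (?J - Dl \<alpha> \<theta> y)"
        unfolding Dl_diff[OF schwartz_smooth[OF sS] schwartz_smooth[OF s\<theta>]] DS IJ[symmetric]
        by (simp add: right_diff_distrib)
      then have "norm (Dl \<alpha> (\<lambda>y. S y - \<theta> y) y) \<le> norm (?R - ?I) + norm (?J - Dl \<alpha> \<theta> y)"
        using norm_triangle_ineq[of "(-1) ^ length \<alpha> * (?R - ?I)" "?J - Dl \<alpha> \<theta> y"]
        by (simp add: norm_mult norm_power)
      then have "wt y ^ m * norm (Dl \<alpha> (\<lambda>y. S y - \<theta> y) y) \<le> wt y ^ m * (norm (?R - ?I) + norm (?J - Dl \<alpha> \<theta> y))"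
        by (rule mult_left_mono) (rule wt_power_nonneg)
      also have "\<dots> \<le> (1 + K) * \<epsilon>"
        using 1 2 by (simp add: distrib_left distrib_right)
      finally show "wt y ^ m * norm (Dl \<alpha> (\<lambda>y. S y - \<theta> y) y) \<le> (1 + K) * \<epsilon>" .
    qed
    from ext_bound[OF schwartz_diff[OF sS s\<theta>] this]
    have diff: "norm (ext T S - T \<theta>) \<le> C * ((1 + K) * \<epsilon>)"
      unfolding ext_diff[OF sS s\<theta>] ext_test[OF \<theta>U] .
    have "ext T S = (\<Sum>q\<in>p. (of_real (measure lborel (snd q)) * \<theta> (fst q)) * conv ?\<phi> (fst q))"
      unfolding S_def by (rule ext_sum[OF finp schwartz_reflect[OF s\<phi>]])
    also have "norm \<dots> \<le> (\<Sum>q\<in>p. measure lborel (snd q) * (A * (\<bar>D\<bar> * \<epsilon>)))"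
    proof (rule sum_norm_le)
      fix q assume "q \<in> p"
      have "norm (\<theta> (fst q)) * norm (conv ?\<phi> (fst q)) \<le> A * (\<bar>D\<bar> * \<epsilon>)"
      \<comment> \<open>Tags outside the support of \<open>\<theta>\<close> contribute nothing, and
        all others lie in \<open>\<Omega>\<close>, where the net is known to be small.\<close>
      proof (cases "\<theta> (fst q) = 0")
        case False
        then have "fst q \<in> \<Omega>"
          using \<theta> closure_subset[of "{x. \<theta> x \<noteq> 0}"] by (auto simp: test_fun_def tsupp_def)
        then have "norm (conv ?\<phi> (fst q)) \<le> D * \<epsilon>" by (rule small(2)[OF e(1,2)])
        also have "\<dots> \<le> \<bar>D\<bar> * \<epsilon>" using e by (intro mult_right_mono) auto
        finally show ?thesis using A by (intro mult_mono) auto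
      qed (use A e in simp)
      then show "norm ((of_real (measure lborel (snd q)) * \<theta> (fst q)) * conv ?\<phi> (fst q)) \<le> measure lborel (snd q) * (A * (\<bar>D\<bar> * \<epsilon>))"
        by (simp add: norm_mult mult.assoc mult_left_mono)
    qed
    also have "\<dots> = ?V * (A * (\<bar>D\<bar> * \<epsilon>))"
      using additive_content_tagged_division[OF p(1)] by (simp add: case_prod_unfold flip: sum_distrib_right)
    finally have "norm (ext T S) \<le> ?V * (A * (\<bar>D\<bar> * \<epsilon>))" .
    with diff have "norm (T \<theta>) \<le> ?V * (A * (\<bar>D\<bar> * \<epsilon>)) + C * ((1 + K) * \<epsilon>)"
      using norm_triangle_ineq4[of "ext T S" "ext T S - T \<theta>"] by simp
    also have "\<dots> = (?V * A * \<bar>D\<bar> + C * (1 + K)) * \<epsilon>" by (simp add: algebra_simps)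
    finally show ?thesis .
  qed
  \<comment> \<open>Half the minimum lies strictly below \<open>\<epsilon>0\<close>; scaling
    \<open>t\<close> by it covers the unit interval that \<open>norm_le_linear_imp_zero\<close>
    expects.\<close>
  define e1 where "e1 = min \<epsilon>0 1 / 2"
  have e1: "0 < e1" "e1 < \<epsilon>0" "e1 \<le> 1" using small(1) by (auto simp: e1_def min_def)
  show ?thesis
  proof (rule norm_le_linear_imp_zero)
    fix t :: real assume t: "0 < t" "t \<le> 1"
    have "t * e1 \<le> e1" "0 < t * e1" using t e1 by (simp_all add: mult_left_le_one_le)
    then have "0 < t * e1" "t * e1 < \<epsilon>0" "t * e1 \<le> 1" using e1 by linarith+
    then have "norm (T \<theta>) \<le> (?V * A * \<bar>D\<bar> + C * (1 + K)) * (t * e1)"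
      by (rule main)
    then show "norm (T \<theta>) \<le> ((?V * A * \<bar>D\<bar> + C * (1 + K)) * e1) * t" by (simp add: mult_ac)
  qed
qed

end

section \<open>The net of a distribution: moderateness, linearity and injectivity\<close>

lemma mollifier_eq_dilate: "mollifier \<psi> \<epsilon> = dilate (inv_fourier \<psi>) \<epsilon>"
  by (simp add: mollifier_def[abs_def] dilate_def[abs_def])

lemma colombeau_net_eq_ext:
  "colombeau_net E \<psi> u \<epsilon> x = ext (E u) (\<lambda>y. dilate (inv_fourier \<psi>) \<epsilon> (x - y))"
  by (simp add: colombeau_net_def tconv_eq_ext mollifier_eq_dilate)

text \<open>\<open>ext\<close> evaluates its functional only at truncations of \<open>g\<close>,
  which are test functions.\<close>

lemma ext_dist_eq:
  assumes "dist_eq UNIV S T" "schwartz g"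
  shows "ext S g = ext T g"
  using assms unfolding ext_def dist_eq_def by (simp add: test_fun_mult test_fun_cut schwartz_smooth)

lemma moderate_cong:
  assumes "\<And>\<epsilon>. 0 < \<epsilon> \<Longrightarrow> \<epsilon> \<le> 1 \<Longrightarrow> u \<epsilon> = v \<epsilon>" "moderate \<Omega> v"
  shows "moderate \<Omega> u"
  unfolding moderate_def
proof (intro conjI ballI allI)
  fix \<epsilon> :: real assume "\<epsilon> \<in> {0<..1}"
  then show "smooth_closure \<Omega> (u \<epsilon>)" using assms unfolding moderate_def by auto
next
  fix k :: nat
  obtain a C e where e: "e > 0" "\<And>\<epsilon> \<beta> x. 0 < \<epsilon> \<and> \<epsilon> < e \<Longrightarrow> length \<beta> \<le> k \<and> x \<in> \<Omega> \<Longrightarrow> norm (Dl \<beta> (v \<epsilon>) x) \<le> C * \<epsilon> powr a"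
    using assms(2) unfolding moderate_def by meson
  show "\<exists>a C. \<exists>\<epsilon>0>0. \<forall>\<epsilon>. 0 < \<epsilon> \<and> \<epsilon> < \<epsilon>0 \<longrightarrow> (\<forall>\<beta> x. length \<beta> \<le> k \<and> x \<in> \<Omega> \<longrightarrow> norm (Dl \<beta> (u \<epsilon>) x) \<le> C * \<epsilon> powr a)"
    by (rule exI[of _ a], rule exI[of _ C], rule exI[of _ "min e 1"]) (use e assms(1) in simp)
qed

lemma negligible_zero:
  assumes "\<And>\<epsilon>. 0 < \<epsilon> \<Longrightarrow> \<epsilon> \<le> 1 \<Longrightarrow> u \<epsilon> = (\<lambda>x. 0)"
  shows "negligible \<Omega> u"
proof -
  have bnd: "\<exists>C. \<exists>\<epsilon>0>0. \<forall>\<epsilon>. 0 < \<epsilon> \<and> \<epsilon> < \<epsilon>0 \<longrightarrow> (\<forall>\<beta> x. length \<beta> \<le> k \<and> x \<in> \<Omega> \<longrightarrow> norm (Dl \<beta> (u \<epsilon>) x) \<le> C * \<epsilon> powr a)" for k a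
    by (rule exI[of _ 0], rule exI[of _ 1]) (simp add: assms)
  have "smooth_closure \<Omega> (u \<epsilon>)" if "\<epsilon> \<in> {0<..1}" for \<epsilon>
    using that by (simp add: assms smooth_imp_smooth_closure)
  then show ?thesis unfolding negligible_def moderate_def using bnd by blast
qed

locale colombeau_embedding = extension_operator \<Omega> \<Omega>' E
  for \<Omega> \<Omega>' :: "(real^'n::finite) set" and E :: "'n distr \<Rightarrow> 'n distr" +
  fixes \<psi> :: "real^'n \<Rightarrow> complex"
  assumes psi: "schwartz \<psi>" and psi_0: "\<psi> 0 = 1"
begin

lemmas phi = schwartz_inv_fourier[OF psi] Dl_commutes_inv_fourier[OF psi]

lemma integral_phi: "integral\<^sup>L lborel (inv_fourier \<psi>) = 1"
  using integral_inv_fourier[OF psi] psi_0 by simp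

lemma colombeau_net_moderate:
  assumes u: "Fprime \<Omega> \<Omega>' u"
  shows "moderate \<Omega> (colombeau_net E \<psi> u)"
proof -
  obtain m N C where "tempered_functional (E u) m N C" using E_tempered[OF u] .
  then interpret tempered_functional "E u" m N C .
  show ?thesis
    by (rule moderate_cong[OF _ moderate_conv_dilate[OF bounded_\<Omega> phi]])
      (simp add: colombeau_net_eq_ext fun_eq_iff)
qed

text \<open>Linearity holds exactly for each \<open>\<epsilon> > 0\<close>, not merely modulo
  negligible nets: the limits that define the two convolutions can be combined.\<close>

lemma colombeau_net_lin:
  assumes u: "Fprime \<Omega> \<Omega>' u" and v: "Fprime \<Omega> \<Omega>' v" and e: "\<epsilon> > 0"
  shows "colombeau_net E \<psi> (\<lambda>\<phi>. a * u \<phi> + b * v \<phi>) \<epsilon> x = a * colombeau_net E \<psi> u \<epsilon> x + b * colombeau_net E \<psi> v \<epsilon> x"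
proof -
  let ?g = "\<lambda>y. dilate (inv_fourier \<psi>) \<epsilon> (x - y)"
  have g: "schwartz ?g" by (intro schwartz_reflect schwartz_dilate phi e)
  obtain m1 N1 C1 where "tempered_functional (E u) m1 N1 C1" using E_tempered[OF u] .
  then interpret u: tempered_functional "E u" m1 N1 C1 .
  obtain m2 N2 C2 where "tempered_functional (E v) m2 N2 C2" using E_tempered[OF v] .
  then interpret v: tempered_functional "E v" m2 N2 C2 .
  have "ext (\<lambda>\<phi>. a * E u \<phi> + b * E v \<phi>) ?g = a * ext (E u) ?g + b * ext (E v) ?g"
    unfolding ext_def[of "\<lambda>\<phi>. a * E u \<phi> + b * E v \<phi>"]
    by (rule limI) (intro tendsto_intros u.ext_limit v.ext_limit g)
  then show ?thesis
    unfolding colombeau_net_eq_ext ext_dist_eq[OF E_lin[OF u v] g] .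
qed

lemma colombeau_net_injective:
  assumes u: "Fprime \<Omega> \<Omega>' u" and v: "Fprime \<Omega> \<Omega>' v"
    and neg: "negligible \<Omega> (\<lambda>\<epsilon> x. colombeau_net E \<psi> u \<epsilon> x - colombeau_net E \<psi> v \<epsilon> x)"
  shows "dist_eq \<Omega> u v"
proof -
  \<comment> \<open>The difference is written as a linear combination so that
    \<open>Fprime_lin\<close> and \<open>colombeau_net_lin\<close> apply verbatim; its net is the
    given negligible difference.\<close>
  let ?z = "\<lambda>\<phi>. 1 * u \<phi> + (-1) * v \<phi>"
  have z: "Fprime \<Omega> \<Omega>' ?z" by (rule Fprime_lin[OF open_\<Omega> bounded_\<Omega> u v])
  obtain m N C where "tempered_functional (E ?z) m N C" using E_tempered[OF z] .
  then interpret tempered_functional "E ?z" m N C .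
  \<comment> \<open>Negligibility is instantiated at derivative order 0 and exponent 1, which is the
    linear rate required by \<open>functional_zero_of_conv_small\<close>.\<close>
  obtain D e0 where e0: "e0 > 0" and D: "\<And>\<epsilon> \<beta> x. 0 < \<epsilon> \<and> \<epsilon> < e0 \<Longrightarrow> length \<beta> \<le> 0 \<and> x \<in> \<Omega> \<Longrightarrow>
      norm (Dl \<beta> (\<lambda>x. colombeau_net E \<psi> u \<epsilon> x - colombeau_net E \<psi> v \<epsilon> x) x) \<le> D * \<epsilon> powr 1"
    using neg unfolding negligible_def by meson
  have small: "norm (conv (dilate (inv_fourier \<psi>) \<epsilon>) x) \<le> D * \<epsilon>" if "0 < \<epsilon>" "\<epsilon> < e0" "x \<in> \<Omega>" for \<epsilon> x
    using D[of \<epsilon> "[]" x] that colombeau_net_lin[OF u v, of \<epsilon> 1 "-1" x]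
    by (simp flip: colombeau_net_eq_ext)
  have "?z \<theta> = 0" if \<theta>: "test_fun \<Omega> \<theta>" for \<theta>
  proof -
    have "E ?z \<theta> = 0"
      by (rule functional_zero_of_conv_small[OF \<theta> phi integral_phi e0 small])
    then show ?thesis using E_ext[OF z] \<theta> unfolding dist_eq_def by metis
  qed
  then show ?thesis by (simp add: dist_eq_def)
qed

end

text \<open>The quotient algebra is expressed through representatives: equality of classes is
  negligibility of a difference of nets, and equality in the domain is
  \<open>dist_eq \<Omega>\<close>.\<close>

theorem theorem3p8:
  fixes \<Omega> \<Omega>' :: "(real^'n::finite) set"
    and E :: "'n distr \<Rightarrow> 'n distr"
    and \<psi> :: "real^'n \<Rightarrow> complex"
  assumes dom: "smooth_domain \<Omega>"
    and sub: "open \<Omega>'" "compact (closure \<Omega>')" "closure \<Omega>' \<subseteq> \<Omega>"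
    (* E is a map on (classes of) distributions, linear on F'(Omega) *)
    and E_wd: "\<And>u v. Fprime \<Omega> \<Omega>' u \<Longrightarrow> Fprime \<Omega> \<Omega>' v \<Longrightarrow> dist_eq \<Omega> u v \<Longrightarrow>
                 dist_eq UNIV (E u) (E v)"
    and E_lin: "\<And>u v a b. Fprime \<Omega> \<Omega>' u \<Longrightarrow> Fprime \<Omega> \<Omega>' v \<Longrightarrow>
                 dist_eq UNIV (E (\<lambda>\<phi>. a * u \<phi> + b * v \<phi>)) (\<lambda>\<phi>. a * E u \<phi> + b * E v \<phi>)"
    (* E maps W^{k,p}(Omega) into W^{k,p}(R^n), extending *)
    and E_sob: "\<And>k p w. sobolev \<Omega> k p w \<Longrightarrow>
                 \<exists>g. sobolev UNIV k p g \<and> dist_eq UNIV (E (fdist \<Omega> w)) (fdist UNIV g)"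
    (* ... boundedly *)
    and E_bdd: "\<And>k::nat. \<And>p. 1 \<le> p \<Longrightarrow> \<exists>C. \<forall>w g. sobolev \<Omega> (enat k) p w \<longrightarrow>
                 sobolev UNIV (enat k) p g \<longrightarrow> dist_eq UNIV (E (fdist \<Omega> w)) (fdist UNIV g) \<longrightarrow>
                 sobolev_norm UNIV k p g \<le> C * sobolev_norm \<Omega> k p w"
    (* E on E'(Omega') *)
    and E_cpt: "\<And>u. compact_distr \<Omega> \<Omega>' u \<Longrightarrow> distribution UNIV (E u) \<and>
                 (\<forall>\<phi>. test_fun UNIV \<phi> \<and> tsupp \<phi> \<inter> \<Omega> = {} \<longrightarrow> E u \<phi> = 0)"
    (* E(u)|_Omega = u *)
    and E_ext: "\<And>u. Fprime \<Omega> \<Omega>' u \<Longrightarrow> dist_eq \<Omega> (E u) u"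
    and psi: "schwartz \<psi>" "\<exists>r>0. \<forall>\<xi>\<in>ball 0 r. \<psi> \<xi> = 1"
  shows "(\<forall>u. Fprime \<Omega> \<Omega>' u \<longrightarrow> moderate \<Omega> (colombeau_net E \<psi> u))
       \<and> (\<forall>u v a b. Fprime \<Omega> \<Omega>' u \<longrightarrow> Fprime \<Omega> \<Omega>' v \<longrightarrow>
            Fprime \<Omega> \<Omega>' (\<lambda>\<phi>. a * u \<phi> + b * v \<phi>) \<and>
            negligible \<Omega> (\<lambda>\<epsilon> x. colombeau_net E \<psi> (\<lambda>\<phi>. a * u \<phi> + b * v \<phi>) \<epsilon> x
               - (a * colombeau_net E \<psi> u \<epsilon> x + b * colombeau_net E \<psi> v \<epsilon> x)))
       \<and> (\<forall>u v. Fprime \<Omega> \<Omega>' u \<longrightarrow> Fprime \<Omega> \<Omega>' v \<longrightarrow>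
            negligible \<Omega> (\<lambda>\<epsilon> x. colombeau_net E \<psi> u \<epsilon> x - colombeau_net E \<psi> v \<epsilon> x) \<longrightarrow>
            dist_eq \<Omega> u v)"
proof -
  interpret colombeau_embedding \<Omega> \<Omega>' E \<psi>
  proof
    show "open \<Omega>" "bounded \<Omega>" using dom by (auto simp: smooth_domain_def)
    show "schwartz \<psi>" by (rule psi(1))
    show "\<psi> 0 = 1" using psi(2) by auto
  qed (fact E_wd E_lin E_sob E_cpt E_ext)+
  show ?thesis
  proof (intro conjI allI impI)
    fix u v a b assume u: "Fprime \<Omega> \<Omega>' u" and v: "Fprime \<Omega> \<Omega>' v"
    show "negligible \<Omega> (\<lambda>\<epsilon> x. colombeau_net E \<psi> (\<lambda>\<phi>. a * u \<phi> + b * v \<phi>) \<epsilon> x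
               - (a * colombeau_net E \<psi> u \<epsilon> x + b * colombeau_net E \<psi> v \<epsilon> x))"
      by (rule negligible_zero) (simp add: colombeau_net_lin[OF u v])
  qed (auto intro: colombeau_net_moderate colombeau_net_injective Fprime_lin[OF open_\<Omega> bounded_\<Omega>])
qed

end
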